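(* Let $q\in L_2(0,\pi)$ be real valued and $h,H\in\mathbb{R}$, and let $\rho_n$, $\alpha_n$, $\alpha_n^0$, $c(\rho,x)$, $F$, and the transmutation kernels $G(x,t)$ and $H(x,t)$ be as defined in the context. The kernels $G(x,t)$ and $H(x,t)$ admit the representations $$G(x,t)=\sum_{n=0}^{\infty}\left(\frac{c(n,x)\cos nt}{\alpha_n^0}-\frac{c(\rho_n,x)\cos\rho_n t}{\alpha_n}\right)$$ and $$H(x,t)=\sum_{n=0}^{\infty}\left(\frac{\cos\rho_n x\,c(\rho_n,t)}{\alpha_n}-\frac{\cos nx\,c(n,t)}{\alpha_n^0}\right),$$ where the series converge in the following distributional sense. Let the integral kernels $G(x,t)$ and $H(x,t)$ be extended by zero for $t>x$, and let $$I_N(x,t)=\sum_{n=0}^{N}\left(\frac{c(n,x)\cos nt}{\alpha_n^0}-\frac{c(\rho_n,x)\cos\rho_n t}{\alpha_n}\right),\qquad x,t\in[0,\pi].$$ Then for any $f\in AC[0,\pi]$ the following limit (which corresponds to both series representations) exists uniformly with respect to $x\in[0,\pi]$: $$\lim_{N\to\infty}\int_0^\pi f(t)I_N(x,t)\,dt=\int_0^\pi f(t)\bigl(G(x,t)-H(t,x)\bigr)\,dt=-\int_0^\pi f(t)\left(F(x,t)+\int_0^x G(x,s)F(s,t)\,ds\right)dt.$$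
   Context: Let $q\in L_2(0,\pi)$ be real valued and let $h$, $H$ be real numbers (the constant $H$ is not to be confused with the kernel $H(x,t)$ below). For $\rho\in\mathbb{C}$, $c(\rho,x)$ denotes the solution on $[0,\pi]$ of the Cauchy problem $-c''(\rho,x)+q(x)c(\rho,x)=\rho^2c(\rho,x)$, $c(\rho,0)=1$, $c'(\rho,0)=h$ (prime is the derivative in $x$; $c(n,x)$ means $c(\rho,x)$ with $\rho=n$). Consider the Sturm-Liouville problem $-y''+q(x)y=\lambda y$ on $(0,\pi)$, $y'(0)-hy(0)=0$, $y'(\pi)+Hy(\pi)=0$. Its eigenvalues are real and simple and are enumerated in increasing order as $\{\lambda_n\}_{n=0}^\infty$; put $\rho_n:=\sqrt{\lambda_n}$ (possibly purely imaginary for finitely many $n$; all expressions used are even in $\rho_n$). The weight numbers are $\alpha_n:=\int_0^\pi c^2(\rho_n,x)\,dx>0$. With $\omega:=h+H+\frac12\int_0^\pi q(t)\,dt$, the known asymptotics are $\rho_n=n+\frac{\omega}{\pi n}+\frac{k_n}{n}$ and $\alpha_n=\frac{\pi}{2}+\frac{K_n}{n}$ ($n\ge1$) with $\{k_n\},\{K_n\}\in\ell_2$. Put $\alpha_n^0=\pi/2$ for $n>0$ and $\alpha_0^0=\pi$. The function $F$ is $$F(x,t)=\sum_{n=0}^\infty\left(\frac{\cos\rho_n x\cos\rho_n t}{\alpha_n}-\frac{\cos nx\cos nt}{\alpha_n^0}\right),\qquad x,t\in[0,\pi].$$ The kernel $G(x,t)$, continuous on $0\le t\le x\le\pi$, is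 the integral kernel of the transmutation operator $T[u](x)=u(x)+\int_0^xG(x,s)u(s)\,ds$, which satisfies $T[\cos\rho x]=c(\rho,x)$ for all $\rho\in\mathbb{C}$ and relates $L=\frac{d^2}{dx^2}-q(x)$ to $B=\frac{d^2}{dx^2}$ by $LTu=TBu$ for $u\in C^2[0,\pi]$ with $u'(0)=0$. It satisfies the Gel'fand-Levitan equation $G(x,t)+F(x,t)+\int_0^xF(t,s)G(x,s)\,ds=0$ for $0\le t<x$. The kernel $H(x,t)$, continuous on $0\le t\le x\le\pi$, is the integral kernel of the inverse operator, $T^{-1}[u](x)=u(x)+\int_0^xH(x,s)u(s)\,ds$. It satisfies $H(x,t)-F(x,t)-\int_0^tF(x,s)G(t,s)\,ds=0$ for $0\le t<x$. *)

theory Defs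
  imports "HOL-Analysis.Analysis"
begin

definition abs_cont_on :: "real \<Rightarrow> real \<Rightarrow> (real \<Rightarrow> complex) \<Rightarrow> bool" where
  "abs_cont_on a b f \<longleftrightarrow>
     (\<forall>\<epsilon>>0. \<exists>\<delta>>0. \<forall>D. finite D \<longrightarrow>
        (\<forall>(u,v)\<in>D. a \<le> u \<and> u < v \<and> v \<le> b) \<longrightarrow>
        disjoint_family_on (\<lambda>(u,v). {u<..<v}) D \<longrightarrow>
        (\<Sum>(u,v)\<in>D. v - u) < \<delta> \<longrightarrow>
        (\<Sum>(u,v)\<in>D. norm (f v - f u)) < \<epsilon>)"

definition L2_0pi :: "(real \<Rightarrow> real) \<Rightarrow> bool" where
  "L2_0pi q \<longleftrightarrow> q \<in> borel_measurable (lebesgue_on {0<..<pi}) \<and>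
     integrable (lebesgue_on {0<..<pi}) (\<lambda>x. (q x)\<^sup>2)"

definition dx :: "(real \<Rightarrow> complex) \<Rightarrow> real \<Rightarrow> complex" where
  "dx y x = vector_derivative y (at x within {0..pi})"

text \<open>The relation $y'' - q\,y = g$ on $(0,\pi)$ in the Caratheodory sense, as is needed for a
  potential that is only square integrable: $y$ and $y'$ are absolutely continuous on the closed
  interval and the equation holds almost everywhere.\<close>

definition sl_eq :: "(real \<Rightarrow> real) \<Rightarrow> (real \<Rightarrow> complex) \<Rightarrow> (real \<Rightarrow> complex) \<Rightarrow> bool" where
  "sl_eq q y g \<longleftrightarrow>
     (\<forall>x\<in>{0..pi}. y differentiable (at x within {0..pi})) \<and>
     abs_cont_on 0 pi (dx y) \<and>
     (AE x in lebesgue_on {0<..<pi}.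
        (dx y has_vector_derivative (complex_of_real (q x) * y x + g x)) (at x))"

definition cauchy_solution ::
  "(real \<Rightarrow> real) \<Rightarrow> real \<Rightarrow> complex \<Rightarrow> (real \<Rightarrow> complex) \<Rightarrow> bool" where
  "cauchy_solution q h \<rho> y \<longleftrightarrow>
     sl_eq q y (\<lambda>x. - (\<rho>\<^sup>2 * y x)) \<and> y 0 = 1 \<and> dx y 0 = complex_of_real h"

definition sl_eigenvalue :: "(real \<Rightarrow> real) \<Rightarrow> real \<Rightarrow> real \<Rightarrow> complex \<Rightarrow> bool" where
  "sl_eigenvalue q h H \<mu> \<longleftrightarrow>
     (\<exists>y. sl_eq q y (\<lambda>x. - (\<mu> * y x)) \<and>
          dx y 0 - complex_of_real h * y 0 = 0 \<and>
          dx y pi + complex_of_real H * y pi = 0 \<and>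
          (\<exists>x\<in>{0..pi}. y x \<noteq> 0))"

definition eigenvalue_enumeration ::
  "(real \<Rightarrow> real) \<Rightarrow> real \<Rightarrow> real \<Rightarrow> (nat \<Rightarrow> real) \<Rightarrow> bool" where
  "eigenvalue_enumeration q h H lam \<longleftrightarrow>
     strict_mono lam \<and> range (\<lambda>n. complex_of_real (lam n)) = {\<mu>. sl_eigenvalue q h H \<mu>}"

definition rho :: "(nat \<Rightarrow> real) \<Rightarrow> nat \<Rightarrow> complex" where
  "rho lam n = csqrt (complex_of_real (lam n))"

definition alpha :: "(complex \<Rightarrow> real \<Rightarrow> complex) \<Rightarrow> (nat \<Rightarrow> real) \<Rightarrow> nat \<Rightarrow> complex" where
  "alpha c lam n = integral {0..pi} (\<lambda>x. (c (rho lam n) x)\<^sup>2)"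

definition alpha0 :: "nat \<Rightarrow> complex" where
  "alpha0 n = complex_of_real (if n = 0 then pi else pi / 2)"

definition kernel_F ::
  "(complex \<Rightarrow> real \<Rightarrow> complex) \<Rightarrow> (nat \<Rightarrow> real) \<Rightarrow> real \<Rightarrow> real \<Rightarrow> complex" where
  "kernel_F c lam x t =
     (\<Sum>n. cos (rho lam n * of_real x) * cos (rho lam n * of_real t) / alpha c lam n
         - cos (of_nat n * of_real x) * cos (of_nat n * of_real t) / alpha0 n)"

definition partial_I ::
  "(complex \<Rightarrow> real \<Rightarrow> complex) \<Rightarrow> (nat \<Rightarrow> real) \<Rightarrow> nat \<Rightarrow> real \<Rightarrow> real \<Rightarrow> complex" where
  "partial_I c lam N x t =
     (\<Sum>n\<le>N. c (of_nat n) x * cos (of_nat n * of_real t) / alpha0 n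
          - c (rho lam n) x * cos (rho lam n * of_real t) / alpha c lam n)"

definition volterra ::
  "(real \<Rightarrow> real \<Rightarrow> complex) \<Rightarrow> (real \<Rightarrow> complex) \<Rightarrow> real \<Rightarrow> complex" where
  "volterra K u x = u x + integral {0..x} (\<lambda>s. K x s * u s)"

definition continuous_kernel :: "(real \<Rightarrow> real \<Rightarrow> complex) \<Rightarrow> bool" where
  "continuous_kernel K \<longleftrightarrow>
     continuous_on {(x, t). 0 \<le> t \<and> t \<le> x \<and> x \<le> pi} (\<lambda>(x, t). K x t)"

text \<open>The last conjunct is the intertwining relation $L T u = T B u$, with
  $L = d^2/dx^2 - q$ and $B = d^2/dx^2$, for $u \in C^2[0,\pi]$ with $u'(0) = 0$.\<close>

definition transmutation_kernel ::
  "(real \<Rightarrow> real) \<Rightarrow> (complex \<Rightarrow> real \<Rightarrow> complex) \<Rightarrow> (real \<Rightarrow> real \<Rightarrow> complex) \<Rightarrow> bool" where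
  "transmutation_kernel q c G \<longleftrightarrow>
     continuous_kernel G \<and>
     (\<forall>\<rho>. \<forall>x\<in>{0..pi}. volterra G (\<lambda>s. cos (\<rho> * of_real s)) x = c \<rho> x) \<and>
     (\<forall>u u' u''.
        (\<forall>x\<in>{0..pi}. (u has_vector_derivative u' x) (at x within {0..pi})) \<longrightarrow>
        (\<forall>x\<in>{0..pi}. (u' has_vector_derivative u'' x) (at x within {0..pi})) \<longrightarrow>
        continuous_on {0..pi} u'' \<longrightarrow> u' 0 = 0 \<longrightarrow>
        sl_eq q (volterra G u) (volterra G u''))"

definition inverse_kernel ::
  "(real \<Rightarrow> real \<Rightarrow> complex) \<Rightarrow> (real \<Rightarrow> real \<Rightarrow> complex) \<Rightarrow> bool" where
  "inverse_kernel G K \<longleftrightarrow>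
     continuous_kernel K \<and>
     (\<forall>u. continuous_on {0..pi} u \<longrightarrow>
        (\<forall>x\<in>{0..pi}. volterra K (volterra G u) x = u x \<and> volterra G (volterra K u) x = u x))"

definition ext0 :: "(real \<Rightarrow> real \<Rightarrow> complex) \<Rightarrow> real \<Rightarrow> real \<Rightarrow> complex" where
  "ext0 K x t = (if t \<le> x then K x t else 0)"

end

theory Submission
  imports Defs "HOL-Complex_Analysis.Complex_Analysis"
begin

text \<open>
  Write $T$ for the transmutation operator and $c_n = c(\rho_n,\cdot)$. Since $T$ maps
  $\cos\rho x$ to $c(\rho,x)$, the integral $\int f I_N\,dt$ is $-T$ applied to the partial sums of
  $\int f(t) F(x,t)\,dt$. The asymptotics $\rho_n = n + \kappa/n + \epsilon_n$ with
  $\sum|\epsilon_n| < \infty$ and $\sum|\alpha_n - \pi/2| < \infty$, both consequences of Bessel's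
  inequality, reduce the series of $F$ to $\sum \sin(ny)/n$ plus an absolutely convergent series.
  Hence its partial sums are bounded and converge pointwise, and for continuous $f$ the series of
  $\int f(t) F(x,t)\,dt$ converges uniformly by the M-test. So the limit $W$ of $\int f I_N\,dt$
  exists uniformly and is given by the expression in $F$.

  To identify $W$, let $g(x) = f(x) + \int_x^\pi H(t,x) f(t)\,dt$, where
  the kernel $H$ is \<open>K\<close> in the formal text. Because
  $\int f\cos\rho_n t\,dt = \int g\,c_n\,dx$, orthogonality of the $c_n$ and Parseval's formula for the
  cosine series show that $Tf - W - g$ is orthogonal to every $c_m$. The eigenfunctions are complete:
  if $u \perp c_m$ for all $m$, then $\int u\,c(\rho,\cdot)\,dx$ divided by the characteristic function is
  entire in $\rho^2$ and tends to zero on the circles $|\rho| = N + \frac12$, so it vanishes. The same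
  circles and Rouche's theorem locate the $n$-th eigenvalue. Therefore
  $W = Tf - g = \int f(t) (G(x,t) - H(t,x))\,dt$.
\<close>

section \<open>Absolutely continuous functions\<close>

text \<open>The asymptotics of eigenvalues and weight numbers are not hypotheses; they are extracted
  from \<open>eigenvalue_enumeration\<close>, which says only that \<open>lam\<close> lists the
  eigenvalues in increasing order. Rouche's theorem has to supply the numbering, and its count is a
  count of eigenvalues because all zeros of the characteristic function are simple: its derivative
  at an eigenvalue is a nonzero multiple of the weight number, which is positive. The potential is
  only square integrable, so solutions satisfy the equation almost everywhere; the Wronskian
  identity behind Duhamel's formula, uniqueness and orthogonality therefore rests on a fundamental
  theorem for absolutely continuous functions. Growth and analyticity in rho come from the
  representation of \<open>c\<close> by \<open>volterra G\<close>, which turns integrals against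
  \<open>c\<close> into cosine transforms; the variable z = rho^2 removes the sign of rho.
  \<open>K\<close> is linked to \<open>G\<close> only by \<open>inverse_kernel\<close>, which is why
  the limit is identified through completeness of the eigenfunctions and not read off from an
  equation between the kernels.\<close>

lemma abs_cont_on_imp_continuous_on:
  assumes "abs_cont_on a b f"
  shows "continuous_on {a..b} f"
  unfolding continuous_on_iff
proof (intro ballI allI impI)
  fix x e :: real assume x: "x \<in> {a..b}" and "e > 0"
  then obtain d where "d > 0" and d: "\<And>D. finite D \<Longrightarrow>
        (\<forall>(u,v)\<in>D. a \<le> u \<and> u < v \<and> v \<le> b) \<Longrightarrow>
        disjoint_family_on (\<lambda>(u,v). {u<..<v}) D \<Longrightarrow>
        (\<Sum>(u,v)\<in>D. v - u) < d \<Longrightarrow> (\<Sum>(u,v)\<in>D. norm (f v - f u)) < e"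
    using assms unfolding abs_cont_on_def by meson
  show "\<exists>d>0. \<forall>x'\<in>{a..b}. dist x' x < d \<longrightarrow> dist (f x') (f x) < e"
  proof (intro exI conjI ballI impI)
    fix y assume y: "y \<in> {a..b}" "dist y x < d"
    consider "y = x" | "x < y" | "y < x" by linarith
    then show "dist (f y) (f x) < e"
    proof cases
      case 1 then show ?thesis using \<open>e > 0\<close> by simp
    next
      case 2
      then show ?thesis using d[of "{(x,y)}"] x y
        by (simp add: disjoint_family_on_def dist_norm dist_real_def)
    next
      case 3
      then show ?thesis using d[of "{(y,x)}"] x y
        by (simp add: disjoint_family_on_def dist_norm dist_real_def norm_minus_commute)
    qed
  qed (use \<open>d > 0\<close> in auto)
qed

lemma Lipschitz_imp_abs_cont_on:
  assumes "\<And>x y. x \<in> {a..b} \<Longrightarrow> y \<in> {a..b} \<Longrightarrow> norm (f y - f x) \<le> B * \<bar>y - x\<bar>"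
  shows "abs_cont_on a b f"
  unfolding abs_cont_on_def
proof (intro allI impI)
  fix e :: real assume "e > 0"
  \<comment> \<open>The added 1 keeps the denominator positive when \<open>B\<close> is 0.\<close>
  define d where "d = e / (\<bar>B\<bar> + 1)"
  have "d > 0" using \<open>e > 0\<close> unfolding d_def by (simp add: field_simps add_pos_nonneg)
  show "\<exists>\<delta>>0. \<forall>D. finite D \<longrightarrow>
        (\<forall>(u,v)\<in>D. a \<le> u \<and> u < v \<and> v \<le> b) \<longrightarrow>
        disjoint_family_on (\<lambda>(u,v). {u<..<v}) D \<longrightarrow>
        (\<Sum>(u,v)\<in>D. v - u) < \<delta> \<longrightarrow> (\<Sum>(u,v)\<in>D. norm (f v - f u)) < e"
  proof (intro exI conjI allI impI)
    fix D assume D: "finite D" "\<forall>(u,v)\<in>D. a \<le> u \<and> u < v \<and> v \<le> b" "(\<Sum>(u,v)\<in>D. v - u) < d"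
    have "(\<Sum>(u,v)\<in>D. norm (f v - f u)) \<le> (\<Sum>(u,v)\<in>D. (\<bar>B\<bar> + 1) * (v - u))"
    proof (intro sum_mono, clarify)
      fix u v assume "(u, v) \<in> D"
      then have uv: "a \<le> u" "u < v" "v \<le> b" using D(2) by auto
      have "norm (f v - f u) \<le> B * \<bar>v - u\<bar>" using uv by (intro assms) auto
      also have "\<dots> \<le> (\<bar>B\<bar> + 1) * (v - u)" using uv by (simp add: mult_right_mono)
      finally show "norm (f v - f u) \<le> (\<bar>B\<bar> + 1) * (v - u)" .
    qed
    also have "\<dots> = (\<bar>B\<bar> + 1) * (\<Sum>(u,v)\<in>D. v - u)" by (simp add: sum_distrib_left split_beta)
    also have "\<dots> < (\<bar>B\<bar> + 1) * d" using D(3) by (intro mult_strict_left_mono) auto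
    also have "\<dots> = e" unfolding d_def by simp
    finally show "(\<Sum>(u,v)\<in>D. norm (f v - f u)) < e" .
  qed (use \<open>d > 0\<close> in auto)
qed

text \<open>A single estimate of increments serves for differences, products and complex conjugates
  alike.\<close>

lemma abs_cont_on_dominated:
  assumes "abs_cont_on a b f" "abs_cont_on a b g"
    and "\<And>x y. x \<in> {a..b} \<Longrightarrow> y \<in> {a..b} \<Longrightarrow>
           norm (k y - k x) \<le> A * norm (f y - f x) + B * norm (g y - g x)"
  shows "abs_cont_on a b k"
  unfolding abs_cont_on_def
proof (intro allI impI)
  fix e :: real assume "e > 0"
  define M where "M = \<bar>A\<bar> + \<bar>B\<bar> + 1"
  have "M > 0" unfolding M_def by auto
  then have "e / (2 * M) > 0" using \<open>e > 0\<close> by simp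
  then obtain d1 where "d1 > 0" and d1: "\<And>D. finite D \<Longrightarrow>
        (\<forall>(u,v)\<in>D. a \<le> u \<and> u < v \<and> v \<le> b) \<Longrightarrow>
        disjoint_family_on (\<lambda>(u,v). {u<..<v}) D \<Longrightarrow>
        (\<Sum>(u,v)\<in>D. v - u) < d1 \<Longrightarrow> (\<Sum>(u,v)\<in>D. norm (f v - f u)) < e / (2 * M)"
    using assms(1) unfolding abs_cont_on_def by meson
  obtain d2 where "d2 > 0" and d2: "\<And>D. finite D \<Longrightarrow>
        (\<forall>(u,v)\<in>D. a \<le> u \<and> u < v \<and> v \<le> b) \<Longrightarrow>
        disjoint_family_on (\<lambda>(u,v). {u<..<v}) D \<Longrightarrow>
        (\<Sum>(u,v)\<in>D. v - u) < d2 \<Longrightarrow> (\<Sum>(u,v)\<in>D. norm (g v - g u)) < e / (2 * M)"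
    using assms(2) \<open>e / (2 * M) > 0\<close> unfolding abs_cont_on_def by meson
  show "\<exists>\<delta>>0. \<forall>D. finite D \<longrightarrow>
        (\<forall>(u,v)\<in>D. a \<le> u \<and> u < v \<and> v \<le> b) \<longrightarrow>
        disjoint_family_on (\<lambda>(u,v). {u<..<v}) D \<longrightarrow>
        (\<Sum>(u,v)\<in>D. v - u) < \<delta> \<longrightarrow> (\<Sum>(u,v)\<in>D. norm (k v - k u)) < e"
  proof (intro exI conjI allI impI)
    show "min d1 d2 > 0" using \<open>d1 > 0\<close> \<open>d2 > 0\<close> by simp
    fix D assume D: "finite D" "\<forall>(u,v)\<in>D. a \<le> u \<and> u < v \<and> v \<le> b"
      "disjoint_family_on (\<lambda>(u,v). {u<..<v}) D" "(\<Sum>(u,v)\<in>D. v - u) < min d1 d2"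
    have "(\<Sum>(u,v)\<in>D. norm (k v - k u)) \<le> (\<Sum>(u,v)\<in>D. M * norm (f v - f u) + M * norm (g v - g u))"
    proof (intro sum_mono, clarify)
      fix u v assume "(u, v) \<in> D"
      then have uv: "a \<le> u" "u < v" "v \<le> b" using D(2) by auto
      have "norm (k v - k u) \<le> A * norm (f v - f u) + B * norm (g v - g u)"
        using uv by (intro assms) auto
      also have "\<dots> \<le> M * norm (f v - f u) + M * norm (g v - g u)"
        by (intro add_mono mult_right_mono) (auto simp: M_def)
      finally show "norm (k v - k u) \<le> M * norm (f v - f u) + M * norm (g v - g u)" .
    qed
    also have "\<dots> = M * (\<Sum>(u,v)\<in>D. norm (f v - f u)) + M * (\<Sum>(u,v)\<in>D. norm (g v - g u))"
      by (simp add: sum_distrib_left split_beta sum.distrib)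
    also have "\<dots> < M * (e / (2 * M)) + M * (e / (2 * M))"
      using D d1[of D] d2[of D] \<open>M > 0\<close> by (intro add_strict_mono mult_strict_left_mono) auto
    also have "\<dots> = e" using \<open>M > 0\<close> by (simp add: field_simps)
    finally show "(\<Sum>(u,v)\<in>D. norm (k v - k u)) < e" .
  qed
qed

lemma abs_cont_on_diff:
  assumes "abs_cont_on a b f" "abs_cont_on a b g"
  shows "abs_cont_on a b (\<lambda>x. f x - g x)"
proof (rule abs_cont_on_dominated[OF assms, where A=1 and B=1])
  fix x y
  have "f y - g y - (f x - g x) = (f y - f x) - (g y - g x)" by simp
  then show "norm (f y - g y - (f x - g x)) \<le> 1 * norm (f y - f x) + 1 * norm (g y - g x)"
    by (metis mult_1 norm_triangle_ineq4)
qed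

lemma abs_cont_on_mult:
  assumes "abs_cont_on a b f" "abs_cont_on a b g"
  shows "abs_cont_on a b (\<lambda>x. f x * g x)"
proof -
  have bdd: "\<exists>B. \<forall>x\<in>{a..b}. norm (u x) \<le> B" if "abs_cont_on a b u" for u
  proof -
    have "compact (u ` {a..b})"
      using abs_cont_on_imp_continuous_on[OF that] by (intro compact_continuous_image) auto
    then show ?thesis using compact_imp_bounded bounded_iff by (metis imageI)
  qed
  obtain A where A: "\<And>x. x \<in> {a..b} \<Longrightarrow> norm (f x) \<le> A" using bdd[OF assms(1)] by metis
  obtain B where B: "\<And>x. x \<in> {a..b} \<Longrightarrow> norm (g x) \<le> B" using bdd[OF assms(2)] by metis
  show ?thesis
  proof (rule abs_cont_on_dominated[OF assms, where A=B and B=A])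
    fix x y assume xy: "x \<in> {a..b}" "y \<in> {a..b}"
    have "f y * g y - f x * g x = (f y - f x) * g y + f x * (g y - g x)" by (simp add: algebra_simps)
    then have "norm (f y * g y - f x * g x) \<le> norm (f y - f x) * norm (g y) + norm (f x) * norm (g y - g x)"
      by (metis norm_mult norm_triangle_ineq)
    also have "\<dots> \<le> B * norm (f y - f x) + A * norm (g y - g x)"
      using A[OF xy(1)] B[OF xy(2)]
      by (intro add_mono) (simp_all add: mult.commute mult_right_mono)
    finally show "norm (f y * g y - f x * g x) \<le> B * norm (f y - f x) + A * norm (g y - g x)" .
  qed
qed

lemma C1_imp_abs_cont_on:
  fixes f :: "real \<Rightarrow> complex"
  assumes der: "\<And>x. x \<in> {a..b} \<Longrightarrow> (f has_vector_derivative f' x) (at x within {a..b})"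
    and cont: "continuous_on {a..b} f'"
  shows "abs_cont_on a b f"
proof -
  have "bounded (f' ` {a..b})"
    using compact_continuous_image[OF cont] compact_imp_bounded by blast
  then obtain B where B: "\<And>x. x \<in> {a..b} \<Longrightarrow> norm (f' x) \<le> B" unfolding bounded_iff by (metis imageI)
  show ?thesis
  proof (rule Lipschitz_imp_abs_cont_on)
    fix x y assume xy: "x \<in> {a..b}" "y \<in> {a..b}"
    have "norm (f y - f x) \<le> B * norm (y - x)"
    proof (rule differentiable_bound[where S="{a..b}" and f'="\<lambda>x h. h *\<^sub>R f' x"])
      show "(f has_derivative (\<lambda>h. h *\<^sub>R f' x)) (at x within {a..b})" if "x \<in> {a..b}" for x
        using der[OF that] by (simp add: has_vector_derivative_def)
      show "onorm (\<lambda>h. h *\<^sub>R f' x) \<le> B" if "x \<in> {a..b}" for x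
      proof (rule onorm_le)
        fix h :: real
        show "norm (h *\<^sub>R f' x) \<le> B * norm h"
          using mult_right_mono[OF B[OF that], of "\<bar>h\<bar>"] by (simp add: mult.commute)
      qed
    qed (use xy in auto)
    then show "norm (f y - f x) \<le> B * \<bar>y - x\<bar>" by simp
  qed
qed

text \<open>The exceptional null set is covered by an open set of small measure; there the increments of
  an absolutely continuous function are negligible, elsewhere the gauge is as for the usual
  fundamental theorem.\<close>

theorem fundamental_theorem_of_calculus_abs_cont:
  fixes F :: "real \<Rightarrow> complex"
  assumes "a \<le> b" and ac: "abs_cont_on a b F" and N: "negligible N"
    and der: "\<And>x. x \<in> {a..b} - N \<Longrightarrow> (F has_vector_derivative f x) (at x within {a..b})"
  shows "(f has_integral (F b - F a)) {a..b}"
proof -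
  define g where "g x = (if x \<in> N then 0 else f x)" for x
  have "(g has_integral (F b - F a)) (cbox a b)"
    unfolding has_integral
  proof (intro allI impI)
    fix e :: real assume "e > 0"
    define e' where "e' = e / (4 * (b - a + 1))"
    have "e' > 0" using \<open>e > 0\<close> \<open>a \<le> b\<close> by (simp add: e'_def)
    have e': "e' * (b - a) < e / 2"
    proof -
      have "e' * (b - a) < e' * (b - a + 1)" using \<open>e' > 0\<close> by (intro mult_strict_left_mono) auto
      also have "\<dots> = e / 4" using \<open>a \<le> b\<close> by (simp add: e'_def field_simps)
      finally show ?thesis using \<open>e > 0\<close> by simp
    qed
    have "e / 2 > 0" using \<open>e > 0\<close> by simp
    then obtain d where "d > 0" and d: "\<And>D. finite D \<Longrightarrow>
          (\<forall>(u,v)\<in>D. a \<le> u \<and> u < v \<and> v \<le> b) \<Longrightarrow>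
          disjoint_family_on (\<lambda>(u,v). {u<..<v}) D \<Longrightarrow>
          (\<Sum>(u,v)\<in>D. v - u) < d \<Longrightarrow> (\<Sum>(u,v)\<in>D. norm (F v - F u)) < e / 2"
      using ac unfolding abs_cont_on_def by meson
    have "N \<in> sets lebesgue" using N by (simp add: negligible_imp_sets)
    then obtain U where U: "open U" "N \<subseteq> U" "U - N \<in> lmeasurable" "emeasure lebesgue (U - N) < ennreal d"
      using sets_lebesgue_outer_open[OF _ \<open>d > 0\<close>] by metis
    have Um: "U \<in> lmeasurable"
      using U(1,3) N by (metis Diff_partition U(2) fmeasurable.Un negligible_imp_measurable)
    have "emeasure lebesgue U = emeasure lebesgue (U - N)"
      using N U(1) by (simp add: emeasure_Diff_null_set negligible_iff_null_sets borel_open)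
    then have mU: "measure lebesgue U < d"
      using U(4) Um by (metis emeasure_eq_measure2 ennreal_less_iff measure_nonneg)
    have "\<forall>x. \<exists>r>0. x \<in> {a..b} - N \<longrightarrow>
         (\<forall>y\<in>{a..b}. norm (y-x) < r \<longrightarrow> norm (F y - F x - (y-x) *\<^sub>R f x) \<le> e' * norm (y-x))"
      using der[unfolded has_vector_derivative_def has_derivative_within_alt] \<open>e' > 0\<close> by (meson zero_less_one)
    then obtain r where r0: "\<And>x. 0 < r x" and
      r: "\<And>x y. \<lbrakk>x \<in> {a..b} - N; y \<in> {a..b}; norm (y-x) < r x\<rbrakk>
                        \<Longrightarrow> norm (F y - F x - (y-x) *\<^sub>R f x) \<le> e' * norm (y-x)"
      by metis
    \<comment> \<open>A tag in \<open>N\<close> forces its interval into \<open>U\<close>, so the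
      total length of all such intervals stays below the absolute continuity threshold
      \<open>d\<close>.\<close>
    define \<gamma> where "\<gamma> x = (if x \<in> N then U else ball x (r x))" for x
    have "gauge \<gamma>" unfolding gauge_def \<gamma>_def using U(1,2) r0 by auto
    moreover have "norm ((\<Sum>(x, k)\<in>p. measure lborel k *\<^sub>R g x) - (F b - F a)) < e"
      if p: "p tagged_division_of cbox a b" and fine: "\<gamma> fine p" for p
    proof -
      have fin: "finite p" using p by blast
      have itv: "\<exists>u v. K = {u..v} \<and> u \<le> x \<and> x \<le> v \<and> a \<le> u \<and> v \<le> b" if "(x,K) \<in> p" for x K
      proof -
        obtain u v where "K = cbox u v" using p \<open>(x,K) \<in> p\<close> by blast
        moreover have "x \<in> K" "K \<subseteq> cbox a b" using p \<open>(x,K) \<in> p\<close> by blast+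
        ultimately show ?thesis by auto
      qed
      define h where "h = (\<lambda>(x::real, K). measure lborel K *\<^sub>R g x - (F (Sup K) - F (Inf K)))"
      have sumF: "(\<Sum>(x,K)\<in>p. F(Sup K) - F(Inf K)) = F b - F a"
        and suml: "(\<Sum>(x,K)\<in>p. Sup K - Inf K) = b - a"
        using additive_tagged_division_1[where f= "\<lambda>x. x"] additive_tagged_division_1[where f= F]
            \<open>a \<le> b\<close> p by auto
      \<comment> \<open>Degenerate intervals contribute nothing and are left out: they would break
        both the strict inequality asked of the family and the injectivity of passing to end
        points.\<close>
      define P where "P = {(x,K) \<in> p. x \<in> N \<and> Inf K < Sup K}"
      have "finite P" "P \<subseteq> p" unfolding P_def using fin by (auto intro: finite_subset[OF _ fin])
      define E where "E = (\<lambda>(x::real,K::real set). (Inf K, Sup K)) ` P"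
      have inj: "inj_on (\<lambda>(x::real,K::real set). (Inf K, Sup K)) P"
      proof (rule inj_onI, clarify)
        fix x K y L assume xK: "(x,K) \<in> P" and yL: "(y,L) \<in> P" and eq: "Inf K = Inf L" "Sup K = Sup L"
        obtain u v where uv: "K = {u..v}" "u \<le> x" "x \<le> v" using itv[of x K] xK P_def by auto
        obtain u' v' where uv': "L = {u'..v'}" "u' \<le> y" "y \<le> v'" using itv[of y L] yL P_def by auto
        have "K = L" "u < v" using uv uv' eq xK unfolding P_def by auto
        then have "interior K \<inter> interior L = {u<..<v}" using uv(1) by (metis Int_absorb interior_atLeastAtMost_real)
        then have "interior K \<inter> interior L \<noteq> {}" using \<open>u < v\<close> by simp
        then show "x = y \<and> K = L"
          using p xK yL unfolding P_def using tagged_division_ofD(5)[OF p, of x K y L] by auto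
      qed
      have disj: "interior (snd s) \<inter> interior (snd t) = {}" if "s \<in> P" "t \<in> P" "s \<noteq> t" for s t
        using that tagged_division_ofD(5)[OF p, of "fst s" "snd s" "fst t" "snd t"] \<open>P \<subseteq> p\<close> by auto
      have "(\<Sum>(u,v)\<in>E. norm (F v - F u)) < e / 2"
      proof (rule d)
        show "finite E" using \<open>finite P\<close> by (simp add: E_def)
        show "\<forall>(u, v)\<in>E. a \<le> u \<and> u < v \<and> v \<le> b"
        proof (clarsimp simp: E_def)
          fix x K assume "(x,K) \<in> P"
          then show "a \<le> Inf K \<and> Inf K < Sup K \<and> Sup K \<le> b"
            using itv[of x K] by (auto simp: P_def)
        qed
        show "disjoint_family_on (\<lambda>(u, v). {u<..<v}) E"
          unfolding disjoint_family_on_def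
        proof (intro ballI impI)
          fix s t assume "s \<in> E" "t \<in> E" "s \<noteq> t"
          then obtain s' t' where st: "s' \<in> P" "t' \<in> P" "s' \<noteq> t'"
            "s = (Inf (snd s'), Sup (snd s'))" "t = (Inf (snd t'), Sup (snd t'))"
            unfolding E_def by (auto simp: split_beta)
          have "interior (snd s') = {Inf (snd s')<..<Sup (snd s')}"
            using st(1) itv[of "fst s'" "snd s'"] by (auto simp: P_def)
          moreover have "interior (snd t') = {Inf (snd t')<..<Sup (snd t')}"
            using st(2) itv[of "fst t'" "snd t'"] by (auto simp: P_def)
          ultimately show "(case s of (u, v) \<Rightarrow> {u<..<v}) \<inter> (case t of (u, v) \<Rightarrow> {u<..<v}) = {}"
            using disj[OF st(1-3)] st by simp
        qed
        have lK: "snd s \<in> lmeasurable \<and> measure lebesgue (snd s) = Sup (snd s) - Inf (snd s)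
             \<and> snd s \<subseteq> U" if "s \<in> P" for s
        proof -
          have s: "(fst s, snd s) \<in> p" "fst s \<in> N" using that by (auto simp: P_def)
          then obtain u v where "snd s = {u..v}" "u \<le> v" using itv[of "fst s" "snd s"] by auto
          moreover have "snd s \<subseteq> U" using fine s unfolding fine_def \<gamma>_def by fastforce
          ultimately show ?thesis by simp
        qed
        have "(\<Sum>(u,v)\<in>E. v - u) = (\<Sum>s\<in>P. Sup (snd s) - Inf (snd s))"
          unfolding E_def by (subst sum.reindex[OF inj]) (simp add: split_beta)
        also have "\<dots> = (\<Sum>s\<in>P. measure lebesgue (snd s))" using lK by (intro sum.cong) auto
        also have "\<dots> = measure lebesgue (\<Union>(snd ` P))"
        proof (rule measure_negligible_finite_Union_image[symmetric, OF \<open>finite P\<close>])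
          show "pairwise (\<lambda>x y. negligible (snd x \<inter> snd y)) P"
          proof (rule pairwiseI)
            fix s t assume st: "s \<in> P" "t \<in> P" "s \<noteq> t"
            obtain u v where uv: "snd s = {u..v}" using itv[of "fst s" "snd s"] st by (auto simp: P_def)
            obtain u' v' where uv': "snd t = {u'..v'}" using itv[of "fst t" "snd t"] st by (auto simp: P_def)
            have "snd s \<inter> snd t = {max u u'..min v v'}" using uv uv' by auto
            moreover have "interior (snd s \<inter> snd t) = {}" using disj[OF st] by (simp add: interior_Int)
            ultimately have "min v v' \<le> max u u'" by (auto simp: interior_atLeastAtMost_real)
            then have "snd s \<inter> snd t \<subseteq> {max u u'}" using \<open>snd s \<inter> snd t = _\<close> by auto
            then show "negligible (snd s \<inter> snd t)" using negligible_subset negligible_sing by blast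
          qed
        qed (use lK in auto)
        also have "\<dots> \<le> measure lebesgue U"
          using lK by (intro measure_mono_fmeasurable Um) (auto intro!: \<open>finite P\<close> sets.finite_UN)
        also have "\<dots> < d" by (rule mU)
        finally show "(\<Sum>(u,v)\<in>E. v - u) < d" .
      qed
      then have P2: "(\<Sum>s\<in>P. norm (F (Sup (snd s)) - F (Inf (snd s)))) < e / 2"
        unfolding E_def by (subst (asm) sum.reindex[OF inj]) (simp add: split_beta)
      \<comment> \<open>Since \<open>g\<close> vanishes on \<open>N\<close>, an interval tagged
        there contributes only the increment of \<open>F\<close>. Any other interval lies in the
        ball on which the derivative approximates, and the tag separates its end points, so the two
        errors add up to \<open>e'\<close> times the length.\<close>
      have hN: "norm (h s) \<le> (if s \<in> P then norm (F (Sup (snd s)) - F (Inf (snd s))) else 0)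
           + e' * (Sup (snd s) - Inf (snd s))" if sp: "s \<in> p" for s
      proof -
        obtain x K where s: "s = (x,K)" by (cases s)
        obtain u v where K: "K = {u..v}" "u \<le> x" "x \<le> v" "a \<le> u" "v \<le> b" using itv[of x K] sp unfolding s by metis
        have SI: "Sup K = v" "Inf K = u" "measure lborel K = v - u" using K by auto
        show ?thesis
        proof (cases "x \<in> N")
          case True
          show ?thesis
          proof (cases "u < v")
            case True
            then have "s \<in> P" using \<open>x \<in> N\<close> that s SI by (simp add: P_def)
            then show ?thesis using \<open>x \<in> N\<close> \<open>e' > 0\<close> True SI s by (simp add: h_def g_def norm_minus_commute)
          next
            case False
            then have "u = v" using K by auto
            then show ?thesis using \<open>x \<in> N\<close> SI s by (simp add: h_def g_def)
          qed
        next
          case False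
          then have nP: "s \<notin> P" by (simp add: P_def s)
          have sub: "K \<subseteq> ball x (r x)" using fine that s False unfolding fine_def \<gamma>_def by fastforce
          moreover have "u \<in> K" "v \<in> K" using K by auto
          ultimately have "norm (u - x) < r x" "norm (v - x) < r x"
            by (auto simp: dist_norm norm_minus_commute)
          then have 1: "norm (F u - F x - (u-x) *\<^sub>R f x) \<le> e' * norm (u-x)"
             and 2: "norm (F v - F x - (v-x) *\<^sub>R f x) \<le> e' * norm (v-x)"
            using K False r[of x u] r[of x v] by auto
          have "h s = (v - u) *\<^sub>R f x - (F v - F u)"
            using False unfolding h_def g_def s by (simp only: SI split_conv if_False)
          also have "\<dots> = (F u - F x - (u-x) *\<^sub>R f x) - (F v - F x - (v-x) *\<^sub>R f x)"
            by (simp add: scaleR_diff_left)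
          finally have "norm (h s) \<le> e' * norm (u-x) + e' * norm (v-x)"
            using order_trans[OF norm_triangle_ineq4 add_mono[OF 1 2]] by simp
          also have "\<dots> = e' * (v - u)" using K by (simp add: algebra_simps)
          finally show ?thesis using nP SI s by simp
        qed
      qed
      have "(\<Sum>(x, k)\<in>p. measure lborel k *\<^sub>R g x) - (F b - F a) = (\<Sum>s\<in>p. h s)"
        unfolding sumF[symmetric] h_def by (simp add: split_beta sum_subtractf)
      also have "norm \<dots> \<le> (\<Sum>s\<in>p. (if s \<in> P then norm (F (Sup (snd s)) - F (Inf (snd s))) else 0)
           + e' * (Sup (snd s) - Inf (snd s)))"
        by (rule sum_norm_le) (rule hN)
      also have "\<dots> = (\<Sum>s\<in>P. norm (F (Sup (snd s)) - F (Inf (snd s)))) + e' * (b - a)"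
      proof -
        have "(\<Sum>s\<in>p. if s \<in> P then norm (F (Sup (snd s)) - F (Inf (snd s))) else 0)
            = (\<Sum>s\<in>P. norm (F (Sup (snd s)) - F (Inf (snd s))))"
          using \<open>P \<subseteq> p\<close> fin by (intro sum.mono_neutral_cong_right) auto
        moreover have "(\<Sum>s\<in>p. e' * (Sup (snd s) - Inf (snd s))) = e' * (b - a)"
          unfolding sum_distrib_left[symmetric] using suml by (simp add: split_beta)
        ultimately show ?thesis by (simp only: sum.distrib)
      qed
      also have "\<dots> < e / 2 + e / 2" using P2 e' by (intro add_strict_mono)
      finally show ?thesis by simp
    qed
    ultimately show "\<exists>\<gamma>. gauge \<gamma> \<and> (\<forall>\<D>. \<D> tagged_division_of cbox a b \<and> \<gamma> fine \<D> \<longrightarrow>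
         norm ((\<Sum>(x, k)\<in>\<D>. measure lborel k *\<^sub>R g x) - (F b - F a)) < e)"
      by (intro exI[of _ \<gamma>] conjI allI impI) auto
  qed
  then have "(g has_integral (F b - F a)) {a..b}" by simp
  then show ?thesis
    by (rule has_integral_spike[OF N, rotated]) (simp add: g_def)
qed

section \<open>Interchange of integrals over a triangle\<close>

text \<open>Fubini is applied to Bochner integrals over \<open>lborel\<close>, while the integrals
  of the theory are gauge integrals; this lemma and the next translate. As \<open>lborel\<close> is
  not complete, Borel measurability has to be carried along.\<close>

lemma absolutely_integrable_imp_lborel:
  fixes w :: "real \<Rightarrow> complex"
  assumes "w absolutely_integrable_on S" "(\<lambda>t. indicator S t *\<^sub>R w t) \<in> borel_measurable borel"
  shows "integrable lborel (\<lambda>t. indicator S t *\<^sub>R w t)"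
  using assms integrable_completion[of "\<lambda>t. indicator S t *\<^sub>R w t" lborel]
  by (simp add: set_integrable_def)

lemma lborel_integral_eq_integral:
  fixes w :: "real \<Rightarrow> complex"
  assumes "integrable lborel (\<lambda>t. indicator S t *\<^sub>R w t)"
  shows "(\<integral>t. indicator S t *\<^sub>R w t \<partial>lborel) = integral S w"
  using set_borel_integral_eq_integral(2)[of S w] assms
  by (simp add: set_integrable_def set_lebesgue_integral_def)

text \<open>The triangle is encoded by an indicator, so that Fubini applies on the whole plane;
  \<open>K\<close> and \<open>u\<close> are bounded there and \<open>v\<close> is integrable, which
  yields a product majorant. Only integrability is asked of \<open>v\<close> because it will contain
  the potential as a factor.\<close>

lemma integral_triangle_swap:
  fixes u v :: "real \<Rightarrow> complex"
  assumes K: "continuous_kernel K" and u: "continuous_on {0..pi} u"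
    and v: "v absolutely_integrable_on {0..pi}"
    and vm: "(\<lambda>t. indicator {0..pi} t *\<^sub>R v t) \<in> borel_measurable borel"
  shows "integral {0..pi} (\<lambda>x. u x * integral {0..x} (\<lambda>t. K x t * v t))
       = integral {0..pi} (\<lambda>t. v t * integral {t..pi} (\<lambda>x. K x t * u x))"
proof -
  define T where "T = {(x, t). 0 \<le> t \<and> t \<le> x \<and> x \<le> pi}"
  have clT: "closed T"
  proof -
    have "T = {z. 0 \<le> snd z} \<inter> {z. snd z \<le> fst z} \<inter> {z. fst z \<le> pi}" by (auto simp: T_def)
    moreover have "closed \<dots>" by (intro closed_Int closed_Collect_le continuous_intros)
    ultimately show ?thesis by simp
  qed
  have bT: "bounded T"
    by (rule bounded_subset[OF bounded_Times[OF bounded_closed_interval[of 0 pi] bounded_closed_interval[of 0 pi]]])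
       (auto simp: T_def)
  define v' where "v' t = indicator {0..pi} t *\<^sub>R v t" for t
  define k where "k z = K (fst z) (snd z) * u (fst z)" for z
  have ck: "continuous_on T k"
  proof -
    have "continuous_on T (\<lambda>z. K (fst z) (snd z))"
      using K by (simp add: continuous_kernel_def T_def split_beta)
    moreover have "continuous_on T (\<lambda>z. u (fst z))"
      by (rule continuous_on_compose2[OF u]) (auto intro!: continuous_intros simp: T_def)
    ultimately show ?thesis unfolding k_def by (intro continuous_intros)
  qed
  have "bounded (k ` T)"
  proof (intro compact_imp_bounded compact_continuous_image[OF ck])
    show "compact T" using clT bT by (simp add: compact_eq_bounded_closed)
  qed
  then obtain M where M: "\<And>z. z \<in> T \<Longrightarrow> norm (k z) \<le> M" "M > 0"
    unfolding bounded_pos by blast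
  define g where "g = (\<lambda>(x, t). indicator T (x, t) *\<^sub>R k (x, t) * v' t)"
  have v'i: "integrable lborel v'"
    using absolutely_integrable_imp_lborel[OF v vm] by (simp add: v'_def[abs_def])
  have v'm [measurable]: "v' \<in> borel_measurable borel" using vm by (simp add: v'_def[abs_def])
  have "(\<lambda>z. indicator T z *\<^sub>R k z) \<in> borel_measurable borel"
    by (rule borel_measurable_continuous_on_indicator[OF _ ck]) (use clT in auto)
  then have [measurable]: "(\<lambda>z. indicator T z *\<^sub>R k z) \<in> borel_measurable (lborel \<Otimes>\<^sub>M lborel)"
    by (simp add: borel_prod[symmetric] cong: measurable_cong_sets)
  have gm [measurable]: "g \<in> borel_measurable (lborel \<Otimes>\<^sub>M lborel)"
  proof -
    have *: "g = (\<lambda>z. (indicator T z *\<^sub>R k z) * v' (snd z))" by (auto simp: g_def)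
    have "(\<lambda>z. v' (snd z)) \<in> borel_measurable (lborel \<Otimes>\<^sub>M lborel)"
      by (rule measurable_compose[OF measurable_snd]) (simp add: v'm)
    then show ?thesis
      unfolding * by (rule borel_measurable_times[rotated]) fact
  qed
  have gb: "norm (g (x, t)) \<le> indicator {0..pi} x * (M * norm (v' t))" for x t
    using M(1)[of "(x,t)"] \<open>M > 0\<close>
    by (auto simp: g_def norm_mult indicator_def T_def intro!: mult_right_mono)
  have gx: "integrable lborel (\<lambda>t. g (x, t))" for x
  proof (rule Bochner_Integration.integrable_bound)
    show "integrable lborel (\<lambda>t. M * norm (v' t))" using v'i by simp
    show "AE t in lborel. norm (g (x, t)) \<le> norm (M * norm (v' t))"
    proof (intro AE_I2)
      fix t
      have "norm (g (x, t)) \<le> indicator {0..pi} x * (M * norm (v' t))" by (rule gb)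
      also have "\<dots> \<le> M * norm (v' t)" using \<open>M > 0\<close> by (simp add: indicator_def)
      finally show "norm (g (x, t)) \<le> norm (M * norm (v' t))" by simp
    qed
  qed simp
  have gi: "integrable (lborel \<Otimes>\<^sub>M lborel) g"
  proof (rule lborel_pair.Fubini_integrable)
    show "integrable lborel (\<lambda>x. \<integral>t. norm (g (x, t)) \<partial>lborel)"
    proof (rule Bochner_Integration.integrable_bound)
      show "integrable lborel (\<lambda>x. indicator {0..pi} x * (M * (\<integral>t. norm (v' t) \<partial>lborel)))"
        by (intro integrable_mult_left) (auto intro!: integrable_real_indicator)
      show "AE x in lborel. norm (\<integral>t. norm (g (x, t)) \<partial>lborel)
          \<le> norm (indicator {0..pi} x * (M * (\<integral>t. norm (v' t) \<partial>lborel)))"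
      proof (intro AE_I2)
        fix x
        have "(\<integral>t. norm (g (x, t)) \<partial>lborel) \<le> (\<integral>t. indicator {0..pi} x * (M * norm (v' t)) \<partial>lborel)"
          using gx[of x] v'i gb by (intro integral_mono) auto
        also have "\<dots> = indicator {0..pi} x * (M * (\<integral>t. norm (v' t) \<partial>lborel))" by simp
        finally show "norm (\<integral>t. norm (g (x, t)) \<partial>lborel)
          \<le> norm (indicator {0..pi} x * (M * (\<integral>t. norm (v' t) \<partial>lborel)))" by simp
      qed
    qed simp
  qed (use gx in auto)
  have swap: "(\<integral>t. (\<integral>x. g (x, t) \<partial>lborel) \<partial>lborel) = (\<integral>x. (\<integral>t. g (x, t) \<partial>lborel) \<partial>lborel)"
    using lborel_pair.Fubini_integral[of "\<lambda>x t. g (x, t)"] gi by simp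
  have i1: "integrable lborel (\<lambda>x. \<integral>t. g (x, t) \<partial>lborel)" using lborel_pair.integrable_fst'[OF gi] .
  have i2: "integrable lborel (\<lambda>t. \<integral>x. g (x, t) \<partial>lborel)"
    using lborel_pair.integrable_snd[of "\<lambda>x t. g (x, t)"] gi by simp
  have e1: "(\<integral>t. g (x, t) \<partial>lborel) = indicator {0..pi} x *\<^sub>R (u x * integral {0..x} (\<lambda>t. K x t * v t))" for x
  proof (cases "x \<in> {0..pi}")
    case True
    have eq: "g (x, t) = indicator {0..x} t *\<^sub>R (u x * (K x t * v t))" for t
      using True by (auto simp: g_def T_def k_def v'_def indicator_def)
    show ?thesis using lborel_integral_eq_integral[of "{0..x}" "\<lambda>t. u x * (K x t * v t)"] gx[of x] True
      by (simp add: eq)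
  next
    case False
    then have "g (x, t) = 0" for t by (auto simp: g_def T_def indicator_def)
    then show ?thesis using False by simp
  qed
  have e2: "(\<integral>x. g (x, t) \<partial>lborel) = indicator {0..pi} t *\<^sub>R (v t * integral {t..pi} (\<lambda>x. K x t * u x))" for t
  proof (cases "t \<in> {0..pi}")
    case True
    have eq: "g (x, t) = indicator {t..pi} x *\<^sub>R (v t * (K x t * u x))" for x
      using True by (auto simp: g_def T_def k_def v'_def indicator_def)
    have "integrable lborel (\<lambda>x. g (x, t))"
    proof (rule Bochner_Integration.integrable_bound)
      show "integrable lborel (\<lambda>x. indicator {0..pi} x * (M * norm (v' t)))"
        by (intro integrable_mult_left) (auto intro!: integrable_real_indicator)
      show "AE x in lborel. norm (g (x, t)) \<le> norm (indicator {0..pi} x * (M * norm (v' t)))"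
        using gb[of _ t] \<open>M > 0\<close> by (intro AE_I2) (simp add: abs_mult)
    qed simp
    then show ?thesis using lborel_integral_eq_integral[of "{t..pi}" "\<lambda>x. v t * (K x t * u x)"] True
      by (simp add: eq)
  next
    case False
    then have "g (x, t) = 0" for x by (auto simp: g_def T_def indicator_def)
    then show ?thesis using False by simp
  qed
  show ?thesis
    using swap lborel_integral_eq_integral[OF i1[unfolded e1]] lborel_integral_eq_integral[OF i2[unfolded e2]]
    by (simp add: e1 e2)
qed

lemma indicator_borel_measurable_continuous:
  fixes v :: "real \<Rightarrow> complex"
  assumes "continuous_on {a..b} v"
  shows "(\<lambda>t. indicator {a..b} t *\<^sub>R v t) \<in> borel_measurable borel"
  by (rule borel_measurable_continuous_on_indicator[OF _ assms]) auto

section \<open>Fourier cosine series\<close>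

lemma absolutely_integrable_mult_continuous:
  fixes w u :: "real \<Rightarrow> 'a::{real_normed_algebra,euclidean_space}"
  assumes "w absolutely_integrable_on {a..b}" "continuous_on {a..b} u"
  shows "(\<lambda>x. w x * u x) absolutely_integrable_on {a..b}" "(\<lambda>x. u x * w x) absolutely_integrable_on {a..b}"
proof -
  have meas: "u \<in> borel_measurable (lebesgue_on {a..b})"
    using assms(2) by (intro continuous_imp_measurable_on_sets_lebesgue) auto
  have bdd: "bounded (u ` {a..b})"
    using compact_continuous_image[OF assms(2)] compact_imp_bounded by blast
  have bil: "bilinear (\<lambda>x y :: 'a. x * y)" "bilinear (\<lambda>x y :: 'a. y * x)"
    by (simp_all add: bilinear_conv_bounded_bilinear bounded_bilinear_mult bounded_bilinear.flip)
  show "(\<lambda>x. u x * w x) absolutely_integrable_on {a..b}"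
    by (rule absolutely_integrable_bounded_measurable_product[OF bil(1) meas _ bdd assms(1)]) auto
  show "(\<lambda>x. w x * u x) absolutely_integrable_on {a..b}"
    by (rule absolutely_integrable_bounded_measurable_product[OF bil(2) meas _ bdd assms(1)]) auto
qed

text \<open>No integrability is required: the integral of a non-integrable function is 0 by
  convention.\<close>

lemma integral_nonneg_real:
  fixes f :: "real \<Rightarrow> real"
  shows "0 \<le> integral S (\<lambda>x. (f x)\<^sup>2)"
  by (cases "(\<lambda>x. (f x)\<^sup>2) integrable_on S") (auto intro: integral_nonneg simp: not_integrable_integral)

text \<open>The index set \<open>A\<close> is a parameter so that the sines fit: their member of
  index 0 is the zero function and must be excluded.\<close>

locale orthogonal_family =
  fixes e :: "nat \<Rightarrow> real \<Rightarrow> real" and \<gamma> :: "nat \<Rightarrow> real" and A :: "nat set"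
  assumes cont: "\<And>n. continuous_on {0..pi} (e n)"
    and orth: "\<And>n m. n \<in> A \<Longrightarrow> m \<in> A \<Longrightarrow> integral {0..pi} (\<lambda>x. e n x * e m x) = (if n = m then \<gamma> n else 0)"
    and pos: "\<And>n. n \<in> A \<Longrightarrow> \<gamma> n > 0"
begin

definition coef :: "(real \<Rightarrow> real) \<Rightarrow> nat \<Rightarrow> real" where
  "coef w n = integral {0..pi} (\<lambda>x. w x * e n x)"

text \<open>The coefficients \<open>b\<close> are arbitrary, so the same expansion gives Bessel's
  inequality and the best approximation property. The function \<open>w\<close> need not be
  continuous, since it will be the potential.\<close>

lemma integral_square_diff:
  assumes w: "w absolutely_integrable_on {0..pi}" and w2: "(\<lambda>x. (w x)\<^sup>2) integrable_on {0..pi}"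
    and I: "finite I" "I \<subseteq> A"
  shows "integral {0..pi} (\<lambda>x. (w x - (\<Sum>n\<in>I. b n * e n x))\<^sup>2)
       = integral {0..pi} (\<lambda>x. (w x)\<^sup>2) - 2 * (\<Sum>n\<in>I. b n * coef w n) + (\<Sum>n\<in>I. (b n)\<^sup>2 * \<gamma> n)"
proof -
  define s where "s x = (\<Sum>n\<in>I. b n * e n x)" for x
  have cs: "continuous_on {0..pi} s" unfolding s_def by (intro continuous_intros cont)
  have int: "(\<lambda>x. u x * v x) integrable_on {0..pi}"
    if "u absolutely_integrable_on {0..pi}" "continuous_on {0..pi} v" for u v :: "real \<Rightarrow> real"
    using absolutely_integrable_mult_continuous(1)[OF that] absolutely_integrable_on_def by blast
  have sa: "s absolutely_integrable_on {0..pi}" using cs absolutely_integrable_continuous_real by blast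
  have ea: "e n absolutely_integrable_on {0..pi}" for n using cont absolutely_integrable_continuous_real by blast
  have prod: "integral {0..pi} (\<lambda>x. u x * s x) = (\<Sum>n\<in>I. b n * coef u n)"
    if "u absolutely_integrable_on {0..pi}" for u
  proof -
    have "integral {0..pi} (\<lambda>x. u x * s x) = integral {0..pi} (\<lambda>x. \<Sum>n\<in>I. b n * (u x * e n x))"
      by (simp add: s_def sum_distrib_left algebra_simps)
    also have "\<dots> = (\<Sum>n\<in>I. integral {0..pi} (\<lambda>x. b n * (u x * e n x)))"
      using int[OF that cont] by (intro integral_sum I) (auto intro: integrable_on_mult_right)
    finally show ?thesis by (simp add: coef_def)
  qed
  have "coef s n = b n * \<gamma> n" if "n \<in> I" for n
  proof -
    have "coef s n = integral {0..pi} (\<lambda>x. e n x * s x)" by (simp add: coef_def mult.commute)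
    also have "\<dots> = (\<Sum>m\<in>I. b m * coef (e n) m)" by (rule prod[OF ea])
    also have "\<dots> = (\<Sum>m\<in>I. if m = n then b n * \<gamma> n else 0)"
      using I that by (intro sum.cong refl) (auto simp: coef_def orth subset_iff)
    also have "\<dots> = b n * \<gamma> n" using I that by simp
    finally show ?thesis .
  qed
  then have ss: "integral {0..pi} (\<lambda>x. s x * s x) = (\<Sum>n\<in>I. (b n)\<^sup>2 * \<gamma> n)"
    unfolding prod[OF sa] by (intro sum.cong) (auto simp: power2_eq_square)
  have "integral {0..pi} (\<lambda>x. (w x - s x)\<^sup>2) = integral {0..pi} (\<lambda>x. (w x)\<^sup>2 - 2 * (w x * s x) + s x * s x)"
    by (simp add: power2_eq_square algebra_simps)
  also have "\<dots> = integral {0..pi} (\<lambda>x. (w x)\<^sup>2) - 2 * integral {0..pi} (\<lambda>x. w x * s x) + integral {0..pi} (\<lambda>x. s x * s x)"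
    using w2 int[OF w cs] int[OF sa cs]
    by (simp add: integral_add integral_diff integrable_diff integrable_on_mult_right)
  finally have "integral {0..pi} (\<lambda>x. (w x - s x)\<^sup>2)
      = integral {0..pi} (\<lambda>x. (w x)\<^sup>2) - 2 * (\<Sum>n\<in>I. b n * coef w n) + (\<Sum>n\<in>I. (b n)\<^sup>2 * \<gamma> n)"
    unfolding ss prod[OF w] .
  then show ?thesis unfolding s_def .
qed

lemma Bessel_finite:
  assumes w: "w absolutely_integrable_on {0..pi}" and w2: "(\<lambda>x. (w x)\<^sup>2) integrable_on {0..pi}"
    and I: "finite I" "I \<subseteq> A"
  shows "(\<Sum>n\<in>I. (coef w n)\<^sup>2 / \<gamma> n) \<le> integral {0..pi} (\<lambda>x. (w x)\<^sup>2)"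
proof -
  have "0 \<le> integral {0..pi} (\<lambda>x. (w x - (\<Sum>n\<in>I. (coef w n / \<gamma> n) * e n x))\<^sup>2)"
    by (rule integral_nonneg_real)
  also have "\<dots> = integral {0..pi} (\<lambda>x. (w x)\<^sup>2) - 2 * (\<Sum>n\<in>I. coef w n / \<gamma> n * coef w n) + (\<Sum>n\<in>I. (coef w n / \<gamma> n)\<^sup>2 * \<gamma> n)"
    by (rule integral_square_diff[OF w w2 I])
  also have "(\<Sum>n\<in>I. coef w n / \<gamma> n * coef w n) = (\<Sum>n\<in>I. (coef w n)\<^sup>2 / \<gamma> n)"
    by (simp add: power2_eq_square)
  also have "(\<Sum>n\<in>I. (coef w n / \<gamma> n)\<^sup>2 * \<gamma> n) = (\<Sum>n\<in>I. (coef w n)\<^sup>2 / \<gamma> n)"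
    using pos I by (intro sum.cong) (auto simp: power2_eq_square subset_iff)
  finally show ?thesis by simp
qed

text \<open>Completing the square in each coefficient separately: the contribution of index
  \<open>n\<close> is least at \<open>coef w n / \<gamma> n\<close>.\<close>

lemma best_approximation:
  assumes w: "w absolutely_integrable_on {0..pi}" and w2: "(\<lambda>x. (w x)\<^sup>2) integrable_on {0..pi}"
    and I: "finite I" "I \<subseteq> A"
  shows "integral {0..pi} (\<lambda>x. (w x)\<^sup>2) - (\<Sum>n\<in>I. (coef w n)\<^sup>2 / \<gamma> n)
       \<le> integral {0..pi} (\<lambda>x. (w x - (\<Sum>n\<in>I. b n * e n x))\<^sup>2)"
proof -
  have "- ((coef w n)\<^sup>2 / \<gamma> n) \<le> - 2 * (b n * coef w n) + (b n)\<^sup>2 * \<gamma> n" if "n \<in> I" for n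
  proof -
    have g: "\<gamma> n > 0" using pos I that by auto
    have "0 \<le> (b n * \<gamma> n - coef w n)\<^sup>2 / \<gamma> n" using g by simp
    also have "\<dots> = (coef w n)\<^sup>2 / \<gamma> n - 2 * (b n * coef w n) + (b n)\<^sup>2 * \<gamma> n"
      using g by (simp add: power2_eq_square field_simps)
    finally show ?thesis by simp
  qed
  then have "(\<Sum>n\<in>I. - ((coef w n)\<^sup>2 / \<gamma> n)) \<le> (\<Sum>n\<in>I. - 2 * (b n * coef w n) + (b n)\<^sup>2 * \<gamma> n)"
    by (rule sum_mono)
  then show ?thesis
    unfolding integral_square_diff[OF assms] by (simp add: sum.distrib sum_negf sum_subtractf sum_distrib_left)
qed

text \<open>Bessel's inequality is applied from index 1 on, so that the sines are covered too; the
  one remaining term does not affect summability.\<close>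

lemma summable_coef_square:
  assumes w: "w absolutely_integrable_on {0..pi}" and w2: "(\<lambda>x. (w x)\<^sup>2) integrable_on {0..pi}"
    and A: "{1..} \<subseteq> A" and g: "\<And>n. n \<ge> 1 \<Longrightarrow> \<gamma> n = g"
  shows "summable (\<lambda>n. (coef w n)\<^sup>2)"
proof -
  have "summable (\<lambda>n. (coef w (Suc n))\<^sup>2)"
  proof (rule bounded_imp_summable)
    fix n
    have inj: "inj_on Suc {..n}" by simp
    have "(\<Sum>k\<in>Suc ` {..n}. (coef w k)\<^sup>2 / \<gamma> k) \<le> integral {0..pi} (\<lambda>x. (w x)\<^sup>2)"
      using A by (intro Bessel_finite w w2) auto
    then have "(\<Sum>k\<le>n. (coef w (Suc k))\<^sup>2 / g) \<le> integral {0..pi} (\<lambda>x. (w x)\<^sup>2)"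
      using g by (simp add: sum.reindex)
    then have "(\<Sum>k\<le>n. (coef w (Suc k))\<^sup>2) / g \<le> integral {0..pi} (\<lambda>x. (w x)\<^sup>2)"
      by (simp add: sum_divide_distrib)
    then show "(\<Sum>k\<le>n. (coef w (Suc k))\<^sup>2) \<le> integral {0..pi} (\<lambda>x. (w x)\<^sup>2) * g"
      using pos[of 1] g[of 1] A by (subst pos_divide_le_eq[symmetric]) auto
  qed auto
  then show ?thesis by (subst (asm) summable_Suc_iff)
qed

end

lemma integral_cos_nat: "integral {0..pi} (\<lambda>x. cos (real n * x)) = (if n = 0 then pi else 0)"
proof (cases "n = 0")
  case False
  have "((\<lambda>x. cos (real n * x)) has_integral sin (real n * pi) / real n - sin (real n * 0) / real n) {0..pi}"
    by (rule fundamental_theorem_of_calculus)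
       (use False in \<open>auto intro!: derivative_eq_intros simp: has_real_derivative_iff_has_vector_derivative[symmetric]\<close>)
  then show ?thesis using False by (simp add: integral_unique)
qed auto

lemma cos_product_integral:
  fixes m n :: nat
  shows "integral {0..pi} (\<lambda>x. cos (real n * x) * cos (real m * x))
       = (if n = m then (if n = 0 then pi else pi / 2) else 0)"
    and "integral {0..pi} (\<lambda>x. sin (real n * x) * sin (real m * x))
       = (if n = m then (if n = 0 then 0 else pi / 2) else 0)"
proof -
  have ci: "(\<lambda>x. cos (real k * x)) integrable_on {0..pi}" for k
    by (intro integrable_continuous_interval continuous_intros)
  \<comment> \<open>The difference frequency is made a natural number, as
    \<open>integral_cos_nat\<close> asks; the cosine does not see the sign.\<close>
  define d where "d = nat \<bar>int n - int m\<bar>"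
  have d: "cos (real n * x - real m * x) = cos (real d * x)" for x
  proof (cases "n \<ge> m")
    case True then show ?thesis by (simp add: d_def algebra_simps of_nat_diff nat_diff_distrib')
  next
    case False
    then have "real d * x = - (real n * x - real m * x)" by (simp add: d_def algebra_simps of_nat_diff nat_diff_distrib')
    then show ?thesis by (metis cos_minus)
  qed
  have 1: "integral {0..pi} (\<lambda>x. (cos (real d * x) + cos (real (n + m) * x)) / 2)
     = (integral {0..pi} (\<lambda>x. cos (real d * x)) + integral {0..pi} (\<lambda>x. cos (real (n + m) * x))) / 2"
    by (subst integral_divide) (simp only: integral_add[OF ci ci])
  have 2: "integral {0..pi} (\<lambda>x. (cos (real d * x) - cos (real (n + m) * x)) / 2)
     = (integral {0..pi} (\<lambda>x. cos (real d * x)) - integral {0..pi} (\<lambda>x. cos (real (n + m) * x))) / 2"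
    by (subst integral_divide) (simp only: integral_diff[OF ci ci])
  have "(\<lambda>x. cos (real n * x) * cos (real m * x)) = (\<lambda>x. (cos (real d * x) + cos (real (n + m) * x)) / 2)"
    by (simp add: cos_times_cos d[symmetric] distrib_right)
  then show "integral {0..pi} (\<lambda>x. cos (real n * x) * cos (real m * x))
       = (if n = m then (if n = 0 then pi else pi / 2) else 0)"
    by (simp only: 1 integral_cos_nat) (auto simp: d_def)
  have "(\<lambda>x. sin (real n * x) * sin (real m * x)) = (\<lambda>x. (cos (real d * x) - cos (real (n + m) * x)) / 2)"
    by (simp add: sin_times_sin d[symmetric] distrib_right)
  then show "integral {0..pi} (\<lambda>x. sin (real n * x) * sin (real m * x))
       = (if n = m then (if n = 0 then 0 else pi / 2) else 0)"
    by (simp only: 2 integral_cos_nat) (auto simp: d_def)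
qed

interpretation cosine: orthogonal_family "\<lambda>n x. cos (real n * x)" "\<lambda>n. if n = 0 then pi else pi / 2" UNIV
  by unfold_locales (auto intro!: continuous_intros simp: cos_product_integral)

interpretation sine: orthogonal_family "\<lambda>n x. sin (real n * x)" "\<lambda>n. pi / 2" "{1..}"
  by unfold_locales (auto intro!: continuous_intros simp: cos_product_integral)

lemma summable_cos_coeff_square:
  assumes "w absolutely_integrable_on {0..pi}" "(\<lambda>x. (w x)\<^sup>2) integrable_on {0..pi}"
  shows "summable (\<lambda>n. (integral {0..pi} (\<lambda>x. w x * cos (real n * x)))\<^sup>2)"
  using cosine.summable_coef_square[OF assms, of "pi / 2"] by (simp add: cosine.coef_def)

lemma summable_sin_coeff_square:
  assumes "w absolutely_integrable_on {0..pi}" "(\<lambda>x. (w x)\<^sup>2) integrable_on {0..pi}"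
  shows "summable (\<lambda>n. (integral {0..pi} (\<lambda>x. w x * sin (real n * x)))\<^sup>2)"
  using sine.summable_coef_square[OF assms, of "pi / 2"] by (simp add: sine.coef_def)

lemma integral_Re_Im:
  fixes f :: "real \<Rightarrow> complex"
  assumes "f integrable_on S"
  shows "Re (integral S f) = integral S (\<lambda>x. Re (f x))" "Im (integral S f) = integral S (\<lambda>x. Im (f x))"
  using integral_linear[OF assms bounded_linear_Re] integral_linear[OF assms bounded_linear_Im]
  by (simp_all add: o_def)

text \<open>The squared modulus splits into the coefficients of the real and the imaginary part. The
  real result enters as the hypothesis \<open>real\<close>, so that one proof serves cosines and
  sines.\<close>

lemma summable_complex_coeff_square:
  fixes w :: "real \<Rightarrow> complex"
  assumes w: "continuous_on {0..pi} w" and e: "\<And>n. continuous_on {0..pi} (e n)"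
    and real: "\<And>w. w absolutely_integrable_on {0..pi} \<Longrightarrow> (\<lambda>x. (w x)\<^sup>2) integrable_on {0..pi} \<Longrightarrow>
           summable (\<lambda>n. (integral {0..pi} (\<lambda>x. w x * e n x))\<^sup>2)"
  shows "summable (\<lambda>n. (norm (integral {0..pi} (\<lambda>x. w x * complex_of_real (e n x))))\<^sup>2)"
proof -
  have 1: "(norm (integral {0..pi} (\<lambda>x. w x * complex_of_real (e n x))))\<^sup>2
    = (integral {0..pi} (\<lambda>x. Re (w x) * e n x))\<^sup>2 + (integral {0..pi} (\<lambda>x. Im (w x) * e n x))\<^sup>2" for n
  proof -
    have "(\<lambda>x. w x * complex_of_real (e n x)) integrable_on {0..pi}"
      by (intro integrable_continuous_interval continuous_intros w e)
    then show ?thesis unfolding cmod_power2 by (simp add: integral_Re_Im)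
  qed
  have "summable (\<lambda>n. (integral {0..pi} (\<lambda>x. Re (w x) * e n x))\<^sup>2)"
    "summable (\<lambda>n. (integral {0..pi} (\<lambda>x. Im (w x) * e n x))\<^sup>2)"
    by (intro real absolutely_integrable_continuous_real integrable_continuous_interval continuous_intros w)+
  then show ?thesis unfolding 1 by (rule summable_add)
qed

section \<open>Completeness of the cosines: cosine polynomials and Parseval's formula\<close>

definition cos_poly :: "nat \<Rightarrow> (real \<Rightarrow> real) \<Rightarrow> bool" where
  "cos_poly N p \<longleftrightarrow> (\<exists>b. \<forall>t. p t = (\<Sum>k\<le>N. b k * cos (real k * t)))"

lemma cos_poly_sum:
  assumes "finite I" "\<And>i. i \<in> I \<Longrightarrow> cos_poly N (p i)"
  shows "cos_poly N (\<lambda>t. \<Sum>i\<in>I. a i * p i t)"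
proof -
  obtain b where b: "\<And>i t. i \<in> I \<Longrightarrow> p i t = (\<Sum>k\<le>N. b i k * cos (real k * t))"
    using assms(2) unfolding cos_poly_def by metis
  have "(\<Sum>i\<in>I. a i * p i t) = (\<Sum>k\<le>N. (\<Sum>i\<in>I. a i * b i k) * cos (real k * t))" for t
    by (simp add: b sum_distrib_left sum_distrib_right mult.assoc) (rule sum.swap)
  then show ?thesis unfolding cos_poly_def by (intro exI[of _ "\<lambda>k. \<Sum>i\<in>I. a i * b i k"]) simp
qed

lemma cos_poly_cos: "k \<le> N \<Longrightarrow> cos_poly N (\<lambda>t. cos (real k * t))"
  unfolding cos_poly_def by (intro exI[of _ "\<lambda>j. if j = k then 1 else 0"]) (auto simp: if_distrib[where f="\<lambda>x. x * _"] cong: if_cong)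

lemma cos_poly_mono:
  assumes "cos_poly M p" "M \<le> N"
  shows "cos_poly N p"
proof -
  obtain b where "p = (\<lambda>t. \<Sum>k\<le>M. b k * cos (real k * t))" using assms(1) unfolding cos_poly_def by auto
  then show ?thesis using assms(2) by (auto intro!: cos_poly_sum cos_poly_cos)
qed

text \<open>Multiplication by cos t turns cos(kt) into half the sum of its neighbours cos((k-1)t)
  and cos((k+1)t).\<close>

lemma cos_poly_power: "cos_poly N (\<lambda>t. cos t ^ N)"
proof (induction N)
  case 0
  then show ?case unfolding cos_poly_def by (intro exI[of _ "\<lambda>_. 1"]) simp
next
  case (Suc N)
  then obtain b where b: "\<And>t. cos t ^ N = (\<Sum>k\<le>N. b k * cos (real k * t))" unfolding cos_poly_def by blast
  have single: "cos_poly (Suc N) (\<lambda>t. cos (real k * t) * cos t)" if "k \<le> N" for k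
  proof (cases k)
    case 0
    then show ?thesis using cos_poly_cos[of 1 "Suc N"] by simp
  next
    case (Suc j)
    have "cos (real k * t) * cos t = (\<Sum>i\<in>{j, Suc k}. 1 / 2 * cos (real i * t))" for t
      by (simp add: Suc cos_times_cos algebra_simps add_divide_distrib)
    then have "(\<lambda>t. cos (real k * t) * cos t) = (\<lambda>t. \<Sum>i\<in>{j, Suc k}. 1 / 2 * cos (real i * t))" by blast
    moreover have "cos_poly (Suc N) (\<lambda>t. \<Sum>i\<in>{j, Suc k}. 1 / 2 * cos (real i * t))"
      using that Suc by (intro cos_poly_sum cos_poly_cos) auto
    ultimately show ?thesis by simp
  qed
  have "(\<lambda>t. cos t ^ Suc N) = (\<lambda>t. \<Sum>k\<le>N. b k * (cos (real k * t) * cos t))"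
    by (simp add: b sum_distrib_right sum_distrib_left algebra_simps)
  then show ?case using single by (auto intro!: cos_poly_sum)
qed

text \<open>The substitution x = cos t turns \<open>f\<close> into a continuous function on [-1, 1];
  the Weierstrass theorem there gives a polynomial in cos t.\<close>

lemma cosine_approximation:
  fixes f :: "real \<Rightarrow> real"
  assumes "continuous_on {0..pi} f" "\<epsilon> > 0"
  obtains N p where "cos_poly N p" "\<And>t. t \<in> {0..pi} \<Longrightarrow> \<bar>f t - p t\<bar> < \<epsilon>"
proof -
  have "continuous_on {-1..1} (\<lambda>x. f (arccos x))"
    by (rule continuous_on_compose2[OF assms(1)]) (auto intro!: continuous_intros arccos_lbound arccos_ubound continuous_on_arccos')
  then obtain g where g: "real_polynomial_function g" "\<And>x. x \<in> {-1..1} \<Longrightarrow> \<bar>f (arccos x) - g x\<bar> < \<epsilon>"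
    using Stone_Weierstrass_real_polynomial_function[of "{-1..1}" "\<lambda>x. f (arccos x)" \<epsilon>] assms(2) by auto
  obtain a n where gs: "g = (\<lambda>x. \<Sum>i\<le>n. a i * x^i)" using g(1) real_polynomial_function_iff_sum by blast
  show thesis
  proof (rule that)
    show "cos_poly n (\<lambda>t. \<Sum>i\<le>n. a i * cos t ^ i)"
      by (rule cos_poly_sum) (auto intro: cos_poly_mono[OF cos_poly_power])
    fix t :: real assume "t \<in> {0..pi}"
    then show "\<bar>f t - (\<Sum>i\<le>n. a i * cos t ^ i)\<bar> < \<epsilon>"
      using g(2)[of "cos t"] by (simp add: gs arccos_cos)
  qed
qed

text \<open>By best approximation the defect in Bessel's inequality is at most the mean square error
  of a uniformly close cosine polynomial, for every \<open>N\<close> from its degree on.\<close>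

lemma Parseval_square:
  fixes f :: "real \<Rightarrow> real"
  assumes f: "continuous_on {0..pi} f"
  shows "(\<lambda>N. \<Sum>n\<le>N. (cosine.coef f n)\<^sup>2 / (if n = 0 then pi else pi / 2)) \<longlonglongrightarrow> integral {0..pi} (\<lambda>x. (f x)\<^sup>2)"
proof (rule LIMSEQ_I)
  fix r :: real assume "r > 0"
  have fa: "f absolutely_integrable_on {0..pi}" "(\<lambda>x. (f x)\<^sup>2) integrable_on {0..pi}"
    using f by (auto intro!: absolutely_integrable_continuous_real integrable_continuous_interval continuous_intros)
  \<comment> \<open>With this choice the mean square error over an interval of length pi is at most
    \<open>r / 2\<close>.\<close>
  define \<epsilon> where "\<epsilon> = sqrt (r / (2 * pi))"
  have "\<epsilon> > 0" "\<epsilon>\<^sup>2 = r / (2 * pi)" using \<open>r > 0\<close> by (auto simp: \<epsilon>_def)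
  obtain M p where p: "cos_poly M p" "\<And>t. t \<in> {0..pi} \<Longrightarrow> \<bar>f t - p t\<bar> < \<epsilon>"
    using cosine_approximation[OF f \<open>\<epsilon> > 0\<close>] by metis
  have "norm ((\<Sum>n\<le>N. (cosine.coef f n)\<^sup>2 / (if n = 0 then pi else pi / 2)) - integral {0..pi} (\<lambda>x. (f x)\<^sup>2)) < r"
    if NM: "N \<ge> M" for N
  proof -
    obtain b where b: "\<And>t. p t = (\<Sum>k\<le>N. b k * cos (real k * t))"
      using cos_poly_mono[OF p(1) NM] unfolding cos_poly_def by blast
    have "integral {0..pi} (\<lambda>x. (f x)\<^sup>2) - (\<Sum>n\<le>N. (cosine.coef f n)\<^sup>2 / (if n = 0 then pi else pi / 2))
       \<le> integral {0..pi} (\<lambda>x. (f x - p x)\<^sup>2)"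
      using cosine.best_approximation[OF fa, of "{..N}" b] by (simp add: b)
    also have "\<dots> \<le> integral {0..pi} (\<lambda>x. \<epsilon>\<^sup>2)"
    proof (rule integral_le)
      show "(\<lambda>x. (f x - p x)\<^sup>2) integrable_on {0..pi}"
        unfolding b by (intro integrable_continuous_interval continuous_intros f)
      show "(f x - p x)\<^sup>2 \<le> \<epsilon>\<^sup>2" if "x \<in> {0..pi}" for x
        using p(2)[OF that] \<open>\<epsilon> > 0\<close> by (intro abs_le_square_iff[THEN iffD1]) simp
    qed auto
    also have "\<dots> < r" using \<open>r > 0\<close> by (simp add: \<open>\<epsilon>\<^sup>2 = _\<close>)
    finally show ?thesis using cosine.Bessel_finite[OF fa, of "{..N}"] by simp
  qed
  then show "\<exists>no. \<forall>n\<ge>no. norm ((\<Sum>n\<le>n. (cosine.coef f n)\<^sup>2 / (if n = 0 then pi else pi / 2)) - integral {0..pi} (\<lambda>x. (f x)\<^sup>2)) < r"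
    by blast
qed

text \<open>Polarization: 4fg = (f + g)^2 - (f - g)^2.\<close>

lemma Parseval_real:
  fixes f g :: "real \<Rightarrow> real"
  assumes f: "continuous_on {0..pi} f" and g: "continuous_on {0..pi} g"
  shows "(\<lambda>N. \<Sum>n\<le>N. cosine.coef f n * cosine.coef g n / (if n = 0 then pi else pi / 2)) \<longlonglongrightarrow> integral {0..pi} (\<lambda>x. f x * g x)"
proof -
  have int: "(\<lambda>x. u x * cos (real n * x)) integrable_on {0..pi}" if "continuous_on {0..pi} u" for u and n
    by (intro integrable_continuous_interval continuous_intros that)
  have c: "cosine.coef (\<lambda>x. f x + g x) n = cosine.coef f n + cosine.coef g n"
    "cosine.coef (\<lambda>x. f x - g x) n = cosine.coef f n - cosine.coef g n" for n
    unfolding cosine.coef_def using int[OF f] int[OF g]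
    by (simp_all add: distrib_right left_diff_distrib integral_add integral_diff)
  have "(\<lambda>N. ((\<Sum>n\<le>N. (cosine.coef (\<lambda>x. f x + g x) n)\<^sup>2 / (if n = 0 then pi else pi / 2))
          - (\<Sum>n\<le>N. (cosine.coef (\<lambda>x. f x - g x) n)\<^sup>2 / (if n = 0 then pi else pi / 2))) / 4)
     \<longlonglongrightarrow> (integral {0..pi} (\<lambda>x. (f x + g x)\<^sup>2) - integral {0..pi} (\<lambda>x. (f x - g x)\<^sup>2)) / 4"
    by (intro tendsto_intros Parseval_square continuous_intros f g) simp
  also have "integral {0..pi} (\<lambda>x. (f x + g x)\<^sup>2) - integral {0..pi} (\<lambda>x. (f x - g x)\<^sup>2)
       = integral {0..pi} (\<lambda>x. (f x + g x)\<^sup>2 - (f x - g x)\<^sup>2)"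
    by (intro integral_diff[symmetric] integrable_continuous_interval continuous_intros f g)
  also have "(\<lambda>x. (f x + g x)\<^sup>2 - (f x - g x)\<^sup>2) = (\<lambda>x. 4 * (f x * g x))"
    by (auto simp: power2_eq_square algebra_simps)
  also have "(\<lambda>N. ((\<Sum>n\<le>N. (cosine.coef (\<lambda>x. f x + g x) n)\<^sup>2 / (if n = 0 then pi else pi / 2))
          - (\<Sum>n\<le>N. (cosine.coef (\<lambda>x. f x - g x) n)\<^sup>2 / (if n = 0 then pi else pi / 2))) / 4)
     = (\<lambda>N. \<Sum>n\<le>N. cosine.coef f n * cosine.coef g n / (if n = 0 then pi else pi / 2))"
    unfolding sum_subtractf[symmetric] sum_divide_distrib c
    by (intro ext sum.cong refl) (auto simp: power2_eq_square field_simps)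
  finally show ?thesis by simp
qed

text \<open>The pairing is bilinear, without conjugation, as it will be combined with transposed
  Volterra operators; real and imaginary part each reduce to two instances of the real
  formula.\<close>

lemma Parseval:
  fixes f g :: "real \<Rightarrow> complex"
  assumes f: "continuous_on {0..pi} f" and g: "continuous_on {0..pi} g"
  shows "(\<lambda>N. \<Sum>n\<le>N. integral {0..pi} (\<lambda>x. f x * cos (of_nat n * of_real x))
            * integral {0..pi} (\<lambda>x. g x * cos (of_nat n * of_real x)) / alpha0 n)
         \<longlonglongrightarrow> integral {0..pi} (\<lambda>x. f x * g x)"
proof -
  define \<gamma> :: "nat \<Rightarrow> real" where "\<gamma> n = (if n = 0 then pi else pi / 2)" for n
  have a0: "alpha0 n = complex_of_real (\<gamma> n)" for n by (simp add: alpha0_def \<gamma>_def)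
  have cc: "cos (of_nat n * of_real x) = complex_of_real (cos (real n * x))" for n x
    by (metis cos_of_real of_real_mult of_real_of_nat_eq)
  have coef: "integral {0..pi} (\<lambda>x. u x * cos (of_nat n * of_real x))
     = Complex (cosine.coef (\<lambda>x. Re (u x)) n) (cosine.coef (\<lambda>x. Im (u x)) n)"
    if "continuous_on {0..pi} u" for u n
  proof -
    have "(\<lambda>x. u x * complex_of_real (cos (real n * x))) integrable_on {0..pi}"
      by (intro integrable_continuous_interval continuous_intros that)
    then show ?thesis unfolding cc by (simp add: complex_eq_iff cosine.coef_def integral_Re_Im)
  qed
  note rl = Parseval_real[folded \<gamma>_def]
  have cR: "continuous_on {0..pi} (\<lambda>x. Re (u x))" "continuous_on {0..pi} (\<lambda>x. Im (u x))"
    if "continuous_on {0..pi} u" for u using that by (intro continuous_intros; simp)+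
  have ifg: "(\<lambda>x. f x * g x) integrable_on {0..pi}"
    by (intro integrable_continuous_interval continuous_intros f g)
  show ?thesis
  proof (rule tendsto_complex_iff[THEN iffD2], intro conjI)
    have "(\<lambda>N. (\<Sum>n\<le>N. cosine.coef (\<lambda>x. Re (f x)) n * cosine.coef (\<lambda>x. Re (g x)) n / \<gamma> n)
          - (\<Sum>n\<le>N. cosine.coef (\<lambda>x. Im (f x)) n * cosine.coef (\<lambda>x. Im (g x)) n / \<gamma> n))
       \<longlonglongrightarrow> integral {0..pi} (\<lambda>x. Re (f x) * Re (g x)) - integral {0..pi} (\<lambda>x. Im (f x) * Im (g x))"
      by (intro tendsto_diff rl cR f g)
    also have "integral {0..pi} (\<lambda>x. Re (f x) * Re (g x)) - integral {0..pi} (\<lambda>x. Im (f x) * Im (g x))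
        = Re (integral {0..pi} (\<lambda>x. f x * g x))"
      unfolding integral_Re_Im[OF ifg] complex_mult
      by (subst integral_diff[symmetric]) (auto intro!: integrable_continuous_interval continuous_intros f g)
    finally show "(\<lambda>N. Re (\<Sum>n\<le>N. integral {0..pi} (\<lambda>x. f x * cos (of_nat n * of_real x))
            * integral {0..pi} (\<lambda>x. g x * cos (of_nat n * of_real x)) / alpha0 n))
         \<longlonglongrightarrow> Re (integral {0..pi} (\<lambda>x. f x * g x))"
      by (simp add: coef[OF f] coef[OF g] a0 Re_divide_of_real sum_subtractf diff_divide_distrib)
    have "(\<lambda>N. (\<Sum>n\<le>N. cosine.coef (\<lambda>x. Re (f x)) n * cosine.coef (\<lambda>x. Im (g x)) n / \<gamma> n)
          + (\<Sum>n\<le>N. cosine.coef (\<lambda>x. Im (f x)) n * cosine.coef (\<lambda>x. Re (g x)) n / \<gamma> n))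
       \<longlonglongrightarrow> integral {0..pi} (\<lambda>x. Re (f x) * Im (g x)) + integral {0..pi} (\<lambda>x. Im (f x) * Re (g x))"
      by (intro tendsto_add rl cR f g)
    also have "integral {0..pi} (\<lambda>x. Re (f x) * Im (g x)) + integral {0..pi} (\<lambda>x. Im (f x) * Re (g x))
        = Im (integral {0..pi} (\<lambda>x. f x * g x))"
      unfolding integral_Re_Im[OF ifg] complex_mult
      by (subst integral_add[symmetric]) (auto intro!: integrable_continuous_interval continuous_intros f g)
    finally show "(\<lambda>N. Im (\<Sum>n\<le>N. integral {0..pi} (\<lambda>x. f x * cos (of_nat n * of_real x))
            * integral {0..pi} (\<lambda>x. g x * cos (of_nat n * of_real x)) / alpha0 n))
         \<longlonglongrightarrow> Im (integral {0..pi} (\<lambda>x. f x * g x))"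
      by (simp add: coef[OF f] coef[OF g] a0 Im_divide_of_real sum.distrib add_divide_distrib)
  qed
qed

section \<open>The sine series\<close>

text \<open>Multiplied by 2 sin(y/2), the sum telescopes to a difference of two cosines.\<close>

lemma sum_sin_bound:
  fixes y :: real
  assumes "sin (y / 2) > 0"
  shows "\<bar>\<Sum>n\<in>{m..<m+k}. sin (real n * y)\<bar> \<le> 1 / sin (y / 2)"
proof -
  have *: "2 * sin (y/2) * (\<Sum>n\<in>{m..<m+k}. sin (real n * y)) = cos ((real m - 1/2) * y) - cos ((real (m + k) - 1/2) * y)"
  proof (induction k)
    case (Suc k)
    have "cos ((real (m + k) - 1/2) * y) - cos ((real (m + Suc k) - 1/2) * y)
        = cos (real (m + k) * y - y/2) - cos (real (m + k) * y + y/2)"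
      by (simp add: algebra_simps)
    also have "\<dots> = 2 * sin (y/2) * sin (real (m + k) * y)" by (simp add: cos_diff cos_add)
    finally show ?case using Suc by (simp add: algebra_simps)
  qed simp
  have "\<bar>2 * sin (y/2) * (\<Sum>n\<in>{m..<m+k}. sin (real n * y))\<bar> \<le> 2"
    unfolding * using cos_le_one[of "(real m - 1/2) * y"] cos_ge_minus_one[of "(real m - 1/2) * y"]
      cos_le_one[of "(real (m + k) - 1/2) * y"] cos_ge_minus_one[of "(real (m + k) - 1/2) * y"] by linarith
  then show ?thesis using assms by (simp add: abs_mult field_simps)
qed

text \<open>Abel summation: the differences of the weights are nonnegative and telescope, so only a
  bound on the partial sums of \<open>s\<close> enters.\<close>

lemma sum_decreasing_weights_bound:
  fixes s w :: "nat \<Rightarrow> real"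
  assumes S: "\<And>k. \<bar>\<Sum>n\<in>{m..<m+k}. s n\<bar> \<le> B"
    and w: "\<And>n. w (Suc n) \<le> w n" "\<And>n. w n \<ge> 0"
  shows "\<bar>\<Sum>n\<in>{m..<m+k}. w n * s n\<bar> \<le> B * w m"
proof -
  define S where "S k = (\<Sum>n\<in>{m..<m+k}. s n)" for k
  have eq: "(\<Sum>n\<in>{m..<m+k}. w n * s n) = w (m + k) * S k + (\<Sum>j<k. (w (m + j) - w (m + Suc j)) * S (Suc j))" for k
  proof (induction k)
    case (Suc k)
    then show ?case by (simp add: S_def algebra_simps)
  qed (simp add: S_def)
  have tel: "(\<Sum>j<k. w (m + j) - w (m + Suc j)) = w m - w (m + k)" for k
    by (induction k) auto
  have "\<bar>\<Sum>n\<in>{m..<m+k}. w n * s n\<bar> \<le> \<bar>w (m + k) * S k\<bar> + (\<Sum>j<k. \<bar>(w (m + j) - w (m + Suc j)) * S (Suc j)\<bar>)"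
    unfolding eq by (rule order_trans[OF abs_triangle_ineq]) (simp add: sum_abs)
  also have "\<dots> \<le> w (m + k) * B + (\<Sum>j<k. (w (m + j) - w (m + Suc j)) * B)"
  proof (intro add_mono sum_mono)
    show "\<bar>w (m + k) * S k\<bar> \<le> w (m + k) * B"
      using S[of k] w(2) by (simp add: abs_mult S_def mult_left_mono)
    fix j
    have "w (m + j) - w (m + Suc j) \<ge> 0" using w(1)[of "m + j"] by simp
    then show "\<bar>(w (m + j) - w (m + Suc j)) * S (Suc j)\<bar> \<le> (w (m + j) - w (m + Suc j)) * B"
      using S[of "Suc j"] unfolding abs_mult S_def by (simp add: mult_left_mono del: sum.op_ivl_Suc)
  qed
  also have "\<dots> = B * w m" unfolding sum_distrib_right[symmetric] tel by (simp add: algebra_simps)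
  finally show ?thesis .
qed

lemma sin_series_tail_bound:
  fixes y :: real
  assumes "sin (y / 2) > 0"
  shows "\<bar>\<Sum>n\<in>{Suc m..<Suc m+k}. sin (real n * y) / real n\<bar> \<le> 1 / (real (Suc m) * sin (y / 2))"
proof -
  \<comment> \<open>The plain reciprocal is 0 at \<open>n = 0\<close> and would not be decreasing
    there.\<close>
  define w where "w n = 1 / real (max n 1)" for n
  have "\<bar>\<Sum>n\<in>{Suc m..<Suc m+k}. w n * sin (real n * y)\<bar> \<le> (1 / sin (y/2)) * w (Suc m)"
    by (intro sum_decreasing_weights_bound sum_sin_bound assms)
       (auto simp: w_def divide_simps)
  moreover have "w n * sin (real n * y) = sin (real n * y) / real n" if "n \<in> {Suc m..<Suc m+k}" for n
    using that by (simp add: w_def max_def)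
  then have "(\<Sum>n\<in>{Suc m..<Suc m+k}. w n * sin (real n * y)) = (\<Sum>n\<in>{Suc m..<Suc m+k}. sin (real n * y) / real n)"
    by (rule sum.cong[OF refl])
  ultimately show ?thesis by (simp add: w_def mult.commute del: sum.op_ivl_Suc)
qed

text \<open>The sum is cut near 1/y. Up to there every term is at most y, which gives 1 in total;
  beyond, the tail bound together with sin(y/2) >= y/pi, from concavity, gives pi.\<close>

lemma sin_series_partial_bound_aux:
  fixes y :: real
  assumes "0 < y" "y \<le> pi"
  shows "\<bar>\<Sum>n<N. sin (real n * y) / real n\<bar> \<le> 1 + pi"
proof -
  define m where "m = nat \<lfloor>1 / y\<rfloor>"
  have m: "real m \<le> 1 / y" "1 / y < real (Suc m)"
    using assms by (auto simp: m_def) linarith+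
  have head: "\<bar>\<Sum>n<k. sin (real n * y) / real n\<bar> \<le> 1" if "k \<le> Suc m" for k
  proof -
    have t: "\<bar>sin (real n * y) / real n\<bar> \<le> (if n = 0 then 0 else y)" for n
      using abs_sin_x_le_abs_x[of "real n * y"] assms
      by (auto simp: abs_mult divide_simps mult.commute)
    have "\<bar>\<Sum>n<k. sin (real n * y) / real n\<bar> \<le> (\<Sum>n<k. if n = 0 then 0 else y)"
      by (rule order_trans[OF sum_abs sum_mono]) (rule t)
    also have "\<dots> \<le> (\<Sum>n<Suc m. if n = 0 then 0 else y)"
      using assms that by (intro sum_mono2) auto
    also have "\<dots> = real m * y" by (subst sum.lessThan_Suc_shift) simp
    also have "\<dots> \<le> 1" using m(1) assms by (simp add: field_simps)
    finally show ?thesis .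
  qed
  show ?thesis
  proof (cases "N \<le> Suc m")
    case True
    then show ?thesis using head[OF True] by (smt (verit) pi_gt_zero)
  next
    case False
    then obtain k where N: "N = Suc m + k" using le_Suc_ex nat_le_linear by blast
    have jord: "sin (y / 2) \<ge> y / pi"
    proof -
      have "concave_on {0..pi} sin" 
        by (rule f''_le0_imp_concave[where f'="cos" and f''="\<lambda>x. - sin x"])
          (auto intro!: derivative_eq_intros sin_ge_zero)
      then show ?thesis
        using concave_onD[of "{0..pi}" sin "y / pi" 0 "pi / 2"] assms by simp
    qed
    have pos: "sin (y/2) > 0" using assms by (intro sin_gt_zero) auto
    have "(\<Sum>n<N. sin (real n * y) / real n) = (\<Sum>n<Suc m. sin (real n * y) / real n)
        + (\<Sum>n\<in>{Suc m..<Suc m+k}. sin (real n * y) / real n)"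
      unfolding N by (simp add: lessThan_atLeast0 sum.atLeastLessThan_concat del: sum.op_ivl_Suc)
    then have "\<bar>\<Sum>n<N. sin (real n * y) / real n\<bar> \<le> 1 + 1 / (real (Suc m) * sin (y / 2))"
      using head[of "Suc m"] sin_series_tail_bound[OF pos, of m k] by linarith
    also have "1 / (real (Suc m) * sin (y / 2)) \<le> pi"
    proof -
      have "real (Suc m) * sin (y / 2) \<ge> (1 / y) * (y / pi)"
        using m(2) jord assms by (intro mult_mono) auto
      then have "real (Suc m) * sin (y / 2) \<ge> 1 / pi" using assms by simp
      then show ?thesis using pos by (simp add: divide_simps mult.commute)
    qed
    finally show ?thesis by simp
  qed
qed

text \<open>The sum is odd and changes sign under the reflection of y to 2 pi - y, which reduces
  everything to 0 < y <= pi. The range up to 2 pi is what x + t and x - t require.\<close>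

lemma sin_series_partial_bound:
  fixes y :: real
  assumes "\<bar>y\<bar> \<le> 2 * pi"
  shows "\<bar>\<Sum>n<N. sin (real n * y) / real n\<bar> \<le> 1 + pi"
proof -
  define s where "s y = (\<Sum>n<N. sin (real n * y) / real n)" for y
  have odd: "s (- y) = - s y" for y by (simp add: s_def sum_negf)
  have per: "s (2 * pi - y) = - s y" for y
  proof -
    have "sin (real n * (2 * pi - y)) = - sin (real n * y)" for n
    proof -
      have "sin (real n * (2 * pi - y)) = sin (2 * pi * real n - real n * y)" by (simp add: algebra_simps)
      moreover have "sin (2 * pi * real n) = 0" "cos (2 * pi * real n) = 1"
        using sin_2npi[of n] cos_2npi[of n] by (simp_all add: algebra_simps)
      ultimately show ?thesis by (simp add: sin_diff)
    qed
    then show ?thesis by (simp add: s_def sum_negf)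
  qed
  have b: "\<bar>s y\<bar> \<le> 1 + pi" if "0 < y" "y \<le> pi" for y
    using sin_series_partial_bound_aux[OF that] by (simp add: s_def)
  have b2: "\<bar>s y\<bar> \<le> 1 + pi" if y: "0 \<le> y" "y \<le> 2 * pi" for y
  proof -
    consider "y = 0" | "y = 2 * pi" | "0 < y" "y \<le> pi" | "pi < y" "y < 2 * pi" using y by linarith
    then show ?thesis
    proof cases
      case 4 then show ?thesis using b[of "2 * pi - y"] per[of y] by simp
    next
      case 2 
      have "s 0 = 0" by (simp add: s_def)
      then show ?thesis using 2 per[of 0] pi_gt_zero by simp
    next
      case 1
      have "s 0 = 0" by (simp add: s_def)
      then show ?thesis using 1 pi_gt_zero by simp
    qed (use b in auto)
  qed
  show ?thesis using b2[of y] b2[of "-y"] odd[of y] assms unfolding s_def by (cases "y \<ge> 0") auto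
qed

text \<open>Inside (0, 2 pi) the tail bound is a Cauchy criterion; at 0 and at the end points all
  terms vanish.\<close>

lemma summable_sin_series:
  fixes y :: real
  assumes "\<bar>y\<bar> \<le> 2 * pi"
  shows "summable (\<lambda>n. sin (real n * y) / real n)"
proof -
  have main: "summable (\<lambda>n. sin (real n * y) / real n)" if "0 < y" "y < 2 * pi" for y :: real
  proof -
    have pos: "sin (y/2) > 0" using that by (intro sin_gt_zero) auto
    show ?thesis
      unfolding summable_Cauchy
    proof (intro allI impI)
      fix e :: real assume "e > 0"
      obtain m0 :: nat where m0: "real m0 > 1 / (e * sin (y/2))" using reals_Archimedean2 by blast
      have "norm (\<Sum>n\<in>{i..<j}. sin (real n * y) / real n) < e" if ge: "i \<ge> Suc m0" for i j
      proof (cases "i \<le> j")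
        case True
        obtain m where m: "i = Suc m" using Suc_le_D[OF ge] by blast
        obtain k where j: "j = Suc m + k" using True m le_Suc_ex by blast
        have "norm (\<Sum>n\<in>{i..<j}. sin (real n * y) / real n) \<le> 1 / (real (Suc m) * sin (y / 2))"
          using sin_series_tail_bound[OF pos, of m k] unfolding m j by simp
        also have "\<dots> < e"
        proof -
          have "1 / (e * sin (y/2)) < real (Suc m)" using m0 ge m by linarith
          then have "1 < e * (real (Suc m) * sin (y / 2))" using pos \<open>e > 0\<close> by (simp add: field_simps)
          then show ?thesis using pos by (simp add: pos_divide_less_eq)
        qed
        finally show ?thesis .
      qed (use \<open>e > 0\<close> in simp)
      then show "\<exists>N. \<forall>m\<ge>N. \<forall>n. norm (\<Sum>n\<in>{m..<n}. sin (real n * y) / real n) < e" by blast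
    qed
  qed
  have s2: "sin (real n * (2 * pi)) = 0" for n by (metis mult.commute sin_2npi mult.assoc)
  consider "y = 0" | "y = 2 * pi" | "y = - 2 * pi" | "0 < y" "y < 2 * pi" | "0 < - y" "- y < 2 * pi"
    using assms by linarith
  then show ?thesis
  proof cases
    case 5
    then show ?thesis using summable_minus[OF main[of "-y"]] by simp
  qed (use main s2 in auto)
qed

section \<open>Entire functions\<close>

lemma holomorphic_cos_transform:
  assumes "continuous_on {0..pi} v"
  shows "(\<lambda>\<rho>. integral {0..pi} (\<lambda>t. v t * cos (\<rho> * of_real t))) holomorphic_on UNIV"
proof -
  have "(\<lambda>\<rho>. integral (cbox 0 pi) (\<lambda>t. v t * cos (\<rho> * of_real t))) field_differentiable at \<rho>" for \<rho> :: complex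
  proof (rule leibniz_rule_field_differentiable)
    show "((\<lambda>\<rho>. v t * cos (\<rho> * of_real t)) has_field_derivative - (v t * sin (\<rho> * of_real t) * of_real t))
        (at \<rho> within UNIV)" for \<rho> t
      by (auto intro!: derivative_eq_intros)
    show "(\<lambda>t. v t * cos (\<rho> * of_real t)) integrable_on cbox 0 pi" for \<rho>
      by (rule integrable_continuous) (auto intro!: continuous_intros assms simp: assms)
    have "continuous_on (UNIV \<times> {0..pi}) (\<lambda>x::complex \<times> real. v (snd x))"
      by (rule continuous_on_compose2[OF assms]) (auto intro!: continuous_intros)
    then show "continuous_on (UNIV \<times> cbox 0 pi) (\<lambda>(\<rho>, t). - (v t * sin (\<rho> * of_real t) * of_real t))"
      unfolding split_beta by (auto intro!: continuous_intros)
  qed auto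
  then show ?thesis by (simp add: holomorphic_on_def)
qed

text \<open>\<open>csqrt\<close> is discontinuous across the negative axis. By evenness
  \<open>J (csqrt z)\<close> equals \<open>J (\<i> * csqrt (- z))\<close>, which is holomorphic off
  the nonnegative axis; the two domains cover everything except 0, and there continuity makes the
  singularity removable.\<close>

lemma holomorphic_even_csqrt:
  assumes hol: "J holomorphic_on UNIV" and even: "\<And>\<rho>. J (- \<rho>) = J \<rho>"
  shows "(\<lambda>z. J (csqrt z)) holomorphic_on UNIV"
proof (rule no_isolated_singularity[where K="{0}"])
  have contJ: "continuous_on UNIV J" using hol holomorphic_on_imp_continuous_on by blast
  have hol1: "(\<lambda>z. J (csqrt z)) holomorphic_on - \<real>\<^sub>\<le>\<^sub>0"
    by (rule holomorphic_on_compose_gen[OF _ hol, unfolded o_def]) (auto intro!: holomorphic_intros)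
  have "(\<lambda>z. J (\<i> * csqrt (- z))) holomorphic_on - \<real>\<^sub>\<ge>\<^sub>0"
    by (rule holomorphic_on_compose_gen[OF _ hol, unfolded o_def])
       (auto intro!: holomorphic_intros simp: complex_nonpos_Reals_iff complex_nonneg_Reals_iff)
  moreover have "J (\<i> * csqrt (- z)) = J (csqrt z)" for z
  proof -
    have "(\<i> * csqrt (- z))\<^sup>2 = (csqrt z)\<^sup>2" by (simp add: power_mult_distrib)
    then have "\<i> * csqrt (- z) = csqrt z \<or> \<i> * csqrt (- z) = - csqrt z" using power2_eq_iff by blast
    then show ?thesis using even by metis
  qed
  ultimately have "(\<lambda>z. J (csqrt z)) holomorphic_on - \<real>\<^sub>\<ge>\<^sub>0" by simp
  then have "(\<lambda>z. J (csqrt z)) holomorphic_on (- \<real>\<^sub>\<ge>\<^sub>0 \<union> - \<real>\<^sub>\<le>\<^sub>0)"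
    using hol1 by (intro holomorphic_on_Un) (auto intro!: open_Compl simp: closed_nonneg_Reals_complex closed_nonpos_Reals_complex)
  moreover have "UNIV - {0::complex} = - \<real>\<^sub>\<ge>\<^sub>0 \<union> - \<real>\<^sub>\<le>\<^sub>0"
    by (auto simp: complex_nonpos_Reals_iff complex_nonneg_Reals_iff complex_eq_iff)
  ultimately show hol0: "(\<lambda>z. J (csqrt z)) holomorphic_on (UNIV - {0})" by simp
  have "isCont (\<lambda>z. J (csqrt z)) z" for z
  proof (cases "z = 0")
    case True
    have "((\<lambda>z. csqrt z) \<longlongrightarrow> 0) (at 0)"
    proof (rule tendsto_norm_zero_cancel)
      have "((\<lambda>z::complex. sqrt (norm z)) \<longlongrightarrow> sqrt (norm (0::complex))) (at 0)"
        by (intro tendsto_intros)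
      then show "((\<lambda>z. norm (csqrt z)) \<longlongrightarrow> 0) (at 0)" by (simp add: norm_csqrt)
    qed
    then have "((\<lambda>z. J (csqrt z)) \<longlongrightarrow> J 0) (at 0)"
      by (rule isCont_tendsto_compose[rotated]) (use contJ in \<open>simp add: continuous_on_eq_continuous_at\<close>)
    then show ?thesis using True by (simp add: isCont_def)
  next
    case False
    then show ?thesis
      using holomorphic_on_imp_continuous_on[OF hol0]
      by (simp add: continuous_on_eq_continuous_at open_Diff)
  qed
  then show "continuous_on UNIV (\<lambda>z. J (csqrt z))" by (simp add: continuous_on_eq_continuous_at)
qed auto

text \<open>The argument is the spectral parameter z = rho^2. As the cosine is even, the branch of
  the root is immaterial and the transform is entire in z.\<close>

definition cos_transform :: "(real \<Rightarrow> complex) \<Rightarrow> complex \<Rightarrow> complex" where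
  "cos_transform v z = integral {0..pi} (\<lambda>t. v t * cos (csqrt z * of_real t))"

lemma holomorphic_on_cos_transform:
  assumes "continuous_on {0..pi} v"
  shows "cos_transform v holomorphic_on S"
proof -
  have "(\<lambda>z. integral {0..pi} (\<lambda>t. v t * cos (csqrt z * of_real t))) holomorphic_on UNIV"
    by (rule holomorphic_even_csqrt[OF holomorphic_cos_transform[OF assms]]) simp
  then show ?thesis unfolding cos_transform_def[abs_def] by (rule holomorphic_on_subset) auto
qed

text \<open>Every zero of \<open>g\<close> is simple and is a zero of \<open>f\<close>, so the
  quotient has removable singularities only; the value to be put there is the quotient of the
  derivatives.\<close>

lemma entire_quotient:
  assumes f: "f holomorphic_on UNIV" and g: "g holomorphic_on UNIV"
    and zeros: "\<And>z. g z = 0 \<Longrightarrow> f z = 0 \<and> deriv g z \<noteq> 0"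
  obtains \<phi> where "\<phi> holomorphic_on UNIV" "\<And>z. f z = \<phi> z * g z"
proof -
  define \<phi> where "\<phi> z = (if g z = 0 then deriv f z / deriv g z else f z / g z)" for z
  have contg: "isCont g z" for z
    using holomorphic_on_imp_continuous_on[OF g] by (simp add: continuous_on_eq_continuous_at)
  have "\<phi> analytic_on {z}" for z
  proof (cases "g z = 0")
    case False
    then obtain e where "e > 0" and e: "\<And>y. dist z y < e \<Longrightarrow> g y \<noteq> 0"
      using continuous_at_avoid[OF contg[of z], of 0] by metis
    have "(\<lambda>z. f z / g z) holomorphic_on ball z e"
      using e f g by (intro holomorphic_intros) (auto intro: holomorphic_on_subset)
    then have "\<phi> holomorphic_on ball z e"
      by (rule holomorphic_transform) (use e in \<open>auto simp: \<phi>_def\<close>)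
    then show ?thesis using \<open>e > 0\<close> analytic_at_ball by blast
  next
    case True
    have fd: "(f has_field_derivative deriv f z) (at z)" and gd: "(g has_field_derivative deriv g z) (at z)"
      using f g by (auto intro!: holomorphic_derivI)
    have lim: "((\<lambda>y. ((f y - f z) / (y - z)) / ((g y - g z) / (y - z))) \<longlongrightarrow> deriv f z / deriv g z) (at z)"
      using fd gd zeros[OF True] unfolding has_field_derivative_iff by (intro tendsto_divide) auto
    have "((\<lambda>y. (g y - g z) / (y - z)) \<longlongrightarrow> deriv g z) (at z)"
      using gd unfolding has_field_derivative_iff .
    then have "\<forall>\<^sub>F y in at z. (g y - g z) / (y - z) \<noteq> 0"
      using zeros[OF True] by (intro tendsto_imp_eventually_ne) auto
    then obtain e where "e > 0" and e: "\<And>y. y \<noteq> z \<Longrightarrow> dist y z < e \<Longrightarrow> g y \<noteq> 0"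
      using True unfolding eventually_at by auto
    have hol: "\<phi> holomorphic_on ball z e"
    proof (rule no_isolated_singularity'[where K="{z}"])
      have "(\<lambda>z. f z / g z) holomorphic_on (ball z e - {z})"
        using e f g by (intro holomorphic_intros) (auto intro: holomorphic_on_subset simp: dist_commute)
      then show "\<phi> holomorphic_on (ball z e - {z})"
        by (rule holomorphic_transform) (use e in \<open>auto simp: \<phi>_def dist_commute\<close>)
      fix y assume "y \<in> {z}"
      have "(\<phi> \<longlongrightarrow> deriv f z / deriv g z) (at z)"
      proof (rule Lim_transform_eventually[OF lim])
        have "\<forall>\<^sub>F y in at z. y \<noteq> z \<and> dist y z < e"
          using \<open>e > 0\<close> by (auto simp: eventually_at)
        then show "\<forall>\<^sub>F y in at z. ((f y - f z) / (y - z)) / ((g y - g z) / (y - z)) = \<phi> y"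
          by eventually_elim (use e zeros[OF True] True in \<open>auto simp: \<phi>_def\<close>)
      qed
      then show "(\<phi> \<longlongrightarrow> \<phi> y) (at y within ball z e)"
        using \<open>y \<in> {z}\<close> True by (auto simp: \<phi>_def intro: tendsto_within_subset)
    qed auto
    then show ?thesis using \<open>e > 0\<close> analytic_at_ball by blast
  qed
  then have "\<phi> analytic_on UNIV" using analytic_on_analytic_at by blast
  then have "\<phi> holomorphic_on UNIV" by (simp add: analytic_imp_holomorphic)
  moreover have "f z = \<phi> z * g z" for z using zeros[of z] by (simp add: \<phi>_def)
  ultimately show thesis using that by blast
qed

section \<open>The Sturm-Liouville equation\<close>

text \<open>The end points are put into the exceptional set, so that an almost everywhere statement
  on the open interval can be used on the closed one.\<close>

lemma AE_lebesgue_on_imp_negligible: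
  assumes "AE x in lebesgue_on {0<..<pi}. P x"
  obtains N where "negligible N" "\<And>x. x \<in> {0..pi} - N \<Longrightarrow> x \<in> {0<..<pi} \<and> P x"
proof -
  have "AE x in lebesgue. x \<in> {0<..<pi} \<longrightarrow> P x"
    using assms by (subst (asm) AE_restrict_space_iff) auto
  then obtain N where N: "{x. \<not> (x \<in> {0<..<pi} \<longrightarrow> P x)} \<subseteq> N" "N \<in> null_sets lebesgue"
    by (auto simp: eventually_ae_filter)
  then have "negligible (N \<union> {0, pi})" by (simp add: negligible_iff_null_sets[symmetric] negligible_Un_eq)
  moreover have "x \<in> {0<..<pi} \<and> P x" if "x \<in> {0..pi} - (N \<union> {0, pi})" for x
    using that N(1) by (auto simp: subset_iff order.order_iff_strict)
  ultimately show thesis using that by blast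
qed

lemma dx_eqI:
  assumes "(y has_vector_derivative d) (at x within {0..pi})" "x \<in> {0..pi}"
  shows "dx y x = d"
  unfolding dx_def using assms by (intro vector_derivative_within_closed_interval) auto

lemma abs_cont_on_cong:
  assumes "\<And>x. x \<in> {a..b} \<Longrightarrow> f x = g x"
  shows "abs_cont_on a b f \<longleftrightarrow> abs_cont_on a b g"
proof -
  have "(\<Sum>(u,v)\<in>D. norm (f v - f u)) = (\<Sum>(u,v)\<in>D. norm (g v - g u))"
    if "\<forall>(u,v)\<in>D. a \<le> u \<and> u < v \<and> v \<le> b" for D
    using that assms by (intro sum.cong) fastforce+
  then show ?thesis unfolding abs_cont_on_def by (intro all_cong1 imp_cong ex_cong1 conj_cong refl) auto
qed

lemma abs_cont_on_subinterval:
  assumes "abs_cont_on a b f" "b' \<le> b"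
  shows "abs_cont_on a b' f"
  unfolding abs_cont_on_def
proof (intro allI impI)
  fix e :: real assume "e > 0"
  then obtain d where "d > 0" and d: "\<And>D. finite D \<Longrightarrow>
        (\<forall>(u,v)\<in>D. a \<le> u \<and> u < v \<and> v \<le> b) \<Longrightarrow>
        disjoint_family_on (\<lambda>(u,v). {u<..<v}) D \<Longrightarrow>
        (\<Sum>(u,v)\<in>D. v - u) < d \<Longrightarrow> (\<Sum>(u,v)\<in>D. norm (f v - f u)) < e"
    using assms unfolding abs_cont_on_def by meson
  show "\<exists>\<delta>>0. \<forall>D. finite D \<longrightarrow>
        (\<forall>(u,v)\<in>D. a \<le> u \<and> u < v \<and> v \<le> b') \<longrightarrow>
        disjoint_family_on (\<lambda>(u,v). {u<..<v}) D \<longrightarrow>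
        (\<Sum>(u,v)\<in>D. v - u) < \<delta> \<longrightarrow> (\<Sum>(u,v)\<in>D. norm (f v - f u)) < e"
    using \<open>d > 0\<close> assms(2) by (intro exI[of _ d] conjI allI impI d) fastforce+
qed

lemma sl_eqD:
  assumes "sl_eq q y g"
  shows "\<And>x. x \<in> {0..pi} \<Longrightarrow> (y has_vector_derivative dx y x) (at x within {0..pi})"
    and "continuous_on {0..pi} (dx y)" and "continuous_on {0..pi} y" and "abs_cont_on 0 pi y"
proof -
  show d: "(y has_vector_derivative dx y x) (at x within {0..pi})" if "x \<in> {0..pi}" for x
    using assms that unfolding sl_eq_def dx_def vector_derivative_works[symmetric] by blast
  show c: "continuous_on {0..pi} (dx y)"
    using assms unfolding sl_eq_def by (intro abs_cont_on_imp_continuous_on) auto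
  show "continuous_on {0..pi} y"
    using d by (meson continuous_on_eq_continuous_within has_vector_derivative_continuous)
  show "abs_cont_on 0 pi y" using d c by (rule C1_imp_abs_cont_on)
qed

text \<open>Explicit smooth functions thereby become admissible in the Lagrange identity: potential
  0, with the second derivative as inhomogeneity.\<close>

lemma sl_eq_smooth:
  assumes "\<And>x. (z has_vector_derivative z' x) (at x)" "\<And>x. (z' has_vector_derivative z'' x) (at x)"
    "continuous_on {0..pi} z''"
  shows "sl_eq (\<lambda>_. 0) z z''" and "\<And>x. x \<in> {0..pi} \<Longrightarrow> dx z x = z' x"
proof -
  have d: "(z has_vector_derivative z' x) (at x within {0..pi})" "(z' has_vector_derivative z'' x) (at x within {0..pi})" for x
    using assms by (auto intro: has_vector_derivative_at_within)
  show dz: "dx z x = z' x" if "x \<in> {0..pi}" for x using dx_eqI[OF d(1) that] .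
  have "abs_cont_on 0 pi (dx z)"
    using C1_imp_abs_cont_on[OF d(2) assms(3)] dz abs_cont_on_cong[of 0 pi "dx z" z'] by auto
  moreover have "(dx z has_vector_derivative z'' x) (at x)" if "x \<in> {0<..<pi}" for x
    by (rule has_vector_derivative_transform_within_open[OF assms(2), of "{0<..<pi}"])
       (use that dz in auto)
  then have "AE x in lebesgue_on {0<..<pi}. (dx z has_vector_derivative (complex_of_real 0 * z x + z'' x)) (at x)"
    by (intro AE_I2) simp
  ultimately show "sl_eq (\<lambda>_. 0) z z''"
    unfolding sl_eq_def using d(1) differentiableI_vector by blast
qed

lemma sl_eq_diff_scaled:
  assumes 1: "sl_eq q y g" and 2: "sl_eq q z k"
  shows "sl_eq q (\<lambda>x. y x - a * z x) (\<lambda>x. g x - a * k x)"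
    and "\<And>x. x \<in> {0..pi} \<Longrightarrow> dx (\<lambda>x. y x - a * z x) x = dx y x - a * dx z x"
proof -
  have d: "((\<lambda>x. y x - a * z x) has_vector_derivative dx y x - a * dx z x) (at x within {0..pi})"
    if "x \<in> {0..pi}" for x
    using sl_eqD(1)[OF 1 that] sl_eqD(1)[OF 2 that]
    by (intro has_vector_derivative_diff has_vector_derivative_mult_right)
  show dd: "dx (\<lambda>x. y x - a * z x) x = dx y x - a * dx z x" if "x \<in> {0..pi}" for x
    using dx_eqI[OF d[OF that] that] .
  have ca: "abs_cont_on 0 pi (\<lambda>x. a)" by (rule Lipschitz_imp_abs_cont_on[where B=0]) simp
  have "abs_cont_on 0 pi (\<lambda>x. dx y x - a * dx z x)"
    using 1 2 unfolding sl_eq_def by (auto intro!: abs_cont_on_diff[OF _ abs_cont_on_mult[OF ca]])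
  then have ac: "abs_cont_on 0 pi (dx (\<lambda>x. y x - a * z x))" using dd by (subst abs_cont_on_cong)
  have ae: "AE x in lebesgue_on {0<..<pi}. (dx (\<lambda>x. y x - a * z x) has_vector_derivative
      (complex_of_real (q x) * (y x - a * z x) + (g x - a * k x))) (at x)"
  proof -
    have "AE x in lebesgue_on {0<..<pi}. (dx y has_vector_derivative (complex_of_real (q x) * y x + g x)) (at x)"
      "AE x in lebesgue_on {0<..<pi}. (dx z has_vector_derivative (complex_of_real (q x) * z x + k x)) (at x)"
      using 1 2 unfolding sl_eq_def by auto
    then show ?thesis
    proof (rule AE_mp[OF AE_conjI], intro AE_I2 impI)
      fix x assume x: "x \<in> space (lebesgue_on {0<..<pi})"
        and "(dx y has_vector_derivative (complex_of_real (q x) * y x + g x)) (at x) \<and>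
             (dx z has_vector_derivative (complex_of_real (q x) * z x + k x)) (at x)"
      then have "((\<lambda>x. dx y x - a * dx z x) has_vector_derivative
          ((complex_of_real (q x) * y x + g x) - a * (complex_of_real (q x) * z x + k x))) (at x)"
        by (intro has_vector_derivative_diff has_vector_derivative_mult_right) auto
      also have "(complex_of_real (q x) * y x + g x) - a * (complex_of_real (q x) * z x + k x)
         = complex_of_real (q x) * (y x - a * z x) + (g x - a * k x)" by (simp add: algebra_simps)
      finally show "(dx (\<lambda>x. y x - a * z x) has_vector_derivative
          (complex_of_real (q x) * (y x - a * z x) + (g x - a * k x))) (at x)"
        by (rule has_vector_derivative_transform_within_open[of _ _ _ "{0<..<pi}"])
           (use x dd in auto)
    qed
  qed
  show "sl_eq q (\<lambda>x. y x - a * z x) (\<lambda>x. g x - a * k x)"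
    unfolding sl_eq_def by (intro conjI ballI ac ae differentiableI_vector[OF d])
qed

lemma has_vector_derivative_cnj':
  "(f has_vector_derivative d) F \<Longrightarrow> ((\<lambda>x. cnj (f x)) has_vector_derivative cnj d) F"
  using bounded_linear.has_vector_derivative[OF bounded_linear_cnj] .

text \<open>Conjugation commutes with the equation because the potential is real; this will show
  that the eigenfunctions are real.\<close>

lemma sl_eq_cnj:
  assumes "sl_eq q y g"
  shows "sl_eq q (\<lambda>x. cnj (y x)) (\<lambda>x. cnj (g x))"
    and "\<And>x. x \<in> {0..pi} \<Longrightarrow> dx (\<lambda>x. cnj (y x)) x = cnj (dx y x)"
proof -
  have d: "((\<lambda>x. cnj (y x)) has_vector_derivative cnj (dx y x)) (at x within {0..pi})"
    if "x \<in> {0..pi}" for x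
    using sl_eqD(1)[OF assms that] by (rule has_vector_derivative_cnj')
  show dd: "dx (\<lambda>x. cnj (y x)) x = cnj (dx y x)" if "x \<in> {0..pi}" for x
    using dx_eqI[OF d[OF that] that] .
  have acy: "abs_cont_on 0 pi (dx y)" using assms unfolding sl_eq_def by blast
  have "abs_cont_on 0 pi (\<lambda>x. cnj (dx y x))"
    by (rule abs_cont_on_dominated[OF acy acy, where A=1 and B=0])
       (simp add: complex_cnj_diff[symmetric] del: complex_cnj_diff)
  then have ac: "abs_cont_on 0 pi (dx (\<lambda>x. cnj (y x)))" using dd by (subst abs_cont_on_cong)
  have ae: "AE x in lebesgue_on {0<..<pi}. (dx (\<lambda>x. cnj (y x)) has_vector_derivative
      (complex_of_real (q x) * cnj (y x) + cnj (g x))) (at x)"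
  proof -
    have "AE x in lebesgue_on {0<..<pi}. (dx y has_vector_derivative (complex_of_real (q x) * y x + g x)) (at x)"
      using assms unfolding sl_eq_def by auto
    then show ?thesis
    proof (rule AE_mp, intro AE_I2 impI)
      fix x assume x: "x \<in> space (lebesgue_on {0<..<pi})"
        and "(dx y has_vector_derivative (complex_of_real (q x) * y x + g x)) (at x)"
      then have "((\<lambda>x. cnj (dx y x)) has_vector_derivative cnj (complex_of_real (q x) * y x + g x)) (at x)"
        by (intro has_vector_derivative_cnj')
      then have "((\<lambda>x. cnj (dx y x)) has_vector_derivative complex_of_real (q x) * cnj (y x) + cnj (g x)) (at x)"
        by simp
      then show "(dx (\<lambda>x. cnj (y x)) has_vector_derivative
          (complex_of_real (q x) * cnj (y x) + cnj (g x))) (at x)"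
        by (rule has_vector_derivative_transform_within_open[of _ _ _ "{0<..<pi}"])
           (use x dd in auto)
    qed
  qed
  show "sl_eq q (\<lambda>x. cnj (y x)) (\<lambda>x. cnj (g x))"
    unfolding sl_eq_def by (intro conjI ballI ac ae differentiableI_vector[OF d])
qed

text \<open>The integrand is the almost everywhere derivative of z y' - z' y, which is absolutely
  continuous. Two potentials are allowed: with \<open>r\<close> zero and a trigonometric
  \<open>z\<close> the identity becomes Duhamel's formula, with \<open>r\<close> equal to
  \<open>q\<close> it gives the Wronskian relation between two solutions.\<close>

lemma Lagrange_identity:
  assumes 1: "sl_eq q y g" and 2: "sl_eq r z k" and x: "x \<in> {0..pi}"
  shows "((\<lambda>t. z t * (q t * y t + g t) - (r t * z t + k t) * y t) has_integral
      (z x * dx y x - dx z x * y x) - (z 0 * dx y 0 - dx z 0 * y 0)) {0..x}"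
proof -
  obtain N1 where N1: "negligible N1" "\<And>x. x \<in> {0..pi} - N1 \<Longrightarrow> x \<in> {0<..<pi} \<and>
      (dx y has_vector_derivative (complex_of_real (q x) * y x + g x)) (at x)"
    using 1 unfolding sl_eq_def by (auto elim: AE_lebesgue_on_imp_negligible)
  obtain N2 where N2: "negligible N2" "\<And>x. x \<in> {0..pi} - N2 \<Longrightarrow> x \<in> {0<..<pi} \<and>
      (dx z has_vector_derivative (complex_of_real (r x) * z x + k x)) (at x)"
    using 2 unfolding sl_eq_def by (auto elim: AE_lebesgue_on_imp_negligible)
  show ?thesis
  proof (rule fundamental_theorem_of_calculus_abs_cont[where F="\<lambda>x. z x * dx y x - dx z x * y x"])
    show "negligible (N1 \<union> N2)" using N1 N2 by simp
    have "abs_cont_on 0 pi (dx y)" "abs_cont_on 0 pi (dx z)" using 1 2 unfolding sl_eq_def by auto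
    then have "abs_cont_on 0 pi (\<lambda>x. z x * dx y x - dx z x * y x)"
      by (rule abs_cont_on_diff[OF abs_cont_on_mult[OF sl_eqD(4)[OF 2]] abs_cont_on_mult[OF _ sl_eqD(4)[OF 1]]])
    then show "abs_cont_on 0 x (\<lambda>x. z x * dx y x - dx z x * y x)"
      by (rule abs_cont_on_subinterval) (use x in auto)
    fix t assume t: "t \<in> {0..x} - (N1 \<union> N2)"
    then have tp: "t \<in> {0..pi}" using x by auto
    have w: "(y has_vector_derivative dx y t) (at t within {0..x})" "(z has_vector_derivative dx z t) (at t within {0..x})"
      using x by (auto intro!: has_vector_derivative_within_subset[OF sl_eqD(1)[OF 1 tp]]
          has_vector_derivative_within_subset[OF sl_eqD(1)[OF 2 tp]])
    have w': "(dx y has_vector_derivative (complex_of_real (q t) * y t + g t)) (at t within {0..x})"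
      "(dx z has_vector_derivative (complex_of_real (r t) * z t + k t)) (at t within {0..x})"
      using N1(2)[of t] N2(2)[of t] t tp has_vector_derivative_at_within by blast+
    have "((\<lambda>x. z x * dx y x - dx z x * y x) has_vector_derivative
       (z t * (complex_of_real (q t) * y t + g t) + dx z t * dx y t)
       - (dx z t * dx y t + (complex_of_real (r t) * z t + k t) * y t)) (at t within {0..x})"
      by (intro has_vector_derivative_diff has_vector_derivative_mult w w')
    then show "((\<lambda>x. z x * dx y x - dx z x * y x) has_vector_derivative
       z t * (complex_of_real (q t) * y t + g t) - (complex_of_real (r t) * z t + k t) * y t) (at t within {0..x})"
      by simp
  qed (use x in auto)
qed

text \<open>Tested against x - t, the Lagrange identity expresses \<open>y x\<close> as the integral
  of (x - t)(p - \<mu>) y over [0, x]. If [0, s] with s < pi were the largest initial interval on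
  which \<open>y\<close> vanishes, then on a slightly longer one the maximum of |y| would be at most
  half of itself.\<close>

lemma sl_uniqueness:
  assumes p: "(\<lambda>x. complex_of_real (p x)) absolutely_integrable_on {0..pi}"
    and sl: "sl_eq p y (\<lambda>x. - (\<mu> * y x))" and y0: "y 0 = 0" "dx y 0 = 0"
  shows "\<And>x. x \<in> {0..pi} \<Longrightarrow> y x = 0"
proof -
  have cy: "continuous_on {0..pi} y" by (rule sl_eqD(3)[OF sl])
  have int_eq: "((\<lambda>t. of_real (x - t) * ((p t - \<mu>) * y t)) has_integral y x) {0..x}" if "x \<in> {0..pi}" for x
  proof -
    have 1: "((\<lambda>t. complex_of_real (x - t)) has_vector_derivative (\<lambda>_. - 1) t) (at t)" for t
      by (auto intro!: derivative_eq_intros)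
    have 2: "((\<lambda>t::real. - 1 :: complex) has_vector_derivative (\<lambda>_. 0) t) (at t)" for t
      by (auto intro!: derivative_eq_intros)
    note sm = sl_eq_smooth[OF 1 2 continuous_on_const]
    show ?thesis
      using Lagrange_identity[OF sl sm(1) that] y0 unfolding sm(2)[OF that] by (simp add: algebra_simps)
  qed
  define w where "w t = norm (complex_of_real (p t)) + norm \<mu>" for t
  have wi: "w integrable_on {0..pi}"
    using p unfolding w_def absolutely_integrable_on_def by (intro integrable_add) auto
  have w0: "w t \<ge> 0" for t by (simp add: w_def)
  define P where "P x = integral {0..x} w" for x
  have cP: "continuous_on {0..pi} P" unfolding P_def by (rule indefinite_integral_continuous_1[OF wi])
  define S where "S = {x \<in> {0..pi}. \<forall>t\<in>{0..x}. y t = 0}"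
  define s where "s = Sup S"
  have S0: "0 \<in> S" using y0 by (simp add: S_def)
  have bS: "bdd_above S" unfolding S_def by (rule bdd_aboveI[of _ pi]) auto
  have s: "0 \<le> s" "s \<le> pi"
    unfolding s_def using S0 bS by (auto intro!: cSup_upper cSup_least simp: S_def)
  have ys': "y t = 0" if t: "0 \<le> t" "t < s" for t
  proof -
    obtain x where "x \<in> S" "t < x" using t(2) S0 less_cSup_iff[of S t] bS unfolding s_def by blast
    then show ?thesis using t(1) by (simp add: S_def)
  qed
  have ys: "y t = 0" if "0 \<le> t" "t \<le> s" for t
  proof (cases "t < s")
    case False
    then have "t = s" using that by simp
    show ?thesis
    proof (cases "s = 0")
      case False
      have "{0..s} \<subseteq> closure {0..<s}" using False s by simp
      moreover have "y t = 0" if "t \<in> closure {0..<s}" for t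
        by (rule continuous_constant_on_closure[of "{0..<s}" y 0 t])
           (use that ys' False s in \<open>auto intro: continuous_on_subset[OF cy]\<close>)
      ultimately show ?thesis using \<open>t = s\<close> s by auto
    qed (use y0 \<open>t = s\<close> in simp)
  qed (use ys' that in auto)
  have "s = pi"
  proof (rule ccontr)
    assume "s \<noteq> pi"
    then have "s < pi" using s by simp
    \<comment> \<open>The factor \<open>m - t\<close> below is at most pi, so this bound on the
      increment of \<open>P\<close> produces the contraction constant 1/2.\<close>
    have "1 / (2 * pi) > 0" by simp
    then obtain d where "d > 0" and d: "\<And>x. x \<in> {0..pi} \<Longrightarrow> dist x s < d \<Longrightarrow> dist (P x) (P s) < 1 / (2 * pi)"
      using cP s unfolding continuous_on_iff by (metis atLeastAtMost_iff)
    define b where "b = min (s + d / 2) pi"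
    have b: "s < b" "b \<le> pi" "dist b s < d" using \<open>d > 0\<close> \<open>s < pi\<close> by (auto simp: b_def dist_real_def)
    have "continuous_on {s..b} (\<lambda>x. norm (y x))"
      using s b by (intro continuous_on_norm continuous_on_subset[OF cy]) auto
    then obtain m where m: "m \<in> {s..b}" "\<And>x. x \<in> {s..b} \<Longrightarrow> norm (y x) \<le> norm (y m)"
      using continuous_attains_sup[of "{s..b}" "\<lambda>x. norm (y x)"] b by auto
    have mp: "m \<in> {0..pi}" using m s b by auto
    have wi': "w integrable_on {0..m}" using integrable_on_subinterval[OF wi, of 0 m] mp by auto
    have wi2: "w integrable_on {s..m}" using integrable_on_subinterval[OF wi, of s m] mp m s by auto
    have bound: "norm (of_real (m - t) * ((p t - \<mu>) * y t)) \<le> (if t \<in> {s..m} then w t * (pi * norm (y m)) else 0)"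
      if "t \<in> {0..m}" for t
    proof (cases "t < s")
      case True then show ?thesis using ys that by simp
    next
      case False
      then have ts: "t \<in> {s..b}" "t \<in> {s..m}" using that m by auto
      have "norm (of_real (m - t) * ((p t - \<mu>) * y t)) = \<bar>m - t\<bar> * norm (p t - \<mu>) * norm (y t)"
        by (simp only: norm_mult norm_of_real mult.assoc)
      also have "\<dots> \<le> pi * w t * norm (y m)"
        unfolding w_def using that mp m(2)[OF ts(1)]
        by (intro mult_mono norm_triangle_ineq4) auto
      finally show ?thesis using ts by (simp add: algebra_simps)
    qed
    have "((\<lambda>t. w t * (pi * norm (y m))) has_integral (P m - P s) * (pi * norm (y m))) {s..m}"
    proof -
      have "(w has_integral (P m - P s)) {s..m}"
        using Henstock_Kurzweil_Integration.integral_combine[of 0 s m w] wi' s m wi2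
        unfolding P_def by (simp add: has_integral_iff)
      then show ?thesis by (rule has_integral_mult_left)
    qed
    then have hb: "((\<lambda>t. if t \<in> {s..m} then w t * (pi * norm (y m)) else 0) has_integral (P m - P s) * (pi * norm (y m))) {0..m}"
      by (subst has_integral_restrict) (use s in auto)
    have "norm (y m) = norm (integral {0..m} (\<lambda>t. of_real (m - t) * ((p t - \<mu>) * y t)))"
      using int_eq[OF mp] by (simp add: integral_unique)
    also have "\<dots> \<le> integral {0..m} (\<lambda>t. if t \<in> {s..m} then w t * (pi * norm (y m)) else 0)"
      using int_eq[OF mp] hb bound by (intro integral_norm_bound_integral) (auto simp: has_integral_iff)
    also have "\<dots> = (P m - P s) * (pi * norm (y m))" using hb by (rule integral_unique)
    also have "\<dots> \<le> 1 / (2 * pi) * (pi * norm (y m))"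
    proof (intro mult_right_mono)
      have "dist m s < d" using m b by (auto simp: dist_real_def)
      then show "P m - P s \<le> 1 / (2 * pi)" using d[OF mp] by (simp add: dist_real_def)
    qed auto
    finally have "y m = 0" by simp
    then have "y t = 0" if "t \<in> {s..b}" for t using m(2)[OF that] by simp
    then have "y t = 0" if "t \<in> {0..b}" for t using that ys[of t] by (cases "t \<le> s") auto
    then have "b \<in> S" using b s by (simp add: S_def)
    then have "b \<le> s" unfolding s_def using bS by (rule cSup_upper)
    then show False using b by simp
  qed
  then show "\<And>x. x \<in> {0..pi} \<Longrightarrow> y x = 0" using ys by auto
qed

section \<open>Volterra operators\<close>

text \<open>Moves variable limits of integration into the integrand, so that continuity in the
  limits becomes continuity of a parameter integral over [0, 1].\<close>

lemma integral_rescale_unit: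
  fixes \<phi> :: "real \<Rightarrow> complex"
  assumes "a \<le> b" "continuous_on {a..b} \<phi>"
  shows "integral {a..b} \<phi> = integral {0..1} (\<lambda>s. of_real (b - a) * \<phi> (a + (b - a) * s))"
proof -
  have "((\<lambda>s. (b - a) *\<^sub>R \<phi> (a + (b - a) * s)) has_integral (integral {a + (b - a) * 0..a + (b - a) * 1} \<phi>)) {0..1}"
  proof (rule has_integral_substitution[where c=a and d=b])
    show "(\<lambda>s. a + (b - a) * s) ` {0..1} \<subseteq> {a..b}"
    proof (clarsimp, intro conjI)
      fix s :: real assume s: "0 \<le> s" "s \<le> 1"
      show "0 \<le> (b - a) * s" using assms s by simp
      have "(b - a) * s \<le> (b - a) * 1" using assms s by (intro mult_left_mono) auto
      then show "a + (b - a) * s \<le> b" by simp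
    qed
  qed (use assms in \<open>auto intro!: derivative_eq_intros\<close>)
  from integral_unique[OF this] show ?thesis unfolding scaleR_conv_of_real by simp
qed

text \<open>The transpose of \<open>volterra K\<close> for the bilinear pairing on {0..pi}; no
  complex conjugate is involved.\<close>

definition adjoint_volterra :: "(real \<Rightarrow> real \<Rightarrow> complex) \<Rightarrow> (real \<Rightarrow> complex) \<Rightarrow> real \<Rightarrow> complex" where
  "adjoint_volterra K u t = u t + integral {t..pi} (\<lambda>x. K x t * u x)"

context
  fixes K :: "real \<Rightarrow> real \<Rightarrow> complex"
  assumes K: "continuous_kernel K"
begin

lemma continuous_kernel_compose:
  assumes "continuous_on S X" "continuous_on S T"
    and "\<And>z. z \<in> S \<Longrightarrow> 0 \<le> T z \<and> T z \<le> X z \<and> X z \<le> pi"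
  shows "continuous_on S (\<lambda>z. K (X z) (T z))"
proof -
  have "continuous_on S (\<lambda>z. (\<lambda>(x, t). K x t) (X z, T z))"
    by (rule continuous_on_compose2[OF K[unfolded continuous_kernel_def]])
       (use assms in \<open>auto intro!: continuous_intros\<close>)
  then show ?thesis by simp
qed

text \<open>The map t = x s carries the compact rectangle onto the triangle, and the kernel is
  continuous along it; at \<open>x = 0\<close> every \<open>s\<close> represents the corner.\<close>

lemma continuous_kernel_bounded:
  obtains M where "M > 0" "\<And>x t. 0 \<le> t \<Longrightarrow> t \<le> x \<Longrightarrow> x \<le> pi \<Longrightarrow> norm (K x t) \<le> M"
proof -
  have c: "continuous_on ({0..pi} \<times> {0..1}) (\<lambda>z. K (fst z) (fst z * snd z))"
    by (rule continuous_kernel_compose) (auto intro!: continuous_intros mult_left_le)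
  have "compact ((\<lambda>z. K (fst z) (fst z * snd z)) ` ({0..pi} \<times> {0..1}))"
    by (rule compact_continuous_image[OF c]) (intro compact_Times compact_Icc)
  from compact_imp_bounded[OF this] obtain M where "M > 0"
    and "\<forall>k\<in>(\<lambda>z. K (fst z) (fst z * snd z)) ` ({0..pi} \<times> {0..1}). norm k \<le> M"
    unfolding bounded_pos by auto
  then have M: "M > 0" "\<And>z. z \<in> {0..pi} \<times> {0..1} \<Longrightarrow> norm (K (fst z) (fst z * snd z)) \<le> M"
    by blast+
  show thesis
  proof (rule that[OF M(1)])
    fix x t :: real assume "0 \<le> t" "t \<le> x" "x \<le> pi"
    then show "norm (K x t) \<le> M"
      using M(2)[of "(x, 0)"] M(2)[of "(x, t / x)"] by (cases "x = 0") auto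
  qed
qed

lemma continuous_on_volterra_integral:
  assumes u: "continuous_on {0..pi} u"
  shows "continuous_on {0..pi} (\<lambda>x. integral {0..x} (\<lambda>t. K x t * u t))"
proof -
  have c: "continuous_on ({0..pi} \<times> cbox 0 1) (\<lambda>(x, s). of_real x * (K x (x * s) * u (x * s)))"
    unfolding split_beta
    by (intro continuous_intros continuous_kernel_compose continuous_on_compose2[OF u])
       (auto intro: mult_left_le order_trans[OF mult_left_le])
  have "continuous_on {0..pi} (\<lambda>x. integral (cbox 0 1) (\<lambda>s. of_real x * (K x (x * s) * u (x * s))))"
    by (rule integral_continuous_on_param[OF c])
  then show ?thesis
  proof (rule continuous_on_eq)
    show "integral (cbox 0 1) (\<lambda>s. of_real x * (K x (x * s) * u (x * s))) = integral {0..x} (\<lambda>t. K x t * u t)"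
    if "x \<in> {0..pi}" for x
    using that by (subst integral_rescale_unit)
      (auto intro!: continuous_intros continuous_kernel_compose continuous_on_subset[OF u])
  qed
qed

lemma continuous_on_volterra:
  assumes "continuous_on {0..pi} u"
  shows "continuous_on {0..pi} (volterra K u)"
  unfolding volterra_def using continuous_on_volterra_integral[OF assms] assms by (intro continuous_intros)

lemma continuous_on_adjoint_integral:
  assumes u: "continuous_on {0..pi} u"
  shows "continuous_on {0..pi} (\<lambda>t. integral {t..pi} (\<lambda>x. K x t * u x))"
proof -
  have b: "t + (pi - t) * s \<le> pi" if "0 \<le> t" "t \<le> pi" "0 \<le> s" "s \<le> 1" for t s
    using mult_left_le[of s "pi - t"] that by simp
  have c: "continuous_on ({0..pi} \<times> cbox 0 1)
     (\<lambda>(t, s). of_real (pi - t) * (K (t + (pi - t) * s) t * u (t + (pi - t) * s)))"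
    unfolding split_beta
    by (intro continuous_intros continuous_kernel_compose continuous_on_compose2[OF u])
       (auto intro: b)
  have "continuous_on {0..pi} (\<lambda>t. integral (cbox 0 1)
     (\<lambda>s. of_real (pi - t) * (K (t + (pi - t) * s) t * u (t + (pi - t) * s))))"
    by (rule integral_continuous_on_param[OF c])
  then show ?thesis
  proof (rule continuous_on_eq)
    show "integral (cbox 0 1) (\<lambda>s. of_real (pi - t) * (K (t + (pi - t) * s) t * u (t + (pi - t) * s)))
     = integral {t..pi} (\<lambda>x. K x t * u x)" if "t \<in> {0..pi}" for t
    using that by (subst integral_rescale_unit)
      (auto intro!: continuous_intros continuous_kernel_compose continuous_on_subset[OF u])
  qed
qed

lemma continuous_on_adjoint_volterra:
  assumes "continuous_on {0..pi} u"
  shows "continuous_on {0..pi} (adjoint_volterra K u)"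
  unfolding adjoint_volterra_def using continuous_on_adjoint_integral[OF assms] assms by (intro continuous_intros)

lemma integral_mult_volterra:
  assumes u: "continuous_on {0..pi} u" and v: "continuous_on {0..pi} v"
  shows "integral {0..pi} (\<lambda>x. u x * volterra K v x) = integral {0..pi} (\<lambda>t. adjoint_volterra K u t * v t)"
proof -
  have i: "f integrable_on {0..pi}" if "continuous_on {0..pi} f" for f :: "real \<Rightarrow> complex"
    using that by (rule integrable_continuous_interval)
  have "integral {0..pi} (\<lambda>x. u x * volterra K v x)
     = integral {0..pi} (\<lambda>x. u x * v x) + integral {0..pi} (\<lambda>x. u x * integral {0..x} (\<lambda>t. K x t * v t))"
    unfolding volterra_def distrib_left
    by (intro integral_add i continuous_intros continuous_on_volterra_integral u v)
  also have "integral {0..pi} (\<lambda>x. u x * integral {0..x} (\<lambda>t. K x t * v t))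
     = integral {0..pi} (\<lambda>t. v t * integral {t..pi} (\<lambda>x. K x t * u x))"
    by (rule integral_triangle_swap[OF K u])
       (auto intro!: absolutely_integrable_continuous_real indicator_borel_measurable_continuous v)
  also have "integral {0..pi} (\<lambda>x. u x * v x) + \<dots> = integral {0..pi} (\<lambda>x. u x * v x + v x * integral {x..pi} (\<lambda>y. K y x * u y))"
    by (intro integral_add[symmetric] i continuous_intros continuous_on_adjoint_integral u v)
  finally show ?thesis by (simp add: adjoint_volterra_def ring_distribs mult.commute)
qed

end

lemma norm_cos_le_exp: "norm (cos z) \<le> exp \<bar>Im z\<bar>"
proof -
  have "norm (exp (\<i> * z) + exp (- (\<i> * z))) \<le> exp \<bar>Im z\<bar> + exp \<bar>Im z\<bar>"
    by (rule norm_triangle_mono) simp_all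
  then show ?thesis by (simp add: cos_exp_eq norm_divide)
qed

lemma norm_cos_mult_le_exp: "t \<ge> 0 \<Longrightarrow> norm (cos (\<rho> * complex_of_real t)) \<le> exp (\<bar>Im \<rho>\<bar> * t)"
  using norm_cos_le_exp[of "\<rho> * of_real t"] by (simp add: abs_mult)

section \<open>The Sturm-Liouville problem\<close>

lemma dx_cong:
  assumes "\<And>x. x \<in> {0..pi} \<Longrightarrow> y x = z x" "x \<in> {0..pi}"
    and "z differentiable (at x within {0..pi})"
  shows "dx y x = dx z x"
proof (rule dx_eqI[OF _ assms(2)])
  have "(z has_vector_derivative dx z x) (at x within {0..pi})"
    using assms(3) unfolding dx_def vector_derivative_works[symmetric] .
  then show "(y has_vector_derivative dx z x) (at x within {0..pi})"
    using has_vector_derivative_transform[OF assms(2), of y z] assms(1) by blast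
qed

text \<open>Fubini requires a Borel measurable potential, so \<open>p\<close> is a Borel representative of $q$.\<close>

locale sturm_liouville =
  fixes p :: "real \<Rightarrow> real" and h H :: real
    and c :: "complex \<Rightarrow> real \<Rightarrow> complex" and lam :: "nat \<Rightarrow> real"
    and G K :: "real \<Rightarrow> real \<Rightarrow> complex"
  assumes p_borel: "p \<in> borel_measurable borel"
    and p_int: "(\<lambda>x. complex_of_real (p x)) absolutely_integrable_on {0..pi}"
    and p_sq: "(\<lambda>x. (p x)\<^sup>2) integrable_on {0..pi}"
    and cauchy: "\<And>\<rho>. cauchy_solution p h \<rho> (c \<rho>)"
    and eig: "eigenvalue_enumeration p h H lam"
    and G: "continuous_kernel G"
    and TG: "\<And>\<rho> x. x \<in> {0..pi} \<Longrightarrow> volterra G (\<lambda>s. cos (\<rho> * of_real s)) x = c \<rho> x"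
    and inv: "inverse_kernel G K"
begin

lemma sl_c: "sl_eq p (c \<rho>) (\<lambda>x. - (\<rho>\<^sup>2 * c \<rho> x))"
  and c_0 [simp]: "c \<rho> 0 = 1" and dx_c_0 [simp]: "dx (c \<rho>) 0 = of_real h"
  using cauchy[of \<rho>] by (auto simp: cauchy_solution_def)

lemma continuous_on_c [continuous_intros]: "continuous_on {0..pi} (c \<rho>)"
  by (rule sl_eqD(3)[OF sl_c])

text \<open>Evenness in rho is read off from the transmutation formula, because the cosine is
  even.\<close>

lemma c_cong:
  assumes "\<rho>\<^sup>2 = \<sigma>\<^sup>2" "x \<in> {0..pi}"
  shows "c \<rho> x = c \<sigma> x"
proof -
  have "\<rho> = \<sigma> \<or> \<rho> = - \<sigma>" using assms(1) power2_eq_iff by blast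
  then have "(\<lambda>s. cos (\<rho> * complex_of_real s)) = (\<lambda>s. cos (\<sigma> * of_real s))" by auto
  then show ?thesis using TG[OF assms(2), of \<rho>] TG[OF assms(2), of \<sigma>] by simp
qed

text \<open>The bound is that of the cosine, |cos(rho t)| <= exp(|Im rho| t), carried over by the
  bounded kernel \<open>G\<close>; the constant is thus independent of rho.\<close>

lemma c_bounded:
  obtains C where "C > 0" "\<And>\<rho> x. x \<in> {0..pi} \<Longrightarrow> norm (c \<rho> x) \<le> C * exp (\<bar>Im \<rho>\<bar> * x)"
proof -
  obtain M where M: "M > 0" "\<And>x t. 0 \<le> t \<Longrightarrow> t \<le> x \<Longrightarrow> x \<le> pi \<Longrightarrow> norm (G x t) \<le> M"
    using continuous_kernel_bounded[OF G] by metis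
  have "norm (c \<rho> x) \<le> (1 + pi * M) * exp (\<bar>Im \<rho>\<bar> * x)" if x: "x \<in> {0..pi}" for \<rho> x
  proof -
    let ?E = "exp (\<bar>Im \<rho>\<bar> * x)"
    have b: "norm (cos (\<rho> * of_real t)) \<le> ?E" if "t \<in> {0..x}" for t
    proof -
      have "norm (cos (\<rho> * of_real t)) \<le> exp (\<bar>Im \<rho>\<bar> * t)" using that by (intro norm_cos_mult_le_exp) auto
      also have "\<dots> \<le> ?E" using that by (simp add: mult_left_mono)
      finally show ?thesis .
    qed
    have "norm (integral {0..x} (\<lambda>s. G x s * cos (\<rho> * of_real s))) \<le> (M * ?E) * (x - 0)"
    proof (rule integral_bound)
      show "continuous_on {0..x} (\<lambda>s. G x s * cos (\<rho> * of_real s))"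
        using x by (intro continuous_intros continuous_kernel_compose[OF G]) auto
      show "norm (G x s * cos (\<rho> * of_real s)) \<le> M * ?E" if "s \<in> {0..x}" for s
        unfolding norm_mult using that x b[OF that] M by (intro mult_mono) auto
    qed (use x in auto)
    also have "\<dots> \<le> (M * ?E) * pi" using x M(1) by (intro mult_left_mono) auto
    finally have "norm (c \<rho> x) \<le> ?E + (M * ?E) * pi"
      unfolding TG[OF x, symmetric] volterra_def using b[of x] x by (intro norm_triangle_mono) auto
    then show ?thesis by (simp add: algebra_simps)
  qed
  then show thesis using that[of "1 + pi * M"] M(1) by (simp add: add_pos_pos)
qed

lemma p_mult_integrable:
  assumes "continuous_on {0..pi} u" "x \<in> {0..pi}"
  shows "(\<lambda>t. complex_of_real (p t) * u t) absolutely_integrable_on {0..x}"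
  using set_integrable_subset[OF absolutely_integrable_mult_continuous(1)[OF p_int assms(1)], of "{0..x}"] assms(2)
  by auto

lemma trig_derivatives:
  fixes \<rho> :: complex
  shows "((\<lambda>t. cos (\<rho> * of_real (x - t))) has_vector_derivative \<rho> * sin (\<rho> * of_real (x - t))) (at t)"
    and "((\<lambda>t. sin (\<rho> * of_real (x - t))) has_vector_derivative - \<rho> * cos (\<rho> * of_real (x - t))) (at t)"
proof -
  have "((\<lambda>z. cos (\<rho> * (of_real x - z))) has_field_derivative \<rho> * sin (\<rho> * (of_real x - of_real t))) (at (of_real t))"
    and "((\<lambda>z. sin (\<rho> * (of_real x - z))) has_field_derivative - \<rho> * cos (\<rho> * (of_real x - of_real t))) (at (of_real t))"
    by (auto intro!: derivative_eq_intros)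
  from this[THEN has_vector_derivative_real_field]
  show "((\<lambda>t. cos (\<rho> * of_real (x - t))) has_vector_derivative \<rho> * sin (\<rho> * of_real (x - t))) (at t)"
    and "((\<lambda>t. sin (\<rho> * of_real (x - t))) has_vector_derivative - \<rho> * cos (\<rho> * of_real (x - t))) (at t)"
    by simp_all
qed

text \<open>Lagrange identity of c(rho, .) against sin(rho (x - t)), which solves the equation with
  potential 0. Keeping the factor rho on the left makes the formula valid at rho = 0 as
  well.\<close>

lemma Duhamel:
  assumes x: "x \<in> {0..pi}"
  shows "\<rho> * c \<rho> x = \<rho> * cos (\<rho> * of_real x) + of_real h * sin (\<rho> * of_real x)
           + integral {0..x} (\<lambda>t. of_real (p t) * (sin (\<rho> * of_real (x - t)) * c \<rho> t))"
proof -
  have z: "((\<lambda>t. sin (\<rho> * of_real (x - t))) has_vector_derivative (\<lambda>t. - \<rho> * cos (\<rho> * of_real (x - t))) t) (at t)"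
    "((\<lambda>t. - \<rho> * cos (\<rho> * of_real (x - t))) has_vector_derivative (\<lambda>t. - \<rho> * (\<rho> * sin (\<rho> * of_real (x - t)))) t) (at t)" for t
    by (intro has_vector_derivative_mult_right trig_derivatives)+
  have "sl_eq (\<lambda>_. 0) (\<lambda>t. sin (\<rho> * of_real (x - t))) (\<lambda>t. - \<rho> * (\<rho> * sin (\<rho> * of_real (x - t))))"
    by (rule sl_eq_smooth(1)[OF z]) (intro continuous_intros)
  note L = Lagrange_identity[OF sl_c[of \<rho>] this x]
  have d: "dx (\<lambda>t. sin (\<rho> * of_real (x - t))) s = - \<rho> * cos (\<rho> * of_real (x - s))" if "s \<in> {0..pi}" for s
    by (rule sl_eq_smooth(2)[OF z _ that]) (intro continuous_intros)
  have z0: "0 \<in> {0..pi}" by simp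
  from L[unfolded d[OF x] d[OF z0]] have "((\<lambda>t. of_real (p t) * (sin (\<rho> * of_real (x - t)) * c \<rho> t)) has_integral
     \<rho> * c \<rho> x - (of_real h * sin (\<rho> * of_real x) + \<rho> * cos (\<rho> * of_real x))) {0..x}"
    by (rule has_integral_eq_rhs[OF has_integral_eq[rotated]])
       (auto simp: power2_eq_square algebra_simps)
  from integral_unique[OF this] show ?thesis by (simp add: algebra_simps)
qed

text \<open>The same with cos(rho (x - t)), whose derivative vanishes at t = x, so that the boundary
  term there is the derivative of c alone.\<close>

lemma Duhamel_derivative:
  assumes x: "x \<in> {0..pi}"
  shows "dx (c \<rho>) x = - \<rho> * sin (\<rho> * of_real x) + of_real h * cos (\<rho> * of_real x)
           + integral {0..x} (\<lambda>t. of_real (p t) * (cos (\<rho> * of_real (x - t)) * c \<rho> t))"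
proof -
  have z: "((\<lambda>t. cos (\<rho> * of_real (x - t))) has_vector_derivative (\<lambda>t. \<rho> * sin (\<rho> * of_real (x - t))) t) (at t)"
    "((\<lambda>t. \<rho> * sin (\<rho> * of_real (x - t))) has_vector_derivative (\<lambda>t. \<rho> * (- \<rho> * cos (\<rho> * of_real (x - t)))) t) (at t)" for t
    by (intro has_vector_derivative_mult_right trig_derivatives)+
  have "sl_eq (\<lambda>_. 0) (\<lambda>t. cos (\<rho> * of_real (x - t))) (\<lambda>t. \<rho> * (- \<rho> * cos (\<rho> * of_real (x - t))))"
    by (rule sl_eq_smooth(1)[OF z]) (intro continuous_intros)
  note L = Lagrange_identity[OF sl_c[of \<rho>] this x]
  have d: "dx (\<lambda>t. cos (\<rho> * of_real (x - t))) s = \<rho> * sin (\<rho> * of_real (x - s))" if "s \<in> {0..pi}" for s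
    by (rule sl_eq_smooth(2)[OF z _ that]) (intro continuous_intros)
  have z0: "0 \<in> {0..pi}" by simp
  from L[unfolded d[OF x] d[OF z0]] have "((\<lambda>t. of_real (p t) * (cos (\<rho> * of_real (x - t)) * c \<rho> t)) has_integral
     dx (c \<rho>) x - (of_real h * cos (\<rho> * of_real x) - \<rho> * sin (\<rho> * of_real x))) {0..x}"
    by (rule has_integral_eq_rhs[OF has_integral_eq[rotated]])
       (auto simp: power2_eq_square algebra_simps)
  from integral_unique[OF this] show ?thesis by (simp add: algebra_simps)
qed

definition char_fun :: "complex \<Rightarrow> complex" where
  "char_fun \<rho> = dx (c \<rho>) pi + of_real H * c \<rho> pi"

lemma Wronskian:
  "(\<rho>\<^sup>2 - \<sigma>\<^sup>2) * integral {0..pi} (\<lambda>x. c \<rho> x * c \<sigma> x) = c \<rho> pi * dx (c \<sigma>) pi - dx (c \<rho>) pi * c \<sigma> pi"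
proof -
  have "((\<lambda>t. (\<rho>\<^sup>2 - \<sigma>\<^sup>2) * (c \<rho> t * c \<sigma> t)) has_integral
     c \<rho> pi * dx (c \<sigma>) pi - dx (c \<rho>) pi * c \<sigma> pi) {0..pi}"
    by (rule has_integral_eq_rhs[OF has_integral_eq[rotated, OF Lagrange_identity[OF sl_c[of \<sigma>] sl_c[of \<rho>], of pi]]])
       (auto simp: algebra_simps)
  then show ?thesis by (metis integral_mult_right integral_unique)
qed

text \<open>The boundary condition at pi eliminates the derivative of c(\<sigma>, .). This one
  relation yields both the orthogonality of the eigenfunctions and the factorisation of the
  characteristic function at an eigenvalue.\<close>

lemma Wronskian_char:
  assumes "char_fun \<sigma> = 0"
  shows "(\<rho>\<^sup>2 - \<sigma>\<^sup>2) * integral {0..pi} (\<lambda>x. c \<rho> x * c \<sigma> x) = - c \<sigma> pi * char_fun \<rho>"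
proof -
  have "dx (c \<sigma>) pi = - of_real H * c \<sigma> pi"
    using assms by (simp add: char_fun_def eq_neg_iff_add_eq_0)
  then show ?thesis unfolding Wronskian char_fun_def by (simp add: algebra_simps)
qed

text \<open>By uniqueness an eigenfunction is \<open>y 0\<close> times \<open>c \<rho>\<close>, and
  \<open>y 0\<close> cannot be 0; so the condition at pi passes from one to the other.\<close>

lemma sl_eigenvalue_iff: "sl_eigenvalue p h H (\<rho>\<^sup>2) \<longleftrightarrow> char_fun \<rho> = 0"
proof
  assume "char_fun \<rho> = 0"
  then show "sl_eigenvalue p h H (\<rho>\<^sup>2)"
    unfolding sl_eigenvalue_def char_fun_def using sl_c[of \<rho>]
    by (intro exI[of _ "c \<rho>"]) (auto intro!: bexI[of _ 0])
next
  assume "sl_eigenvalue p h H (\<rho>\<^sup>2)"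
  then obtain y x where y: "sl_eq p y (\<lambda>x. - (\<rho>\<^sup>2 * y x))" "dx y 0 = of_real h * y 0"
    "dx y pi + of_real H * y pi = 0" and x: "x \<in> {0..pi}" "y x \<noteq> 0"
    unfolding sl_eigenvalue_def by auto
  define w where "w x = y x - y 0 * c \<rho> x" for x
  have w: "sl_eq p w (\<lambda>x. - (\<rho>\<^sup>2 * y x) - y 0 * - (\<rho>\<^sup>2 * c \<rho> x))"
    and dw: "dx w x = dx y x - y 0 * dx (c \<rho>) x" if "x \<in> {0..pi}" for x
    unfolding w_def[abs_def] using sl_eq_diff_scaled[OF y(1) sl_c[of \<rho>], where a="y 0"] that by auto
  have "(\<lambda>x. - (\<rho>\<^sup>2 * y x) - y 0 * - (\<rho>\<^sup>2 * c \<rho> x)) = (\<lambda>x. - (\<rho>\<^sup>2 * w x))"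
    by (auto simp: w_def algebra_simps)
  then have "sl_eq p w (\<lambda>x. - (\<rho>\<^sup>2 * w x))" using w[of 0] by simp
  then have w0: "w x = 0" if "x \<in> {0..pi}" for x
    by (rule sl_uniqueness[OF p_int]) (use that y(2) dw[of 0] in \<open>auto simp: w_def\<close>)
  have yc: "y x = y 0 * c \<rho> x" if "x \<in> {0..pi}" for x
    using w0[OF that] by (simp only: w_def right_minus_eq)
  have "dx w pi = dx (\<lambda>_. 0) pi" by (rule dx_cong) (use w0 in auto)
  also have "\<dots> = 0" by (rule dx_eqI) auto
  finally have "dx y pi = y 0 * dx (c \<rho>) pi" using dw[of pi] by simp
  then have "y 0 * char_fun \<rho> = 0"
    using y(3) yc[of pi] by (simp add: char_fun_def algebra_simps)
  moreover have "y 0 \<noteq> 0" using yc[OF x(1)] x(2) by auto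
  ultimately show "char_fun \<rho> = 0" by simp
qed

section \<open>Eigenfunctions, weight numbers and the characteristic function as an entire
  function\<close>

abbreviation r :: "nat \<Rightarrow> complex" where "r \<equiv> rho lam"

lemma r_sq [simp]: "(r n)\<^sup>2 = of_real (lam n)"
  by (simp add: rho_def)

lemma char_fun_r [simp]: "char_fun (r n) = 0"
  using eig unfolding eigenvalue_enumeration_def sl_eigenvalue_iff[symmetric] by auto

lemma char_fun_zeroD:
  assumes "char_fun \<rho> = 0"
  obtains n where "\<rho>\<^sup>2 = of_real (lam n)"
  using eig assms unfolding eigenvalue_enumeration_def sl_eigenvalue_iff[symmetric] by auto

lemma lam_mono: "strict_mono lam"
  using eig by (simp add: eigenvalue_enumeration_def)

text \<open>The conjugate solves the same Cauchy problem, because \<open>lam n\<close> and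
  \<open>h\<close> are real; this holds also when \<open>r n\<close> is imaginary.\<close>

lemma eigenfunction_real:
  assumes x: "x \<in> {0..pi}"
  shows "Im (c (r n) x) = 0"
proof -
  define w where "w x = cnj (c (r n) x) - 1 * c (r n) x" for x
  note cj = sl_eq_cnj[OF sl_c[of "r n"]]
  have "w = (\<lambda>x. cnj (c (r n) x) - 1 * c (r n) x)" by (auto simp: w_def)
  note d = sl_eq_diff_scaled[OF cj(1) sl_c[of "r n"], where a=1, folded this]
  have "(\<lambda>x. cnj (- ((r n)\<^sup>2 * c (r n) x)) - 1 * - ((r n)\<^sup>2 * c (r n) x)) = (\<lambda>x. - ((r n)\<^sup>2 * w x))"
    by (auto simp: w_def algebra_simps)
  then have "sl_eq p w (\<lambda>x. - ((r n)\<^sup>2 * w x))" using d(1) by simp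
  then have "w x = 0"
    by (rule sl_uniqueness[OF p_int]) (use x d(2)[of 0] cj(2)[of 0] in \<open>auto simp: w_def\<close>)
  then show ?thesis by (simp add: w_def complex_eq_iff)
qed

text \<open>\<open>alpha\<close> integrates the square and not the squared modulus, so positivity
  depends on the eigenfunction being real; it is not zero because its value at 0 is 1.\<close>

lemma alpha_pos: "Im (alpha c lam n) = 0" "Re (alpha c lam n) > 0"
proof -
  define u where "u x = Re (c (r n) x)" for x
  have cu: "c (r n) x = of_real (u x)" if "x \<in> {0..pi}" for x
    using eigenfunction_real[OF that, of n] by (simp add: u_def complex_eq_iff)
  have cont: "continuous_on {0..pi} u" unfolding u_def by (intro continuous_intros)
  have "alpha c lam n = integral {0..pi} (\<lambda>x. complex_of_real ((u x)\<^sup>2))"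
    unfolding alpha_def by (rule integral_cong) (simp add: cu)
  also have "\<dots> = of_real (integral {0..pi} (\<lambda>x. (u x)\<^sup>2))"
    using integral_linear[OF _ bounded_linear_of_real, of "\<lambda>x. (u x)\<^sup>2" "{0..pi}"]
    by (simp add: o_def integrable_continuous_interval continuous_on_power cont)
  finally have a: "alpha c lam n = of_real (integral {0..pi} (\<lambda>x. (u x)\<^sup>2))" .
  have "integral {0..pi} (\<lambda>x. (u x)\<^sup>2) \<noteq> 0"
  proof
    assume "integral {0..pi} (\<lambda>x. (u x)\<^sup>2) = 0"
    moreover have "continuous_on {0..pi} (\<lambda>x. (u x)\<^sup>2)" by (intro continuous_intros cont)
    ultimately have "(u 0)\<^sup>2 = 0"
      using integral_eq_0_iff[of 0 pi "\<lambda>x. (u x)\<^sup>2"] by auto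
    then show False using cu[of 0] by simp
  qed
  then show "Im (alpha c lam n) = 0" "Re (alpha c lam n) > 0"
    unfolding a using integral_nonneg_real[of "{0..pi}" u] by auto
qed

lemma alpha_nonzero [simp]: "alpha c lam n \<noteq> 0"
  using alpha_pos(2)[of n] by auto

text \<open>Transposing the transmutation operator makes any such integral a cosine transform. Hence
  it is entire in rho^2 and, for rho = n, a Fourier cosine coefficient.\<close>

lemma integral_mult_c:
  assumes "continuous_on {0..pi} u"
  shows "integral {0..pi} (\<lambda>x. u x * c \<rho> x) = cos_transform (adjoint_volterra G u) (\<rho>\<^sup>2)"
proof -
  have "integral {0..pi} (\<lambda>x. u x * c \<rho> x) = integral {0..pi} (\<lambda>x. u x * volterra G (\<lambda>s. cos (csqrt (\<rho>\<^sup>2) * of_real s)) x)"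
    by (rule integral_cong) (simp add: TG c_cong[of \<rho> "csqrt (\<rho>\<^sup>2)"])
  also have "\<dots> = cos_transform (adjoint_volterra G u) (\<rho>\<^sup>2)"
    unfolding cos_transform_def by (intro integral_mult_volterra G assms continuous_intros)
  finally show ?thesis .
qed

text \<open>Up to a constant factor this is the characteristic function divided by z - lam n; as a
  cosine transform it is visibly entire.\<close>

definition U :: "nat \<Rightarrow> complex \<Rightarrow> complex" where
  "U n = cos_transform (adjoint_volterra G (c (r n)))"

lemma U_eq: "U n (\<rho>\<^sup>2) = integral {0..pi} (\<lambda>x. c (r n) x * c \<rho> x)"
  unfolding U_def by (rule integral_mult_c[symmetric]) (rule continuous_on_c)

lemma U_holomorphic: "U n holomorphic_on S"
  unfolding U_def by (intro holomorphic_on_cos_transform continuous_on_adjoint_volterra G continuous_on_c)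

lemma U_lam: "U n (of_real (lam n)) = alpha c lam n"
  using U_eq[of n "r n", unfolded r_sq] unfolding alpha_def power2_eq_square .

lemma U_char: "(z - of_real (lam n)) * U n z = - c (r n) pi * char_fun (csqrt z)"
  using Wronskian_char[OF char_fun_r, of "csqrt z" n] U_eq[of n "csqrt z"] by (simp add: mult.commute)

text \<open>Otherwise \<open>U_char\<close> makes \<open>U n\<close> vanish off
  \<open>lam n\<close>, and by continuity also at \<open>lam n\<close>, where its value is the
  weight number.\<close>

lemma c_r_pi_nonzero: "c (r n) pi \<noteq> 0"
proof
  assume "c (r n) pi = 0"
  then have z: "U n z = 0" if "z \<noteq> of_real (lam n)" for z
    using U_char[of z n] that by auto
  have "isCont (U n) (of_real (lam n))"
    using holomorphic_on_imp_continuous_on[OF U_holomorphic[of n UNIV]] by (simp add: continuous_on_eq_continuous_at)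
  then have "(U n \<longlongrightarrow> U n (of_real (lam n))) (at (of_real (lam n)))" by (simp add: isCont_def)
  moreover have "(U n \<longlongrightarrow> 0) (at (of_real (lam n)))"
    by (rule Lim_transform_eventually[OF tendsto_const]) (auto simp: eventually_at_filter z)
  ultimately have "U n (of_real (lam n)) = 0" using LIM_unique by blast
  then show False by (simp add: U_lam)
qed

definition \<Delta> :: "complex \<Rightarrow> complex" where
  "\<Delta> z = char_fun (csqrt z)"

lemma \<Delta>_eq: "\<Delta> z = - (z - of_real (lam n)) * U n z / c (r n) pi"
  using U_char[of z n] c_r_pi_nonzero[of n] by (simp add: \<Delta>_def field_simps)

text \<open>The factorisation at the lowest eigenvalue shows it, so \<open>dx (c \<rho>)\<close>
  never has to be differentiated with respect to rho.\<close>

lemma \<Delta>_holomorphic: "\<Delta> holomorphic_on S"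
proof -
  have "(\<lambda>z. - (z - of_real (lam 0)) * U 0 z / c (r 0) pi) holomorphic_on S"
    by (intro holomorphic_intros U_holomorphic c_r_pi_nonzero)
  then show ?thesis by (simp add: \<Delta>_eq[of _ 0, abs_def])
qed

lemma \<Delta>_zero_iff: "\<Delta> z = 0 \<longleftrightarrow> z \<in> range (\<lambda>n. of_real (lam n))"
proof
  assume "\<Delta> z = 0"
  then obtain n where "(csqrt z)\<^sup>2 = of_real (lam n)" unfolding \<Delta>_def by (rule char_fun_zeroD)
  then show "z \<in> range (\<lambda>n. of_real (lam n))" by simp
next
  assume "z \<in> range (\<lambda>n. of_real (lam n))"
  then obtain n where "z = of_real (lam n)" by blast
  then show "\<Delta> z = 0" using \<Delta>_eq[of z n] by simp
qed

text \<open>At \<open>lam n\<close> only the vanishing linear factor is differentiated, and its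
  cofactor \<open>U n\<close> takes the weight number as value. Thus nonzero weight numbers are what
  makes the zeros simple.\<close>

lemma deriv_\<Delta>: "deriv \<Delta> (of_real (lam n)) = - alpha c lam n / c (r n) pi"
proof -
  have "(U n has_field_derivative deriv (U n) (of_real (lam n))) (at (of_real (lam n)))"
    using U_holomorphic[of n UNIV] by (auto intro: holomorphic_derivI)
  then have "((\<lambda>z. - (z - of_real (lam n)) * U n z / c (r n) pi) has_field_derivative - alpha c lam n / c (r n) pi)
     (at (of_real (lam n)))"
    by (auto intro!: derivative_eq_intros simp: U_lam c_r_pi_nonzero)
  then show ?thesis unfolding \<Delta>_eq[of _ n, abs_def] by (rule DERIV_imp_deriv)
qed

lemma deriv_\<Delta>_nonzero: "deriv \<Delta> (of_real (lam n)) \<noteq> 0"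
  by (simp add: deriv_\<Delta> c_r_pi_nonzero)

text \<open>In Duhamel's formula for the derivative at pi only the term with the factor rho is
  large; in the integral the growth exponents pi - t and t add up to pi.\<close>

lemma char_fun_estimate:
  obtains A where "A > 0" "\<And>\<rho>. norm (char_fun \<rho> + \<rho> * sin (\<rho> * of_real pi)) \<le> A * exp (\<bar>Im \<rho>\<bar> * pi)"
proof -
  obtain C where C: "C > 0" "\<And>\<rho> x. x \<in> {0..pi} \<Longrightarrow> norm (c \<rho> x) \<le> C * exp (\<bar>Im \<rho>\<bar> * x)"
    using c_bounded by metis
  define Q where "Q = integral {0..pi} (\<lambda>t. norm (complex_of_real (p t)))"
  have pn: "(\<lambda>t. norm (complex_of_real (p t))) integrable_on {0..pi}"
    using p_int by (simp add: absolutely_integrable_on_def)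
  have "norm (char_fun \<rho> + \<rho> * sin (\<rho> * of_real pi)) \<le> (\<bar>h\<bar> + Q * C + \<bar>H\<bar> * C + 1) * exp (\<bar>Im \<rho>\<bar> * pi)" for \<rho>
  proof -
    let ?E = "exp (\<bar>Im \<rho>\<bar> * pi)"
    have cont: "continuous_on {0..pi} (\<lambda>t. cos (\<rho> * of_real (pi - t)) * c \<rho> t)"
      by (intro continuous_intros)
    have "norm (integral {0..pi} (\<lambda>t. of_real (p t) * (cos (\<rho> * of_real (pi - t)) * c \<rho> t)))
        \<le> integral {0..pi} (\<lambda>t. norm (complex_of_real (p t)) * (C * ?E))"
    proof (rule integral_norm_bound_integral)
      show "(\<lambda>t. of_real (p t) * (cos (\<rho> * of_real (pi - t)) * c \<rho> t)) integrable_on {0..pi}"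
        using p_mult_integrable[OF cont, of pi] by (simp add: absolutely_integrable_on_def)
      show "(\<lambda>t. norm (complex_of_real (p t)) * (C * ?E)) integrable_on {0..pi}"
        using pn by (rule integrable_on_mult_left)
      fix t assume t: "t \<in> {0..pi}"
      have "norm (cos (\<rho> * of_real (pi - t))) * norm (c \<rho> t) \<le> exp (\<bar>Im \<rho>\<bar> * (pi - t)) * (C * exp (\<bar>Im \<rho>\<bar> * t))"
        using t C by (intro mult_mono norm_cos_mult_le_exp) auto
      also have "\<dots> = C * ?E" by (simp add: exp_add[symmetric] algebra_simps)
      finally show "norm (of_real (p t) * (cos (\<rho> * of_real (pi - t)) * c \<rho> t)) \<le> norm (complex_of_real (p t)) * (C * ?E)"
        unfolding norm_mult by (intro mult_left_mono) auto
    qed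
    also have "\<dots> = Q * C * ?E" by (simp add: Q_def)
    finally have 1: "norm (integral {0..pi} (\<lambda>t. of_real (p t) * (cos (\<rho> * of_real (pi - t)) * c \<rho> t))) \<le> Q * C * ?E" .
    have 2: "norm (of_real h * cos (\<rho> * of_real pi)) \<le> \<bar>h\<bar> * ?E"
      unfolding norm_mult norm_of_real by (intro mult_left_mono norm_cos_mult_le_exp) auto
    have 3: "norm (of_real H * c \<rho> pi) \<le> \<bar>H\<bar> * (C * ?E)"
      unfolding norm_mult norm_of_real by (intro mult_left_mono C) auto
    have "char_fun \<rho> + \<rho> * sin (\<rho> * of_real pi) = of_real h * cos (\<rho> * of_real pi)
       + integral {0..pi} (\<lambda>t. of_real (p t) * (cos (\<rho> * of_real (pi - t)) * c \<rho> t)) + of_real H * c \<rho> pi"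
      unfolding char_fun_def by (subst Duhamel_derivative) auto
    also have "norm \<dots> \<le> \<bar>h\<bar> * ?E + Q * C * ?E + \<bar>H\<bar> * (C * ?E)"
      using 1 2 3 by (intro norm_triangle_mono)
    also have "\<dots> \<le> (\<bar>h\<bar> + Q * C + \<bar>H\<bar> * C + 1) * ?E" by (simp add: algebra_simps)
    finally show ?thesis .
  qed
  moreover have "\<bar>h\<bar> + Q * C + \<bar>H\<bar> * C + 1 > 0"
  proof -
    have "Q \<ge> 0" unfolding Q_def by (intro integral_nonneg pn) auto
    then show ?thesis using C(1) by (simp add: add_nonneg_pos)
  qed
  ultimately show thesis using that by blast
qed

end

section \<open>The unperturbed characteristic function\<close>

text \<open>Rouche's theorem counts zeros weighted by winding number and order. On a circle, with
  simple zeros, every weight is 1 inside and 0 outside, which leaves cardinalities.\<close>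

lemma Rouche_simple_zeros:
  assumes f: "f holomorphic_on UNIV" and g: "g holomorphic_on UNIV" and "R > 0"
    and less: "\<And>z. norm z = R \<Longrightarrow> norm (g z - f z) < norm (f z)"
    and f1: "\<And>z. f z = 0 \<Longrightarrow> zorder f z = 1" and g1: "\<And>z. g z = 0 \<Longrightarrow> zorder g z = 1"
  shows "card {z \<in> ball 0 R. g z = 0} = card {z \<in> ball 0 R. f z = 0}"
proof -
  \<comment> \<open>An open region around the closed disc; zeros in the surplus ring have winding
    number 0.\<close>
  define S where "S = ball (0::complex) (R + 1)"
  have fin: "finite {z \<in> S. k z = 0}" if k: "k holomorphic_on UNIV" and nz: "k (of_real R) \<noteq> 0" for k
  proof (cases "k constant_on UNIV")
    case True
    then have "{z \<in> S. k z = 0} = {}" using nz unfolding constant_on_def by auto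
    then show ?thesis by (simp only: finite.emptyI)
  next
    case False
    have "finite {z \<in> cball 0 (R + 1). k z = 0}"
      by (rule holomorphic_compact_finite_zeros[OF k]) (use False in auto)
    then show ?thesis by (rule finite_subset[rotated]) (auto simp: S_def)
  qed
  have "f (of_real R) \<noteq> 0" "g (of_real R) \<noteq> 0"
    using less[of "of_real R"] \<open>R > 0\<close> by auto
  note finf = fin[OF f this(1)] and fing = fin[OF g this(2)]
  have count: "(\<Sum>z\<in>{z \<in> S. k z = 0}. winding_number (circlepath 0 R) z * zorder k z) = of_nat (card {z \<in> ball 0 R. k z = 0})"
    if fk: "finite {z \<in> S. k z = 0}" and k1: "\<And>z. k z = 0 \<Longrightarrow> zorder k z = 1"
      and kR: "\<And>z. norm z = R \<Longrightarrow> k z \<noteq> 0" for k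
  proof -
    have "(\<Sum>z\<in>{z \<in> S. k z = 0}. winding_number (circlepath 0 R) z * zorder k z)
       = (\<Sum>z\<in>{z \<in> ball 0 R. k z = 0}. 1)"
    proof (rule sum.mono_neutral_cong_right[OF fk])
      show "{z \<in> ball 0 R. k z = 0} \<subseteq> {z \<in> S. k z = 0}" by (auto simp: S_def)
      show "\<forall>z\<in>{z \<in> S. k z = 0} - {z \<in> ball 0 R. k z = 0}. winding_number (circlepath 0 R) z * zorder k z = 0"
      proof
        fix z assume z: "z \<in> {z \<in> S. k z = 0} - {z \<in> ball 0 R. k z = 0}"
        then have "norm z \<noteq> R" using kR by auto
        then have "z \<notin> cball 0 R" using z by auto
        then have "winding_number (circlepath 0 R) z = 0"
          using \<open>R > 0\<close> by (intro winding_number_zero_outside[of _ "cball 0 R"]) auto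
        then show "winding_number (circlepath 0 R) z * zorder k z = 0" by simp
      qed
      show "winding_number (circlepath 0 R) z * zorder k z = 1" if "z \<in> {z \<in> ball 0 R. k z = 0}" for z
        using that k1[of z] by (simp add: winding_number_circlepath)
    qed
    then show ?thesis by simp
  qed
  have "(\<Sum>z\<in>{z \<in> S. g z = 0}. winding_number (circlepath 0 R) z * zorder g z)
      = (\<Sum>z\<in>{z \<in> S. f z = 0}. winding_number (circlepath 0 R) z * zorder f z)"
  proof (rule Rouche_theorem[of S f "\<lambda>z. g z - f z" "circlepath 0 R", unfolded add_diff_eq add_diff_cancel_left'])
    show "\<forall>z\<in>path_image (circlepath 0 R). norm (g z - f z) < norm (f z)"
      using less \<open>R > 0\<close> by auto
    show "path_image (circlepath 0 R) \<subseteq> S" using \<open>R > 0\<close> by (auto simp: S_def)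
    show "\<forall>z. z \<notin> S \<longrightarrow> winding_number (circlepath 0 R) z = 0"
      using \<open>R > 0\<close> by (auto intro!: winding_number_zero_outside[of _ S] simp: S_def)
    show "f holomorphic_on S" "(\<lambda>z. g z - f z) holomorphic_on S"
      by (auto intro!: holomorphic_on_diff holomorphic_on_subset[OF f] holomorphic_on_subset[OF g])
  qed (use finf fing in \<open>auto simp: S_def\<close>)
  note eq = this
  have nz: "f z \<noteq> 0" "g z \<noteq> 0" if "norm z = R" for z
    using less[OF that] by (auto simp: norm_minus_commute)
  have "(of_nat (card {z \<in> ball 0 R. g z = 0}) :: complex)
      = (\<Sum>z\<in>{z \<in> S. g z = 0}. winding_number (circlepath 0 R) z * zorder g z)"
    by (rule count[OF fing g1 nz(2), symmetric])
  also have "\<dots> = (\<Sum>z\<in>{z \<in> S. f z = 0}. winding_number (circlepath 0 R) z * zorder f z)"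
    by (rule eq)
  also have "\<dots> = of_nat (card {z \<in> ball 0 R. f z = 0})"
    by (rule count[OF finf f1 nz(1)])
  finally have "(of_nat (card {z \<in> ball 0 R. g z = 0}) :: complex) = of_nat (card {z \<in> ball 0 R. f z = 0})" .
  then show ?thesis by simp
qed

lemma csqrt_of_nat_square: "csqrt ((of_nat n)\<^sup>2) = of_nat n"
  by (rule csqrt_square) auto

text \<open>The radius N + 1/2 keeps rho away from the integers, the zeros of sin(pi rho). With rho
  = \<sigma> + i\<tau>, 4 |sin(pi rho)|^2 is the sum of exp(2 pi \<tau>) and its inverse minus 2
  cos(2 pi \<sigma>). For |\<tau>| >= 1 the exponentials dominate; otherwise |\<sigma>| lies between
  N + 1/4 and N + 1/2, where this cosine is not positive.\<close>

lemma sin_lower_bound: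
  fixes \<rho> :: complex
  assumes "N \<ge> 4" "norm \<rho> = real N + 1 / 2"
  shows "norm (sin (\<rho> * of_real pi)) \<ge> exp (\<bar>Im \<rho>\<bar> * pi) / 3"
proof -
  define \<sigma> \<tau> where "\<sigma> = Re \<rho>" and "\<tau> = Im \<rho>"
  define E where "E = exp (\<bar>\<tau>\<bar> * pi)"
  have sq: "E\<^sup>2 = exp (2 * (\<bar>\<tau>\<bar> * pi))" unfolding E_def by (simp add: power2_eq_square exp_add[symmetric])
  have sum: "exp (2 * (\<tau> * pi)) + inverse (exp (2 * (\<tau> * pi))) \<ge> E\<^sup>2"
    unfolding sq by (cases "\<tau> \<ge> 0") (auto simp: exp_minus[symmetric])
  have eq: "4 * (norm (sin (\<rho> * of_real pi)))\<^sup>2 = exp (2 * (\<tau> * pi)) + inverse (exp (2 * (\<tau> * pi))) - 2 * cos (2 * (\<sigma> * pi))"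
    unfolding norm_sin_squared by (simp add: \<sigma>_def \<tau>_def)
  have "4 * (norm (sin (\<rho> * of_real pi)))\<^sup>2 \<ge> E\<^sup>2 / 2"
  proof (cases "\<bar>\<tau>\<bar> \<ge> 1")
    case True
    have "4 \<le> 1 + 2 * (\<bar>\<tau>\<bar> * pi)"
    proof -
      have "1 * 3 \<le> \<bar>\<tau>\<bar> * pi" using True pi_gt3 by (intro mult_mono) auto
      then show ?thesis by simp
    qed
    also have "\<dots> \<le> E\<^sup>2" unfolding sq by (rule exp_ge_add_one_self)
    finally have "E\<^sup>2 \<ge> 4" .
    then show ?thesis using sum eq cos_le_one[of "2 * (\<sigma> * pi)"] by linarith
  next
    case False
    have n2: "\<sigma>\<^sup>2 + \<tau>\<^sup>2 = (real N + 1 / 2)\<^sup>2" using assms(2) by (metis \<sigma>_def \<tau>_def cmod_power2)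
    have "\<tau>\<^sup>2 \<le> 1" using False by (simp add: abs_square_le_1)
    have up: "\<bar>\<sigma>\<bar> \<le> real N + 1 / 2" 
    proof (rule power2_le_imp_le)
      show "\<bar>\<sigma>\<bar>\<^sup>2 \<le> (real N + 1 / 2)\<^sup>2" unfolding power2_abs using n2 zero_le_power2[of \<tau>] by linarith
    qed simp
    \<comment> \<open>For \<open>N \<ge> 4\<close> the difference of (N + 1/2)^2 and (N + 1/4)^2,
      which is N/2 + 3/16, exceeds the bound 1 for \<tau>^2.\<close>
    have lo: "\<bar>\<sigma>\<bar> \<ge> real N + 1 / 4"
    proof (rule ccontr)
      assume "\<not> \<bar>\<sigma>\<bar> \<ge> real N + 1 / 4"
      then have "\<bar>\<sigma>\<bar>\<^sup>2 \<le> (real N + 1 / 4)\<^sup>2" by (intro power_mono) auto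
      then have "(real N + 1 / 2)\<^sup>2 \<le> (real N + 1 / 4)\<^sup>2 + 1" using n2 \<open>\<tau>\<^sup>2 \<le> 1\<close> by simp
      then show False using assms(1) by (simp add: power2_eq_square algebra_simps)
    qed
    have "cos (2 * (\<sigma> * pi)) = cos (2 * (\<bar>\<sigma>\<bar> * pi))" by (cases "\<sigma> \<ge> 0") auto
    also have "\<dots> = cos (2 * pi * (\<bar>\<sigma>\<bar> - real N))"
    proof -
      have "2 * (\<bar>\<sigma>\<bar> * pi) = 2 * pi * (\<bar>\<sigma>\<bar> - real N) + 2 * real N * pi" by (simp add: algebra_simps)
      show ?thesis unfolding \<open>2 * (\<bar>\<sigma>\<bar> * pi) = _\<close> cos_add cos_2npi sin_2npi by simp
    qed
    also have "\<dots> = - cos (pi - 2 * pi * (\<bar>\<sigma>\<bar> - real N))" by simp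
    also have "\<dots> \<le> 0"
    proof -
      have "2 * pi * (\<bar>\<sigma>\<bar> - real N) \<ge> 2 * pi * (1 / 4)" "2 * pi * (\<bar>\<sigma>\<bar> - real N) \<le> 2 * pi * (1 / 2)"
        using up lo by (intro mult_left_mono; simp)+
      then have "0 \<le> cos (pi - 2 * pi * (\<bar>\<sigma>\<bar> - real N))" by (intro cos_ge_zero) linarith+
      then show ?thesis by (simp only: neg_le_0_iff_le)
    qed
    finally have "cos (2 * (\<sigma> * pi)) \<le> 0" .
    then show ?thesis using sum eq zero_le_power2[of E] by linarith
  qed
  then have "E\<^sup>2 / 9 \<le> (norm (sin (\<rho> * of_real pi)))\<^sup>2"
    using zero_le_power2[of "norm (sin (\<rho> * of_real pi))"] by linarith
  then have "(E / 3)\<^sup>2 \<le> (norm (sin (\<rho> * of_real pi)))\<^sup>2" by (simp add: power_divide)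
  then show ?thesis unfolding E_def \<tau>_def by (rule power2_le_imp_le) simp
qed

text \<open>The characteristic function for potential 0 and h = H = 0.\<close>

definition \<Delta>0 :: "complex \<Rightarrow> complex" where
  "\<Delta>0 z = - csqrt z * sin (csqrt z * of_real pi)"

text \<open>The counterpart of \<open>\<Delta>_eq\<close>, obtained by integrating the derivative of
  the Wronskian of cos(nt) and cos(rho t). With a cosine transform as explicit cofactor, analyticity
  and simplicity of the zeros follow as for \<open>\<Delta>\<close>.\<close>

lemma \<Delta>0_eq: "\<Delta>0 z = - ((-1) ^ n) * (z - (of_nat n)\<^sup>2) * cos_transform (\<lambda>t. cos (of_nat n * of_real t)) z"
proof -
  let ?\<rho> = "csqrt z"
  have d: "((\<lambda>t. ?\<rho> * sin (?\<rho> * of_real t) * cos (of_nat n * of_real t) - of_nat n * cos (?\<rho> * of_real t) * sin (of_nat n * of_real t))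
     has_vector_derivative (z - (of_nat n)\<^sup>2) * (cos (of_nat n * of_real t) * cos (?\<rho> * of_real t))) (at t within {0..pi})" for t
  proof (rule has_vector_derivative_at_within)
    have "((\<lambda>w. ?\<rho> * sin (?\<rho> * w) * cos (of_nat n * w) - of_nat n * cos (?\<rho> * w) * sin (of_nat n * w))
     has_field_derivative (?\<rho>\<^sup>2 - (of_nat n)\<^sup>2) * (cos (of_nat n * of_real t) * cos (?\<rho> * of_real t))) (at (of_real t))"
      by (auto intro!: derivative_eq_intros simp del: power2_csqrt) (simp add: power2_eq_square algebra_simps)
    from has_vector_derivative_real_field[OF this]
    show "((\<lambda>t. ?\<rho> * sin (?\<rho> * of_real t) * cos (of_nat n * of_real t) - of_nat n * cos (?\<rho> * of_real t) * sin (of_nat n * of_real t))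
     has_vector_derivative (z - (of_nat n)\<^sup>2) * (cos (of_nat n * of_real t) * cos (?\<rho> * of_real t))) (at t)" by simp
  qed
  have cn: "cos (of_nat n * complex_of_real pi) = (-1) ^ n" "sin (of_nat n * complex_of_real pi) = 0"
    using cos_npi[of n] sin_npi[of n] by (metis cos_of_real of_real_1 of_real_minus of_real_mult of_real_of_nat_eq of_real_power, simp)
  have "((\<lambda>t. (z - (of_nat n)\<^sup>2) * (cos (of_nat n * of_real t) * cos (?\<rho> * of_real t))) has_integral
     ?\<rho> * sin (?\<rho> * of_real pi) * (-1) ^ n) {0..pi}"
    using fundamental_theorem_of_calculus[OF _ d] by (simp add: cn)
  then have "(z - (of_nat n)\<^sup>2) * cos_transform (\<lambda>t. cos (of_nat n * of_real t)) z = - \<Delta>0 z * (-1) ^ n"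
    unfolding cos_transform_def \<Delta>0_def by (metis (no_types) integral_mult_right integral_unique minus_minus mult_minus_left)
  then have "- ((-1) ^ n) * ((z - (of_nat n)\<^sup>2) * cos_transform (\<lambda>t. cos (of_nat n * of_real t)) z) = \<Delta>0 z * ((-1) ^ n * (-1) ^ n)"
    by simp
  then show ?thesis by (simp add: mult.assoc flip: power_mult_distrib)
qed

lemma cos_transform_cos_nat_holomorphic: "cos_transform (\<lambda>t. cos (of_nat n * of_real t)) holomorphic_on S"
  by (intro holomorphic_on_cos_transform continuous_intros)

lemma \<Delta>0_holomorphic: "\<Delta>0 holomorphic_on S"
proof -
  have "(\<lambda>z. - ((-1) ^ 0) * (z - (of_nat 0)\<^sup>2) * cos_transform (\<lambda>t. cos (of_nat 0 * of_real t)) z) holomorphic_on S"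
    by (intro holomorphic_intros cos_transform_cos_nat_holomorphic)
  then show ?thesis by (simp add: \<Delta>0_eq[of _ 0, abs_def])
qed

lemma cos_transform_cos_nat: "cos_transform (\<lambda>t. cos (of_nat n * of_real t)) ((of_nat n)\<^sup>2) = alpha0 n"
proof -
  have cc: "cos (of_nat n * of_real x) = complex_of_real (cos (real n * x))" for x
    by (metis cos_of_real of_real_mult of_real_of_nat_eq)
  have "cos_transform (\<lambda>t. cos (of_nat n * of_real t)) ((of_nat n)\<^sup>2)
     = integral {0..pi} (\<lambda>t. complex_of_real (cos (real n * t) * cos (real n * t)))"
    unfolding cos_transform_def csqrt_of_nat_square cc by simp
  also have "\<dots> = of_real (integral {0..pi} (\<lambda>t. cos (real n * t) * cos (real n * t)))"
    using integral_linear[OF _ bounded_linear_of_real, of "\<lambda>t. cos (real n * t) * cos (real n * t)" "{0..pi}"]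
    by (simp add: o_def integrable_continuous_interval continuous_intros)
  finally show ?thesis by (simp add: cos_product_integral alpha0_def)
qed

lemma \<Delta>0_zero_iff: "\<Delta>0 z = 0 \<longleftrightarrow> z \<in> range (\<lambda>n. (of_nat n)\<^sup>2)"
proof
  assume "\<Delta>0 z = 0"
  then consider "csqrt z = 0" | "sin (csqrt z * of_real pi) = 0" by (auto simp: \<Delta>0_def)
  then show "z \<in> range (\<lambda>n. (of_nat n)\<^sup>2)"
  proof cases
    case 1 then show ?thesis by (auto intro!: image_eqI[of _ _ 0])
  next
    case 2
    then obtain k :: int where "csqrt z * of_real pi = of_real (k * pi)" by (auto simp: sin_eq_0)
    then have "csqrt z = of_int k" by simp
    then have "z = (of_int k)\<^sup>2" by (metis power2_csqrt)
    also have "\<dots> = (of_nat (nat \<bar>k\<bar>))\<^sup>2" by (cases "k \<ge> 0") (simp_all add: of_nat_nat)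
    finally show ?thesis by blast
  qed
next
  assume "z \<in> range (\<lambda>n. (of_nat n)\<^sup>2)"
  then obtain n where "z = (of_nat n)\<^sup>2" by blast
  then show "\<Delta>0 z = 0" using \<Delta>0_eq[of z n] by simp
qed

lemma zorder_\<Delta>0:
  assumes "\<Delta>0 z = 0"
  shows "zorder \<Delta>0 z = 1"
proof -
  obtain n where z: "z = (of_nat n)\<^sup>2" using assms \<Delta>0_zero_iff by auto
  show ?thesis
  proof (rule simple_zeroI)
    show "(\<lambda>z. - ((-1) ^ n) * cos_transform (\<lambda>t. cos (of_nat n * of_real t)) z) holomorphic_on UNIV"
      by (intro holomorphic_intros cos_transform_cos_nat_holomorphic)
    show "- ((-1) ^ n) * cos_transform (\<lambda>t. cos (of_nat n * of_real t)) z \<noteq> 0"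
      by (simp add: z cos_transform_cos_nat alpha0_def)
  qed (auto simp: \<Delta>0_eq[of _ n] z)
qed

section \<open>Location of the eigenvalues and completeness\<close>

context sturm_liouville
begin

lemma zorder_\<Delta>:
  assumes "\<Delta> z = 0"
  shows "zorder \<Delta> z = 1"
proof -
  obtain n where z: "z = of_real (lam n)" using assms \<Delta>_zero_iff by auto
  show ?thesis
  proof (rule simple_zeroI)
    show "(\<lambda>z. - (U n z / c (r n) pi)) holomorphic_on UNIV"
      by (intro holomorphic_intros U_holomorphic c_r_pi_nonzero)
    show "- (U n z / c (r n) pi) \<noteq> 0"
      by (simp add: z U_lam c_r_pi_nonzero)
  qed (auto simp: \<Delta>_eq[of _ n] z field_simps c_r_pi_nonzero)
qed

lemma \<Delta>_estimate:
  obtains A where "A > 0" "\<And>z. norm (\<Delta> z - \<Delta>0 z) \<le> A * exp (\<bar>Im (csqrt z)\<bar> * pi)"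
  using char_fun_estimate by (metis (no_types) \<Delta>_def \<Delta>0_def diff_minus_eq_add mult_minus_left)

lemma \<Delta>_circle_bounds:
  obtains N0 where "\<And>N z. N \<ge> N0 \<Longrightarrow> norm z = (real N + 1 / 2)\<^sup>2 \<Longrightarrow> norm (\<Delta> z - \<Delta>0 z) < norm (\<Delta>0 z)"
    and "\<And>N z. N \<ge> N0 \<Longrightarrow> norm z = (real N + 1 / 2)\<^sup>2 \<Longrightarrow> exp (\<bar>Im (csqrt z)\<bar> * pi) * (real N / 6) \<le> norm (\<Delta> z)"
proof -
  obtain A where A: "A > 0" "\<And>z. norm (\<Delta> z - \<Delta>0 z) \<le> A * exp (\<bar>Im (csqrt z)\<bar> * pi)"
    using \<Delta>_estimate by metis
  \<comment> \<open>From here on the error \<open>A * E\<close> is at most N/6 times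
    \<open>E\<close>, while \<open>\<Delta>0\<close> is more than N/3 times \<open>E\<close>; the
    margin N/6 that is left is the second bound.\<close>
  define N0 where "N0 = max 4 (nat \<lceil>6 * A\<rceil>)"
  have main: "norm (\<Delta> z - \<Delta>0 z) < norm (\<Delta>0 z) \<and> exp (\<bar>Im (csqrt z)\<bar> * pi) * (real N / 6) \<le> norm (\<Delta> z)"
    if N: "N \<ge> N0" and z: "norm z = (real N + 1 / 2)\<^sup>2" for N z
  proof -
    define E where "E = exp (\<bar>Im (csqrt z)\<bar> * pi)"
    have AN: "real N \<ge> 6 * A" "N \<ge> 4" using N unfolding N0_def by linarith+
    have nr: "norm (csqrt z) = real N + 1 / 2" by (simp add: norm_csqrt z)
    have "norm (\<Delta>0 z) = (real N + 1 / 2) * norm (sin (csqrt z * of_real pi))"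
      by (simp only: \<Delta>0_def norm_mult norm_minus_cancel nr)
    also have "\<dots> \<ge> (real N + 1 / 2) * (E / 3)"
      using sin_lower_bound[OF AN(2) nr] unfolding E_def by (intro mult_left_mono) auto
    finally have lo: "norm (\<Delta>0 z) \<ge> (real N + 1 / 2) * (E / 3)" .
    have up: "norm (\<Delta> z - \<Delta>0 z) \<le> real N / 6 * E"
      unfolding E_def by (rule order_trans[OF A(2)]) (use AN in \<open>auto intro!: mult_right_mono\<close>)
    have E: "E > 0" by (simp add: E_def)
    have e: "(real N + 1 / 2) * (E / 3) = real N / 6 * E + real N / 6 * E + E / 6"
      by (simp add: algebra_simps)
    have 1: "norm (\<Delta> z - \<Delta>0 z) < norm (\<Delta>0 z)"
    proof -
      have "real N / 6 * E \<ge> 0" using E by simp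
      then show ?thesis using lo up E e by linarith
    qed
    have "norm (\<Delta>0 z) \<le> norm (\<Delta> z) + norm (\<Delta> z - \<Delta>0 z)"
      by (metis norm_minus_commute norm_triangle_sub)
    then have 2: "E * (real N / 6) \<le> norm (\<Delta> z)"
      using lo up E e by (simp add: mult.commute)
    from 1 2 show ?thesis unfolding E_def by blast
  qed
  then show thesis using that by blast
qed

text \<open>In the variable z the circles have radius (N + 1/2)^2 and enclose the zeros 0, 1, 4,
  ..., N^2 of \<open>\<Delta>0\<close>; as the zeros of both functions are simple, Rouche's theorem
  compares cardinalities.\<close>

lemma card_eigenvalues:
  obtains N0 where "\<And>N. N \<ge> N0 \<Longrightarrow> card {n. \<bar>lam n\<bar> < (real N + 1 / 2)\<^sup>2} = Suc N"
proof -
  obtain N0 where N0: "\<And>N z. N \<ge> N0 \<Longrightarrow> norm z = (real N + 1 / 2)\<^sup>2 \<Longrightarrow> norm (\<Delta> z - \<Delta>0 z) < norm (\<Delta>0 z)"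
    using \<Delta>_circle_bounds by metis
  have "card {n. \<bar>lam n\<bar> < (real N + 1 / 2)\<^sup>2} = Suc N" if "N \<ge> N0" for N
  proof -
    let ?R = "(real N + 1 / 2)\<^sup>2"
    have "{z \<in> ball 0 ?R. \<Delta> z = 0} = (\<lambda>n. complex_of_real (lam n)) ` {n. \<bar>lam n\<bar> < ?R}"
      by (auto simp: \<Delta>_zero_iff)
    moreover have "inj (\<lambda>n. complex_of_real (lam n))"
      using lam_mono by (auto simp: inj_on_def dest: strict_mono_eq)
    ultimately have "card {n. \<bar>lam n\<bar> < ?R} = card {z \<in> ball 0 ?R. \<Delta> z = 0}"
      by (simp add: card_image inj_on_subset)
    also have "\<dots> = card {z \<in> ball 0 ?R. \<Delta>0 z = 0}"
      by (rule Rouche_simple_zeros[OF \<Delta>0_holomorphic \<Delta>_holomorphic _ N0[OF that] zorder_\<Delta>0 zorder_\<Delta>])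
         auto
    also have "{z \<in> ball 0 ?R. \<Delta>0 z = 0} = (\<lambda>n. (of_nat n)\<^sup>2) ` {..N}"
    proof -
      have "norm ((of_nat n :: complex)\<^sup>2) < ?R \<longleftrightarrow> n \<le> N" for n
      proof -
        have "norm ((of_nat n :: complex)\<^sup>2) < ?R \<longleftrightarrow> real n < real N + 1 / 2"
          unfolding norm_power norm_of_nat
          by (auto intro: power_strict_mono dest: power_less_imp_less_base)
        then show ?thesis by linarith
      qed
      then show ?thesis by (auto simp: \<Delta>0_zero_iff simp del: norm_power)
    qed
    also have "card ((\<lambda>n. (of_nat n :: complex)\<^sup>2) ` {..N}) = Suc N"
    proof -
      have "inj_on (\<lambda>n. (of_nat n :: complex)\<^sup>2) {..N}"
      proof (rule inj_onI)
        fix m n assume "(of_nat m :: complex)\<^sup>2 = (of_nat n)\<^sup>2"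
        then have "m\<^sup>2 = n\<^sup>2" by (metis of_nat_eq_iff of_nat_power)
        then show "m = n" by simp
      qed
      then show ?thesis by (simp add: card_image)
    qed
    finally show ?thesis .
  qed
  then show thesis using that by blast
qed

text \<open>For an increasing sequence the count means that \<open>lam n\<close> lies below (N +
  1/2)^2 exactly when \<open>n \<le> N\<close>; taking N = n and N = n - 1 encloses
  \<open>lam n\<close>.\<close>

lemma eigenvalue_location:
  obtains N0 where "N0 \<ge> 1" "\<And>n. n \<ge> N0 \<Longrightarrow> (real n - 1 / 2)\<^sup>2 \<le> lam n \<and> lam n < (real n + 1 / 2)\<^sup>2"
proof -
  obtain N0 where N0: "\<And>N. N \<ge> N0 \<Longrightarrow> card {n. \<bar>lam n\<bar> < (real N + 1 / 2)\<^sup>2} = Suc N"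
    using card_eigenvalues by metis
  define N1 where "N1 = max N0 (nat \<lceil>\<bar>lam 0\<bar>\<rceil> + 1)"
  have low: "- ((real N + 1 / 2)\<^sup>2) < lam n" if "N \<ge> N1" for N n
  proof -
    have "real N \<ge> \<bar>lam 0\<bar> + 1" using that unfolding N1_def by linarith
    then have "\<bar>lam 0\<bar> < 1 * (real N + 1 / 2)" "1 \<le> real N + 1 / 2" by simp_all
    then have "\<bar>lam 0\<bar> < (real N + 1 / 2)\<^sup>2"
      unfolding power2_eq_square by (meson less_le_trans mult_right_mono add_nonneg_nonneg of_nat_0_le_iff order_trans zero_le_one)
    moreover have "lam 0 \<le> lam n" using strict_mono_less_eq[OF lam_mono] by simp
    ultimately show ?thesis by linarith
  qed
  have char: "lam n < (real N + 1 / 2)\<^sup>2 \<longleftrightarrow> n \<le> N" if "N \<ge> N1" for N n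
  proof -
    let ?S = "{n. lam n < (real N + 1 / 2)\<^sup>2}"
    have "{n. \<bar>lam n\<bar> < (real N + 1 / 2)\<^sup>2} = ?S" using low[OF that] by (auto simp: abs_less_iff minus_less_iff)
    then have card: "card ?S = Suc N" using N0[of N] that by (simp add: N1_def)
    have down: "m \<in> ?S" if "n \<in> ?S" "m \<le> n" for m n
      using that strict_mono_less_eq[OF lam_mono, of m n] by simp
    have fin: "finite ?S" using card card.infinite by fastforce
    show ?thesis
    proof
      assume "lam n < (real N + 1 / 2)\<^sup>2"
      then have "{..n} \<subseteq> ?S" using down[of n] by auto
      then have "card {..n} \<le> card ?S" by (rule card_mono[OF fin])
      then show "n \<le> N" using card by simp
    next
      assume "n \<le> N"
      show "lam n < (real N + 1 / 2)\<^sup>2"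
      proof (rule ccontr)
        assume "\<not> lam n < (real N + 1 / 2)\<^sup>2"
        then have "?S \<subseteq> {..<n}" using down by (metis linorder_not_less lessThan_iff mem_Collect_eq subsetI)
        then have "card ?S \<le> n" using card_mono[of "{..<n}" ?S] by simp
        then show False using card \<open>n \<le> N\<close> by simp
      qed
    qed
  qed
  show thesis
  proof (rule that[of "Suc N1"])
    fix n assume "n \<ge> Suc N1"
    then obtain k where n: "n = Suc k" "k \<ge> N1" by (cases n) auto
    then have "\<not> lam n < (real k + 1 / 2)\<^sup>2" using char[of k n] by simp
    moreover have "lam n < (real n + 1 / 2)\<^sup>2" using char[of n n] n by simp
    moreover have "real k + 1 / 2 = real n - 1 / 2" using n by simp
    ultimately show "(real n - 1 / 2)\<^sup>2 \<le> lam n \<and> lam n < (real n + 1 / 2)\<^sup>2" by simp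
  qed simp
qed

lemma cos_transform_nat:
  "cos_transform v ((of_nat n)\<^sup>2) = integral {0..pi} (\<lambda>t. v t * cos (of_nat n * of_real t))"
  by (simp only: cos_transform_def csqrt_of_nat_square)

text \<open>The maximum principle on ever larger discs: a bound on this sequence of circles suffices
  to give |\<phi>(z)| <= C/N for every fixed z.\<close>

lemma entire_bounded_on_circles_eq_0:
  assumes hol: "\<phi> holomorphic_on UNIV"
    and bound: "\<And>N z. N \<ge> N0 \<Longrightarrow> norm z = (real N + 1 / 2)\<^sup>2 \<Longrightarrow> norm (\<phi> z) * real N \<le> C"
  shows "\<phi> z = 0"
proof (rule ccontr)
  assume nz: "\<phi> z \<noteq> 0"
  define N where "N = max (max 1 N0) (max (nat \<lceil>norm z\<rceil>) (nat \<lceil>C / norm (\<phi> z)\<rceil> + 1))"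
  have N: "N \<ge> 1" "N \<ge> N0" "real N \<ge> norm z" "real N > C / norm (\<phi> z)"
    unfolding N_def by linarith+
  let ?R = "(real N + 1 / 2)\<^sup>2"
  have zR: "norm z < ?R"
  proof -
    have "norm z < 1 * (real N + 1 / 2)" using N(3) by simp
    also have "\<dots> \<le> (real N + 1 / 2) * (real N + 1 / 2)" using N(1) by (intro mult_right_mono) auto
    finally show ?thesis by (simp add: power2_eq_square)
  qed
  have "norm (\<phi> z) \<le> C / real N"
  proof (rule maximum_modulus_frontier[of \<phi> "cball 0 ?R"])
    show "norm (\<phi> w) \<le> C / real N" if "w \<in> frontier (cball 0 ?R)" for w
    proof -
      have "?R > 0" using zR norm_ge_zero[of z] by linarith
      then have "norm w = ?R" using that by (simp add: frontier_cball)
      then show ?thesis using bound[OF N(2)] N(1) by (simp add: pos_le_divide_eq)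
    qed
    show "\<phi> holomorphic_on interior (cball 0 ?R)" by (rule holomorphic_on_subset[OF hol]) auto
    show "continuous_on (closure (cball 0 ?R)) \<phi>"
      by (rule holomorphic_on_imp_continuous_on[OF holomorphic_on_subset[OF hol]]) auto
  qed (use zR in auto)
  then show False using N(1,4) nz by (simp add: field_simps)
qed

text \<open>Numerator and characteristic function share the growth exp(|Im rho| pi), and the extra
  factor rho of the latter makes the quotient O(1/N) on the circles. Once the transform vanishes,
  all cosine coefficients of \<open>adjoint_volterra G u\<close> are 0, so by Parseval that function
  is orthogonal to every continuous one.\<close>

theorem eigenfunctions_complete:
  assumes u: "continuous_on {0..pi} u"
    and orth: "\<And>n. integral {0..pi} (\<lambda>x. u x * c (r n) x) = 0"
    and x: "x \<in> {0..pi}"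
  shows "u x = 0"
proof -
  define V where "V = cos_transform (adjoint_volterra G u)"
  have cv: "continuous_on {0..pi} (adjoint_volterra G u)"
    by (rule continuous_on_adjoint_volterra[OF G u])
  have V: "V (\<rho>\<^sup>2) = integral {0..pi} (\<lambda>x. u x * c \<rho> x)" for \<rho>
    unfolding V_def by (rule integral_mult_c[OF u, symmetric])
  have Vhol: "V holomorphic_on UNIV" unfolding V_def by (rule holomorphic_on_cos_transform[OF cv])
  obtain \<phi> where \<phi>: "\<phi> holomorphic_on UNIV" "\<And>z. V z = \<phi> z * \<Delta> z"
  proof (rule entire_quotient[OF Vhol \<Delta>_holomorphic])
    fix z assume "\<Delta> z = 0"
    then obtain n where z: "z = of_real (lam n)" using \<Delta>_zero_iff by auto
    then show "V z = 0 \<and> deriv \<Delta> z \<noteq> 0" using V[of "r n"] orth[of n] deriv_\<Delta>_nonzero by simp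
  next
    fix \<phi> assume "\<phi> holomorphic_on UNIV" "\<And>z. V z = \<phi> z * \<Delta> z"
    then show thesis by (rule that)
  qed
  obtain N0 where N0: "\<And>N z. N \<ge> N0 \<Longrightarrow> norm z = (real N + 1 / 2)\<^sup>2 \<Longrightarrow> exp (\<bar>Im (csqrt z)\<bar> * pi) * (real N / 6) \<le> norm (\<Delta> z)"
    using \<Delta>_circle_bounds by metis
  have "bounded (adjoint_volterra G u ` {0..pi})"
    using compact_continuous_image[OF cv] compact_imp_bounded by blast
  then obtain B where B: "B > 0" "\<And>t. t \<in> {0..pi} \<Longrightarrow> norm (adjoint_volterra G u t) \<le> B"
    unfolding bounded_pos by auto
  have Vb: "norm (V z) \<le> B * exp (\<bar>Im (csqrt z)\<bar> * pi) * (pi - 0)" for z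
    unfolding V_def cos_transform_def
  proof (rule integral_bound)
    show "continuous_on {0..pi} (\<lambda>t. adjoint_volterra G u t * cos (csqrt z * of_real t))"
      by (intro continuous_intros cv)
    fix t assume t: "t \<in> {0..pi}"
    have "norm (cos (csqrt z * of_real t)) \<le> exp (\<bar>Im (csqrt z)\<bar> * t)" using t by (intro norm_cos_mult_le_exp) auto
    also have "\<dots> \<le> exp (\<bar>Im (csqrt z)\<bar> * pi)" using t by (simp add: mult_left_mono)
    finally show "norm (adjoint_volterra G u t * cos (csqrt z * of_real t)) \<le> B * exp (\<bar>Im (csqrt z)\<bar> * pi)"
      unfolding norm_mult using B t by (intro mult_mono) auto
  qed simp
  have "\<phi> z = 0" for z
  proof (rule entire_bounded_on_circles_eq_0[OF \<phi>(1)])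
    fix N and z :: complex assume N: "N \<ge> N0" and z: "norm z = (real N + 1 / 2)\<^sup>2"
    define E where "E = exp (\<bar>Im (csqrt z)\<bar> * pi)"
    have "E > 0" by (simp add: E_def)
    have "norm (\<phi> z) * (E * (real N / 6)) \<le> norm (\<phi> z) * norm (\<Delta> z)"
      using N0[OF N z] unfolding E_def by (intro mult_left_mono) auto
    also have "\<dots> \<le> B * E * pi" using Vb[of z] \<phi>(2)[of z] unfolding E_def by (simp only: norm_mult diff_zero)
    finally have "E * (norm (\<phi> z) * real N) \<le> E * (6 * B * pi)" by (simp add: field_simps)
    then show "norm (\<phi> z) * real N \<le> 6 * B * pi" using \<open>E > 0\<close> by simp
  qed
  then have "V z = 0" for z using \<phi>(2) by simp
  then have coef0: "integral {0..pi} (\<lambda>t. adjoint_volterra G u t * cos (of_nat n * of_real t)) = 0" for n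
    unfolding cos_transform_nat[symmetric] V_def .
  have ort: "integral {0..pi} (\<lambda>t. adjoint_volterra G u t * v t) = 0" if "continuous_on {0..pi} v" for v
    using Parseval[OF cv that] unfolding coef0 by (simp add: LIMSEQ_const_iff)
  \<comment> \<open>The test function is the inverse transmutation of the conjugate of
    \<open>u\<close>: \<open>volterra G\<close> sends it back to that conjugate, and the
    orthogonality then says that |u|^2 has integral 0.\<close>
  have cb: "continuous_on {0..pi} (\<lambda>x. cnj (u x))" using u by (intro continuous_intros)
  have cK0: "continuous_kernel K" using inv by (simp add: inverse_kernel_def)
  have K: "volterra G (volterra K (\<lambda>x. cnj (u x))) x = cnj (u x)" if "x \<in> {0..pi}" for x
    using inv cb that unfolding inverse_kernel_def by auto
  have cK: "continuous_on {0..pi} (volterra K (\<lambda>x. cnj (u x)))"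
    by (rule continuous_on_volterra[OF cK0 cb])
  have "0 = integral {0..pi} (\<lambda>x. u x * volterra G (volterra K (\<lambda>x. cnj (u x))) x)"
    by (subst integral_mult_volterra[OF G u cK]) (rule ort[OF cK, symmetric])
  also have "\<dots> = integral {0..pi} (\<lambda>x. complex_of_real ((norm (u x))\<^sup>2))"
    by (rule integral_cong) (simp only: K complex_norm_square)
  also have "\<dots> = of_real (integral {0..pi} (\<lambda>x. (norm (u x))\<^sup>2))"
    using integral_linear[OF _ bounded_linear_of_real, of "\<lambda>x. (norm (u x))\<^sup>2" "{0..pi}"]
    by (simp add: o_def integrable_continuous_interval continuous_intros u)
  finally have "integral {0..pi} (\<lambda>x. (norm (u x))\<^sup>2) = 0" by simp
  moreover have "continuous_on {0..pi} (\<lambda>x. (norm (u x))\<^sup>2)" by (intro continuous_intros u)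
  ultimately have "\<forall>x\<in>{0..pi}. (norm (u x))\<^sup>2 = 0"
    using integral_eq_0_iff[of 0 pi "\<lambda>x. (norm (u x))\<^sup>2"] by auto
  then show ?thesis using x by simp
qed

end

section \<open>Asymptotics of the eigenvalues and of the weight numbers\<close>

lemma abs_cos_diff_le: "\<bar>cos x - cos y\<bar> \<le> \<bar>x - y\<bar>" for x y :: real
proof -
  have "\<bar>cos x - cos y\<bar> = 2 * (\<bar>sin ((x + y) / 2)\<bar> * \<bar>sin ((y - x) / 2)\<bar>)"
    by (simp add: cos_diff_cos abs_mult)
  also have "\<dots> \<le> 2 * (1 * \<bar>(y - x) / 2\<bar>)"
    by (intro mult_left_mono mult_mono abs_sin_le_one abs_sin_x_le_abs_x) auto
  finally show ?thesis by simp
qed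

lemma abs_sin_diff_le: "\<bar>sin x - sin y\<bar> \<le> \<bar>x - y\<bar>" for x y :: real
  using abs_cos_diff_le[of "pi / 2 - x" "pi / 2 - y"] by (simp add: cos_diff)

lemma abs_sin_minus_le: "\<bar>sin x - x\<bar> \<le> x\<^sup>2" for x :: real
proof -
  have "\<bar>sin x - x\<bar> \<le> \<bar>x\<bar>\<^sup>2 / 2"
    using Maclaurin_sin_bound[of x 2] by (simp add: numeral_2_eq_2 sin_coeff_def)
  also have "\<dots> \<le> x\<^sup>2" by simp
  finally show ?thesis .
qed

lemma abs_mult_diff_le:
  fixes a b a' b' :: real
  assumes "\<bar>a'\<bar> \<le> 1" "\<bar>b\<bar> \<le> 1" "\<bar>a - a'\<bar> \<le> d" "\<bar>b - b'\<bar> \<le> d"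
  shows "\<bar>a * b - a' * b'\<bar> \<le> 2 * d"
proof -
  have "a * b - a' * b' = (a - a') * b + a' * (b - b')" by (simp add: algebra_simps)
  also have "\<bar>\<dots>\<bar> \<le> \<bar>a - a'\<bar> * \<bar>b\<bar> + \<bar>a'\<bar> * \<bar>b - b'\<bar>"
    by (metis abs_mult abs_triangle_ineq)
  also have "\<dots> \<le> d * 1 + 1 * d" using assms by (intro add_mono mult_mono) auto
  finally show ?thesis by simp
qed

text \<open>Concavity of the sine: on [0, pi/2] the graph lies above its chord.\<close>

lemma abs_sin_pi_mult_ge:
  fixes e :: real
  assumes "\<bar>e\<bar> \<le> 1 / 2"
  shows "2 * \<bar>e\<bar> \<le> \<bar>sin (e * pi)\<bar>"
proof -
  have conc: "concave_on {0..pi} sin"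
    by (rule f''_le0_imp_concave[where f'="cos" and f''="\<lambda>x. - sin x"])
       (auto intro!: derivative_eq_intros sin_ge_zero)
  have "2 * d \<le> sin (d * pi)" if "0 \<le> d" "d \<le> 1 / 2" for d :: real
    using concave_onD[OF conc, of "2 * d" 0 "pi / 2"] that by simp
  from this[of "\<bar>e\<bar>"] show ?thesis using assms by (cases "e \<ge> 0") auto
qed

lemma sin_cos_shift_nat:
  fixes s :: real
  shows "sin (s * pi) = (-1) ^ n * sin ((s - real n) * pi)" "cos (s * pi) = (-1) ^ n * cos ((s - real n) * pi)"
proof -
  have "s * pi = (s - real n) * pi + real n * pi" by (simp add: algebra_simps)
  then show "sin (s * pi) = (-1) ^ n * sin ((s - real n) * pi)" "cos (s * pi) = (-1) ^ n * cos ((s - real n) * pi)"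
    unfolding \<open>s * pi = _\<close> sin_add cos_add by (simp_all del: distrib_right)
qed

context sturm_liouville
begin

definition Q :: real where "Q = integral {0..pi} (\<lambda>t. norm (complex_of_real (p t)))"

lemma p_norm_integrable: "(\<lambda>t. norm (complex_of_real (p t))) integrable_on {0..pi}"
  using p_int by (simp add: absolutely_integrable_on_def)

lemma Q_nonneg: "Q \<ge> 0"
  unfolding Q_def by (intro integral_nonneg p_norm_integrable) auto

lemma p_integral_bound:
  fixes u :: "real \<Rightarrow> complex"
  assumes u: "continuous_on {0..pi} u" and x: "x \<in> {0..pi}" and B: "\<And>t. t \<in> {0..x} \<Longrightarrow> norm (u t) \<le> B"
  shows "norm (integral {0..x} (\<lambda>t. of_real (p t) * u t)) \<le> Q * B"
proof -
  have i: "(\<lambda>t. norm (complex_of_real (p t))) integrable_on {0..x}"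
    using integrable_on_subinterval[OF p_norm_integrable, of 0 x] x by simp
  have "B \<ge> 0" using B[of 0] x norm_ge_zero[of "u 0"] by (smt (verit) atLeastAtMost_iff)
  have "norm (integral {0..x} (\<lambda>t. of_real (p t) * u t)) \<le> integral {0..x} (\<lambda>t. norm (complex_of_real (p t)) * B)"
  proof (rule integral_norm_bound_integral)
    show "(\<lambda>t. of_real (p t) * u t) integrable_on {0..x}"
      using p_mult_integrable[OF u x] by (simp add: absolutely_integrable_on_def)
    show "(\<lambda>t. norm (complex_of_real (p t)) * B) integrable_on {0..x}"
      using i by (rule integrable_on_mult_left)
    show "norm (of_real (p t) * u t) \<le> norm (complex_of_real (p t)) * B" if "t \<in> {0..x}" for t
      unfolding norm_mult using B[OF that] by (intro mult_left_mono) auto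
  qed
  also have "\<dots> = integral {0..x} (\<lambda>t. norm (complex_of_real (p t))) * B" by simp
  also have "\<dots> \<le> Q * B"
    unfolding Q_def using x i p_norm_integrable \<open>B \<ge> 0\<close>
    by (intro mult_right_mono integral_subset_le) auto
  finally show ?thesis .
qed

lemma p_integral_diff_bound:
  fixes u v :: "real \<Rightarrow> complex"
  assumes u: "continuous_on {0..pi} u" and v: "continuous_on {0..pi} v" and x: "x \<in> {0..pi}"
    and B: "\<And>t. t \<in> {0..x} \<Longrightarrow> norm (u t - v t) \<le> B"
  shows "norm (integral {0..x} (\<lambda>t. of_real (p t) * u t) - integral {0..x} (\<lambda>t. of_real (p t) * v t)) \<le> Q * B"
proof -
  have "integral {0..x} (\<lambda>t. of_real (p t) * u t) - integral {0..x} (\<lambda>t. of_real (p t) * v t)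
     = integral {0..x} (\<lambda>t. of_real (p t) * (u t - v t))"
    using p_mult_integrable[OF u x] p_mult_integrable[OF v x]
    by (subst integral_diff[symmetric]) (auto simp: absolutely_integrable_on_def algebra_simps)
  also have "norm \<dots> \<le> Q * B" by (rule p_integral_bound[OF _ x B]) (intro continuous_intros u v)
  finally show ?thesis .
qed

lemma p_real_integral:
  assumes "continuous_on {0..pi} u"
  shows "integral {0..pi} (\<lambda>t. of_real (p t) * complex_of_real (u t)) = of_real (integral {0..pi} (\<lambda>t. p t * u t))"
    and "(\<lambda>t. p t * u t) integrable_on {0..pi}"
proof -
  have "continuous_on {0..pi} (\<lambda>t. complex_of_real (u t))" by (intro continuous_intros assms)
  from p_mult_integrable[OF this, of pi]
  have i: "(\<lambda>t. complex_of_real (p t * u t)) integrable_on {0..pi}"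
    by (simp add: absolutely_integrable_on_def)
  from integrable_linear[OF this bounded_linear_Re] show j: "(\<lambda>t. p t * u t) integrable_on {0..pi}"
    by (simp add: o_def)
  from integral_linear[OF this bounded_linear_of_real[where 'a=complex]]
  show "integral {0..pi} (\<lambda>t. of_real (p t) * complex_of_real (u t)) = of_real (integral {0..pi} (\<lambda>t. p t * u t))"
    by (simp add: o_def)
qed

lemma p_abs_integrable: "p absolutely_integrable_on {0..pi}"
proof -
  have "(\<lambda>t. p t * 1) integrable_on {0..pi}" by (rule p_real_integral(2)) simp
  then show ?thesis using p_norm_integrable by (simp add: absolutely_integrable_on_def)
qed

text \<open>For real s the sine and c are bounded, so Duhamel's formula bounds s times the deviation
  of c from the cosine.\<close>

lemma c_asymptotics:
  obtains B where "B > 0" "\<And>s x. s > 0 \<Longrightarrow> x \<in> {0..pi} \<Longrightarrow> norm (c (of_real s) x) \<le> B"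
    and "\<And>s x. s > 0 \<Longrightarrow> x \<in> {0..pi} \<Longrightarrow> norm (c (of_real s) x - of_real (cos (s * x))) \<le> B / s"
proof -
  obtain C where C: "C > 0" "\<And>\<rho> x. x \<in> {0..pi} \<Longrightarrow> norm (c \<rho> x) \<le> C * exp (\<bar>Im \<rho>\<bar> * x)"
    using c_bounded by metis
  have C1: "norm (c (of_real s) x) \<le> C" if "x \<in> {0..pi}" for s x using C(2)[OF that, of "of_real s"] by simp
  define B where "B = C + (\<bar>h\<bar> + Q * C)"
  have B: "B > 0" "B \<ge> C" "B \<ge> \<bar>h\<bar> + Q * C" using C(1) Q_nonneg by (auto simp: B_def intro!: add_pos_nonneg)
  have 1: "norm (c (of_real s) x) \<le> B" if "x \<in> {0..pi}" for s x using C1[OF that, of s] B by simp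
  have 2: "norm (c (of_real s) x - of_real (cos (s * x))) \<le> B / s" if s: "s > 0" and x: "x \<in> {0..pi}" for s x
  proof -
    have "norm (integral {0..x} (\<lambda>t. of_real (p t) * (sin (of_real s * of_real (x - t)) * c (of_real s) t))) \<le> Q * C"
    proof (rule p_integral_bound[OF _ x])
      show "continuous_on {0..pi} (\<lambda>t. sin (of_real s * of_real (x - t)) * c (of_real s) t)"
        by (intro continuous_intros)
      fix t assume t: "t \<in> {0..x}"
      have "norm (sin (of_real s * complex_of_real (x - t))) \<le> 1"
        by (metis abs_sin_le_one norm_of_real of_real_mult sin_of_real)
      then have "norm (sin (of_real s * complex_of_real (x - t))) * norm (c (of_real s) t) \<le> 1 * C"
        using C1[of t s] t x by (intro mult_mono) auto
      then show "norm (sin (of_real s * of_real (x - t)) * c (of_real s) t) \<le> C" by (simp add: norm_mult)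
    qed
    moreover have "norm (of_real h * sin (of_real s * complex_of_real x)) \<le> \<bar>h\<bar>"
    proof -
      have "sin (of_real s * complex_of_real x) = of_real (sin (s * x))" by (metis sin_of_real of_real_mult)
      then show ?thesis by (simp add: norm_mult mult_left_le)
    qed
    moreover have eq: "of_real s * (c (of_real s) x - of_real (cos (s * x)))
        = of_real h * sin (of_real s * of_real x)
           + integral {0..x} (\<lambda>t. of_real (p t) * (sin (of_real s * of_real (x - t)) * c (of_real s) t))"
      using Duhamel[OF x, of "of_real s"] by (simp add: cos_of_real[symmetric] right_diff_distrib)
    ultimately have "norm (of_real s * (c (of_real s) x - of_real (cos (s * x)))) \<le> \<bar>h\<bar> + Q * C"
      unfolding eq by (intro norm_triangle_mono)
    then have "s * norm (c (of_real s) x - of_real (cos (s * x))) \<le> B"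
      using s B by (simp add: norm_mult)
    then show ?thesis using s by (simp add: field_simps)
  qed
  from that[OF B(1)] 1 2 show thesis by blast
qed

text \<open>Real counterpart of \<open>r n\<close>. The two differ when \<open>lam n\<close> is
  negative; \<open>s_location\<close> makes them agree from some index on.\<close>

definition s :: "nat \<Rightarrow> real" where "s n = sqrt (lam n)"

lemma s_location:
  obtains N0 where "N0 \<ge> 1" "\<And>n. n \<ge> N0 \<Longrightarrow> r n = of_real (s n) \<and> s n \<ge> real n / 2 \<and> \<bar>s n - real n\<bar> \<le> 1 / 2"
proof -
  obtain N0 where N0: "N0 \<ge> 1" "\<And>n. n \<ge> N0 \<Longrightarrow> (real n - 1 / 2)\<^sup>2 \<le> lam n \<and> lam n < (real n + 1 / 2)\<^sup>2"
    using eigenvalue_location by metis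
  have "r n = of_real (s n) \<and> s n \<ge> real n / 2 \<and> \<bar>s n - real n\<bar> \<le> 1 / 2" if n: "n \<ge> N0" for n
  proof -
    have l: "(real n - 1 / 2)\<^sup>2 \<le> lam n" "lam n < (real n + 1 / 2)\<^sup>2" using N0(2)[OF n] by auto
    have "lam n \<ge> 0" using l(1) zero_le_power2[of "real n - 1 / 2"] by linarith
    then have "r n = of_real (s n)" by (simp add: rho_def s_def)
    moreover have "real n \<ge> 1" using n N0(1) by simp
    moreover have "real n - 1 / 2 \<le> s n" unfolding s_def by (rule real_le_rsqrt[OF l(1)])
    moreover have "s n \<le> real n + 1 / 2" unfolding s_def by (rule real_le_lsqrt) (use l in auto)
    ultimately have "s n \<ge> real n / 2" "\<bar>s n - real n\<bar> \<le> 1 / 2" by linarith+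
    with \<open>r n = _\<close> show ?thesis by blast
  qed
  with N0(1) show thesis using that by blast
qed

lemma cos_r_mult: "r n = of_real (s n) \<Longrightarrow> cos (r n * of_real x) = of_real (cos (s n * x))"
  by (metis cos_of_real of_real_mult)

text \<open>This is the equation \<open>char_fun (r n) = 0\<close> in Duhamel form, with c replaced
  by the cosine at the cost of O(1/n).\<close>

lemma characteristic_equation_asymptotics:
  obtains B N0 where "N0 \<ge> 1" "B > 0" "\<And>n. n \<ge> N0 \<Longrightarrow> r n = of_real (s n) \<and> s n \<ge> real n / 2 \<and> \<bar>s n - real n\<bar> \<le> 1 / 2"
    and "\<And>n. n \<ge> N0 \<Longrightarrow> \<bar>s n * sin (s n * pi) - (h + H) * cos (s n * pi)
            - integral {0..pi} (\<lambda>t. p t * (cos (s n * (pi - t)) * cos (s n * t)))\<bar> \<le> B / real n"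
proof -
  obtain N0 where N0: "N0 \<ge> 1" "\<And>n. n \<ge> N0 \<Longrightarrow> r n = of_real (s n) \<and> s n \<ge> real n / 2 \<and> \<bar>s n - real n\<bar> \<le> 1 / 2"
    using s_location by metis
  obtain B where B: "B > 0" "\<And>s x. s > 0 \<Longrightarrow> x \<in> {0..pi} \<Longrightarrow> norm (c (of_real s) x - of_real (cos (s * x))) \<le> B / s"
    using c_asymptotics by metis
  define B' where "B' = 2 * ((Q + \<bar>H\<bar>) * B) + 1"
  have "B' > 0" using B Q_nonneg by (auto simp: B'_def intro!: add_nonneg_pos)
  have "\<bar>s n * sin (s n * pi) - (h + H) * cos (s n * pi)
            - integral {0..pi} (\<lambda>t. p t * (cos (s n * (pi - t)) * cos (s n * t)))\<bar> \<le> B' / real n" if n: "n \<ge> N0" for n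
  proof -
    let ?s = "s n" and ?c = "c (of_real (s n))"
    have rn: "r n = of_real ?s" and sn: "?s \<ge> real n / 2" "real n \<ge> 1" using N0(2)[OF n] n N0(1) by auto
    have sp: "?s > 0" using sn by simp
    have cc: "cos (of_real ?s * complex_of_real y) = of_real (cos (?s * y))"
      "sin (of_real ?s * complex_of_real y) = of_real (sin (?s * y))" for y
      by (metis cos_of_real of_real_mult) (metis sin_of_real of_real_mult)
    define J where "J = integral {0..pi} (\<lambda>t. p t * (cos (?s * (pi - t)) * cos (?s * t)))"
    define I where "I = integral {0..pi} (\<lambda>t. of_real (p t) * (of_real (cos (?s * (pi - t))) * ?c t))"
    have J: "complex_of_real J = integral {0..pi} (\<lambda>t. of_real (p t) * (of_real (cos (?s * (pi - t)) * cos (?s * t))))"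
      unfolding J_def by (rule p_real_integral(1)[symmetric]) (intro continuous_intros)
    have "pi \<in> {0..pi}" by simp
    have "char_fun (of_real ?s) = 0" using char_fun_r[of n] rn by simp
    then have zero: "- of_real ?s * of_real (sin (?s * pi)) + of_real h * of_real (cos (?s * pi)) + I + of_real H * ?c pi = 0"
      unfolding char_fun_def Duhamel_derivative[OF \<open>pi \<in> {0..pi}\<close>] cc I_def .
    have "of_real ?s * of_real (sin (?s * pi)) = of_real ?s * of_real (sin (?s * pi))
      + (- of_real ?s * of_real (sin (?s * pi)) + of_real h * of_real (cos (?s * pi)) + I + of_real H * ?c pi)"
      unfolding zero by simp
    also have "\<dots> = of_real h * of_real (cos (?s * pi)) + I + of_real H * ?c pi" by (simp add: algebra_simps)
    finally have "of_real ?s * of_real (sin (?s * pi)) = of_real h * of_real (cos (?s * pi)) + I + of_real H * ?c pi" .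
    then have eq: "complex_of_real (?s * sin (?s * pi) - (h + H) * cos (?s * pi) - J)
       = (I - of_real J) + of_real H * (?c pi - of_real (cos (?s * pi)))"
      by (simp add: algebra_simps)
    have "norm (I - of_real J) \<le> Q * (B / ?s)"
      unfolding I_def J
    proof (rule p_integral_diff_bound)
      fix t assume t: "t \<in> {0..pi}"
      have "of_real (cos (?s * (pi - t))) * ?c t - of_real (cos (?s * (pi - t)) * cos (?s * t))
          = of_real (cos (?s * (pi - t))) * (?c t - of_real (cos (?s * t)))" by (simp add: algebra_simps)
      also have "norm \<dots> \<le> 1 * (B / ?s)"
        unfolding norm_mult using B(2)[OF sp t] by (intro mult_mono) auto
      finally show "norm (of_real (cos (?s * (pi - t))) * ?c t - of_real (cos (?s * (pi - t)) * cos (?s * t))) \<le> B / ?s"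
        by simp
    qed (auto intro!: continuous_intros)
    moreover have "norm (of_real H * (?c pi - of_real (cos (?s * pi)))) \<le> \<bar>H\<bar> * (B / ?s)"
      unfolding norm_mult norm_of_real using B(2)[OF sp, of pi] by (intro mult_left_mono) auto
    ultimately have "norm (complex_of_real (?s * sin (?s * pi) - (h + H) * cos (?s * pi) - J)) \<le> Q * (B / ?s) + \<bar>H\<bar> * (B / ?s)"
      unfolding eq by (rule norm_triangle_mono)
    then have "\<bar>?s * sin (?s * pi) - (h + H) * cos (?s * pi) - J\<bar> \<le> (Q + \<bar>H\<bar>) * B / ?s"
      unfolding norm_of_real by (simp add: algebra_simps add_divide_distrib)
    also have "\<dots> \<le> (Q + \<bar>H\<bar>) * B / (real n / 2)"
      using sn B(1) Q_nonneg by (intro divide_left_mono mult_nonneg_nonneg mult_pos_pos) auto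
    also have "\<dots> \<le> B' / real n" using sn by (simp add: B'_def divide_right_mono)
    finally show ?thesis by (simp add: J_def)
  qed
  then show thesis using that[OF N0(1) \<open>B' > 0\<close> N0(2)] by blast
qed

text \<open>In the characteristic equation everything except s sin(s pi) is bounded. With s >= n/2
  and |sin(e pi)| >= 2|e| for e = s - n, this bounds n |e|.\<close>

lemma s_minus_nat_bound:
  obtains C N0 where "N0 \<ge> 1" "C > 0"
    "\<And>n. n \<ge> N0 \<Longrightarrow> r n = of_real (s n) \<and> s n \<ge> real n / 2 \<and> \<bar>s n - real n\<bar> \<le> 1 / 2 \<and> \<bar>s n - real n\<bar> \<le> C / real n"
    and "\<And>n. n \<ge> N0 \<Longrightarrow> \<bar>s n * sin (s n * pi) - (h + H) * cos (s n * pi)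
            - integral {0..pi} (\<lambda>t. p t * (cos (s n * (pi - t)) * cos (s n * t)))\<bar> \<le> C / real n"
proof -
  obtain B N0 where N0: "N0 \<ge> 1" "B > 0" "\<And>n. n \<ge> N0 \<Longrightarrow> r n = of_real (s n) \<and> s n \<ge> real n / 2 \<and> \<bar>s n - real n\<bar> \<le> 1 / 2"
    and as: "\<And>n. n \<ge> N0 \<Longrightarrow> \<bar>s n * sin (s n * pi) - (h + H) * cos (s n * pi)
            - integral {0..pi} (\<lambda>t. p t * (cos (s n * (pi - t)) * cos (s n * t)))\<bar> \<le> B / real n"
    by (rule characteristic_equation_asymptotics) (rule that; assumption)
  define C where "C = B + \<bar>h + H\<bar> + Q"
  have C: "C > 0" "B \<le> C" using N0(2) Q_nonneg by (auto simp: C_def)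
  have "\<bar>s n - real n\<bar> \<le> C / real n" if n: "n \<ge> N0" for n
  proof -
    have n1: "real n \<ge> 1" and sn: "s n \<ge> real n / 2" and e: "\<bar>s n - real n\<bar> \<le> 1 / 2" using N0(3)[OF n] n N0(1) by auto
    let ?J = "integral {0..pi} (\<lambda>t. p t * (cos (s n * (pi - t)) * cos (s n * t)))"
    have "norm (complex_of_real ?J) \<le> Q * 1"
    proof (subst p_real_integral(1)[symmetric])
      show "norm (integral {0..pi} (\<lambda>t. of_real (p t) * complex_of_real (cos (s n * (pi - t)) * cos (s n * t)))) \<le> Q * 1"
        by (rule p_integral_bound)
           (auto intro!: continuous_intros simp: norm_mult abs_mult intro: mult_le_one)
    qed (intro continuous_intros)
    then have J: "\<bar>?J\<bar> \<le> Q" by simp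
    have "\<bar>(h + H) * cos (s n * pi)\<bar> \<le> \<bar>h + H\<bar>" by (simp add: abs_mult mult_left_le)
    moreover have "B / real n \<le> B" using n1 N0(2) by (simp add: field_simps)
    ultimately have "\<bar>s n * sin (s n * pi)\<bar> \<le> C" using as[OF n] J unfolding C_def by linarith
    then have "s n * \<bar>sin (s n * pi)\<bar> \<le> C" using sn by (simp add: abs_mult)
    moreover have "\<bar>sin (s n * pi)\<bar> = \<bar>sin ((s n - real n) * pi)\<bar>"
      unfolding sin_cos_shift_nat(1)[of "s n" n] by (simp add: abs_mult)
    moreover have "real n / 2 * (2 * \<bar>s n - real n\<bar>) \<le> s n * \<bar>sin ((s n - real n) * pi)\<bar>"
      using sn n1 abs_sin_pi_mult_ge[OF e] by (intro mult_mono) auto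
    ultimately show ?thesis using n1 by (simp add: field_simps)
  qed
  moreover have "\<bar>s n * sin (s n * pi) - (h + H) * cos (s n * pi)
            - integral {0..pi} (\<lambda>t. p t * (cos (s n * (pi - t)) * cos (s n * t)))\<bar> \<le> C / real n" if "n \<ge> N0" for n
    by (rule order_trans[OF as[OF that]]) (use C(2) in \<open>simp add: divide_right_mono\<close>)
  ultimately show thesis using that[OF N0(1) C(1)] N0(3) by blast
qed

text \<open>Both factors are square summable, and a product is at most the sum of the
  squares.\<close>

lemma summable_coeff_over_n:
  fixes b :: "nat \<Rightarrow> real"
  assumes "summable (\<lambda>n. (b n)\<^sup>2)"
  shows "summable (\<lambda>n. \<bar>b n\<bar> / real n)"
proof (rule summable_comparison_test')
  show "summable (\<lambda>n. (b n)\<^sup>2 + (1 / real n)\<^sup>2)"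
    using summable_add[OF assms inverse_power_summable[of 2, where 'a=real]] by (simp add: power_one_over inverse_eq_divide power_divide)
  show "norm (\<bar>b n\<bar> / real n) \<le> (b n)\<^sup>2 + (1 / real n)\<^sup>2" for n
  proof -
    have "0 \<le> (\<bar>b n\<bar> - 1 / real n)\<^sup>2" by simp
    then have "2 * (\<bar>b n\<bar> * (1 / real n)) \<le> (b n)\<^sup>2 + (1 / real n)\<^sup>2"
      by (simp add: power2_diff)
    moreover have "\<bar>b n\<bar> * (1 / real n) \<ge> 0" by simp
    moreover have "norm (\<bar>b n\<bar> / real n) = \<bar>b n\<bar> * (1 / real n)" by simp
    ultimately show ?thesis by linarith
  qed
qed

lemma summable_const_over_n2: "summable (\<lambda>n. C / (real n)\<^sup>2)"
  using summable_mult[OF inverse_power_summable[of 2, where 'a=real], of C] by (simp add: divide_inverse power_inverse)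

text \<open>The doubled frequency comes from cos^2(nt), the integrand of the unperturbed
  characteristic equation.\<close>

lemma p_cos_summable: "summable (\<lambda>n. (integral {0..pi} (\<lambda>t. p t * cos (real (2 * n) * t)))\<^sup>2)"
proof -
  have "summable (\<lambda>n. (integral {0..pi} (\<lambda>t. p t * cos (real n * t)))\<^sup>2)"
    by (rule summable_cos_coeff_square[OF p_abs_integrable p_sq])
  from summable_reindex[OF this, of "\<lambda>n. 2 * n"] show ?thesis
    by (simp add: inj_on_def o_def)
qed

text \<open>One step of iteration. With e = s - n, replacing s by n inside the integral costs
  O(1/n), so that n e pi = \<omega> + b_n/2 + O(1/n), where b_n is a cosine coefficient of the
  potential. Dividing by n leaves the summable error b_n/n, and \<kappa> is \<omega>/pi.\<close>

lemma s_asymptotics: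
  obtains \<kappa> where "summable (\<lambda>n. \<bar>s n - real n - \<kappa> / real n\<bar>)"
proof -
  obtain C N0 where N0: "N0 \<ge> 1" "C > 0"
    "\<And>n. n \<ge> N0 \<Longrightarrow> r n = of_real (s n) \<and> s n \<ge> real n / 2 \<and> \<bar>s n - real n\<bar> \<le> 1 / 2 \<and> \<bar>s n - real n\<bar> \<le> C / real n"
    and as: "\<And>n. n \<ge> N0 \<Longrightarrow> \<bar>s n * sin (s n * pi) - (h + H) * cos (s n * pi)
            - integral {0..pi} (\<lambda>t. p t * (cos (s n * (pi - t)) * cos (s n * t)))\<bar> \<le> C / real n"
    by (rule s_minus_nat_bound) (rule that; assumption)
  define b where "b n = integral {0..pi} (\<lambda>t. p t * cos (real (2 * n) * t))" for n
  define P where "P = integral {0..pi} p"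
  define \<omega> where "\<omega> = h + H + P / 2"
  \<comment> \<open>The summands are the constants of the error bounds 2, 3, 1 and 4 below, in this
    order.\<close>
  define C' where "C' = C + \<bar>h + H\<bar> * (pi * C) + Q * (2 * (pi * C)) + pi * C\<^sup>2 + pi\<^sup>2 * C\<^sup>2"
  have "\<bar>s n - real n - (\<omega> / pi) / real n\<bar> \<le> \<bar>b n\<bar> / real n + C' / (real n)\<^sup>2" if n: "n \<ge> N0" for n
  proof -
    define e where "e = s n - real n"
    have n1: "real n \<ge> 1" and sn: "s n \<ge> real n / 2" and e: "\<bar>e\<bar> \<le> 1 / 2" "\<bar>e\<bar> \<le> C / real n"
      using N0(3)[OF n] n N0(1) by (auto simp: e_def)
    \<comment> \<open>The sign produced by shifting the arguments of sine and cosine by n pi; it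
      appears in every main term and is removed by multiplying through.\<close>
    define S where "S = (-1 :: real) ^ n"
    have S: "S * S = 1" "\<bar>S\<bar> = 1" unfolding S_def by (simp_all flip: power_mult_distrib)
    define J where "J = integral {0..pi} (\<lambda>t. p t * (cos (s n * (pi - t)) * cos (s n * t)))"
    have ne: "real n * e\<^sup>2 \<le> C\<^sup>2 / real n"
    proof -
      have "e\<^sup>2 \<le> (C / real n)\<^sup>2" using e(2) by (metis abs_ge_zero power2_abs power_mono)
      then have "real n * e\<^sup>2 \<le> real n * (C / real n)\<^sup>2" by (intro mult_left_mono) auto
      then show ?thesis using n1 by (simp add: power2_eq_square)
    qed
    have e2: "e\<^sup>2 \<le> C\<^sup>2 / real n"
      using ne n1 mult_right_mono[OF n1, of "e\<^sup>2"] by simp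
    have "\<bar>J - S * (P / 2 + b n / 2)\<bar> \<le> Q * (2 * (pi * \<bar>e\<bar>))"
    proof -
      have "integral {0..pi} (\<lambda>t. p t * (S * (cos (real n * t) * cos (real n * t)))) = S * (P / 2 + b n / 2)"
      proof -
        have "(\<lambda>t. p t * (S * (cos (real n * t) * cos (real n * t)))) = (\<lambda>t. (S / 2) * (p t * 1) + (S / 2) * (p t * cos (real (2 * n) * t)))"
          by (auto simp: cos_times_cos algebra_simps)
        moreover have "integral {0..pi} (\<lambda>t. (S / 2) * (p t * 1) + (S / 2) * (p t * cos (real (2 * n) * t)))
           = (S / 2) * integral {0..pi} (\<lambda>t. p t * 1) + (S / 2) * integral {0..pi} (\<lambda>t. p t * cos (real (2 * n) * t))"
          by (subst integral_add) (auto intro!: integrable_on_mult_right p_real_integral(2) continuous_intros simp del: mult_1_right)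
        ultimately show ?thesis by (simp add: P_def b_def algebra_simps)
      qed
      then have "complex_of_real (J - S * (P / 2 + b n / 2))
         = integral {0..pi} (\<lambda>t. of_real (p t) * of_real (cos (s n * (pi - t)) * cos (s n * t)))
         - integral {0..pi} (\<lambda>t. of_real (p t) * of_real (S * (cos (real n * t) * cos (real n * t))))"
        unfolding J_def by (subst (1 2) p_real_integral(1)) (auto intro!: continuous_intros)
      also have "norm \<dots> \<le> Q * (2 * (pi * \<bar>e\<bar>))"
      proof (rule p_integral_diff_bound)
        fix t assume t: "t \<in> {0..pi}"
        have "cos (real n * (pi - t)) = S * cos (real n * t)"
          unfolding right_diff_distrib cos_diff by (simp add: S_def)
        then have eq: "S * (cos (real n * t) * cos (real n * t)) = cos (real n * (pi - t)) * cos (real n * t)" by simp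
        have d: "\<bar>cos (s n * y) - cos (real n * y)\<bar> \<le> pi * \<bar>e\<bar>" if "\<bar>y\<bar> \<le> pi" for y
        proof -
          have "\<bar>cos (s n * y) - cos (real n * y)\<bar> \<le> \<bar>s n * y - real n * y\<bar>" by (rule abs_cos_diff_le)
          also have "\<dots> = \<bar>y\<bar> * \<bar>e\<bar>" by (simp add: e_def abs_mult flip: left_diff_distrib)
          also have "\<dots> \<le> pi * \<bar>e\<bar>" using that by (intro mult_right_mono) auto
          finally show ?thesis .
        qed
        have "\<bar>cos (s n * (pi - t)) * cos (s n * t) - cos (real n * (pi - t)) * cos (real n * t)\<bar> \<le> 2 * (pi * \<bar>e\<bar>)"
          by (rule abs_mult_diff_le) (use t in \<open>auto intro!: d\<close>)
        then show "norm (complex_of_real (cos (s n * (pi - t)) * cos (s n * t)) - of_real (S * (cos (real n * t) * cos (real n * t)))) \<le> 2 * (pi * \<bar>e\<bar>)"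
          unfolding eq of_real_diff[symmetric] norm_of_real .
      qed (auto intro!: continuous_intros)
      finally show ?thesis by (simp only: norm_of_real)
    qed
    also have "\<dots> \<le> Q * (2 * (pi * C)) / real n"
    proof -
      have "2 * (pi * \<bar>e\<bar>) \<le> 2 * (pi * (C / real n))" using e(2) by (intro mult_left_mono) auto
      from mult_left_mono[OF this Q_nonneg] show ?thesis by simp
    qed
    finally have 1: "\<bar>S * J - (P / 2 + b n / 2)\<bar> \<le> Q * (2 * (pi * C)) / real n"
    proof -
      assume a: "\<bar>J - S * (P / 2 + b n / 2)\<bar> \<le> Q * (2 * (pi * C)) / real n"
      have "S * J - (P / 2 + b n / 2) = S * (J - S * (P / 2 + b n / 2))"
        by (simp add: right_diff_distrib mult.assoc[symmetric] S)
      then show ?thesis using a by (simp add: abs_mult S)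
    qed
    have "\<bar>S * (s n * sin (s n * pi) - (h + H) * cos (s n * pi) - J)\<bar> \<le> C / real n"
      unfolding abs_mult S using as[OF n] by (simp add: J_def)
    moreover have "S * (s n * sin (s n * pi) - (h + H) * cos (s n * pi) - J)
        = s n * sin (e * pi) - (h + H) * cos (e * pi) - S * J"
      unfolding sin_cos_shift_nat[of "s n" n] e_def[symmetric] S_def[symmetric]
      using S by (simp add: algebra_simps) (simp add: mult.assoc[symmetric])
    ultimately have 2: "\<bar>s n * sin (e * pi) - (h + H) * cos (e * pi) - S * J\<bar> \<le> C / real n" by simp
    have 3: "\<bar>(h + H) * cos (e * pi) - (h + H)\<bar> \<le> \<bar>h + H\<bar> * (pi * C) / real n"
    proof -
      have "\<bar>cos (e * pi) - 1\<bar> \<le> \<bar>e * pi\<bar>" using abs_cos_diff_le[of "e * pi" 0] by simp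
      also have "\<dots> \<le> pi * (C / real n)" using mult_left_mono[OF e(2), of pi] by (simp add: abs_mult mult.commute)
      finally have "\<bar>h + H\<bar> * \<bar>cos (e * pi) - 1\<bar> \<le> \<bar>h + H\<bar> * (pi * (C / real n))" by (intro mult_left_mono) auto
      moreover have "(h + H) * cos (e * pi) - (h + H) = (h + H) * (cos (e * pi) - 1)" by (simp add: algebra_simps)
      ultimately show ?thesis by (simp only: abs_mult) simp
    qed
    have 4: "\<bar>s n * sin (e * pi) - real n * (e * pi)\<bar> \<le> pi * C\<^sup>2 / real n + pi\<^sup>2 * C\<^sup>2 / real n"
    proof -
      have "s n * sin (e * pi) - real n * (e * pi) = e * sin (e * pi) + real n * (sin (e * pi) - e * pi)"
        by (simp add: e_def algebra_simps)
      also have "\<bar>\<dots>\<bar> \<le> \<bar>e\<bar> * \<bar>e * pi\<bar> + real n * (e * pi)\<^sup>2"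
      proof (rule order_trans[OF abs_triangle_ineq], intro add_mono)
        show "\<bar>e * sin (e * pi)\<bar> \<le> \<bar>e\<bar> * \<bar>e * pi\<bar>"
          unfolding abs_mult[of e "sin _"] by (intro mult_left_mono abs_sin_x_le_abs_x) auto
        show "\<bar>real n * (sin (e * pi) - e * pi)\<bar> \<le> real n * (e * pi)\<^sup>2"
          unfolding abs_mult abs_of_nat by (intro mult_left_mono abs_sin_minus_le) auto
      qed
      also have "\<dots> = pi * e\<^sup>2 + pi\<^sup>2 * (real n * e\<^sup>2)" by (simp add: abs_mult power2_eq_square)
      also have "\<dots> \<le> pi * (C\<^sup>2 / real n) + pi\<^sup>2 * (C\<^sup>2 / real n)"
        using ne e2 by (intro add_mono mult_left_mono) auto
      finally show ?thesis by simp
    qed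
    have "\<bar>real n * (e * pi) - (\<omega> + b n / 2)\<bar> \<le> C' / real n"
    proof -
      have "C' / real n = C / real n + \<bar>h + H\<bar> * (pi * C) / real n + Q * (2 * (pi * C)) / real n + pi * C\<^sup>2 / real n + pi\<^sup>2 * C\<^sup>2 / real n"
        by (simp add: C'_def add_divide_distrib)
      then show ?thesis using 1 2 3 4 unfolding \<omega>_def by linarith
    qed
    then have "\<bar>real n * (e * pi) - \<omega>\<bar> \<le> \<bar>b n\<bar> / 2 + C' / real n" by linarith
    moreover have "e - \<omega> / pi / real n = (real n * (e * pi) - \<omega>) / (pi * real n)"
      using n1 by (simp add: field_simps)
    ultimately have "\<bar>e - \<omega> / pi / real n\<bar> \<le> (\<bar>b n\<bar> / 2 + C' / real n) / (pi * real n)"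
      using n1 by (simp add: divide_right_mono)
    also have "\<dots> \<le> (\<bar>b n\<bar> + C' / real n) / (1 * real n)"
    proof (intro frac_le mult_right_mono)
      have "C' \<ge> 0" unfolding C'_def using N0(2) Q_nonneg by simp
      then show "0 \<le> \<bar>b n\<bar> + C' / real n" by simp
    qed (use n1 pi_gt3 in auto)
    finally show ?thesis by (simp add: e_def add_divide_distrib power2_eq_square)
  qed
  note bound = this
  have "summable (\<lambda>n. \<bar>s n - real n - (\<omega> / pi) / real n\<bar>)"
  proof (rule summable_comparison_test'[where N=N0])
    show "summable (\<lambda>n. \<bar>b n\<bar> / real n + C' / (real n)\<^sup>2)"
      unfolding b_def by (rule summable_add[OF summable_coeff_over_n[OF p_cos_summable] summable_const_over_n2])
    show "norm \<bar>s n - real n - (\<omega> / pi) / real n\<bar> \<le> \<bar>b n\<bar> / real n + C' / (real n)\<^sup>2" if "n \<ge> N0" for n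
      using bound[OF that] by simp
  qed
  then show thesis using that by blast
qed

end

section \<open>Asymptotics of the weight numbers\<close>

lemma integral_of_real:
  assumes "f integrable_on S"
  shows "integral S (\<lambda>x. complex_of_real (f x)) = of_real (integral S f)"
  using integral_linear[OF assms bounded_linear_of_real[where 'a=complex]] by (simp add: o_def)

lemma integral_cos_square:
  assumes "s > 0"
  shows "integral {0..pi} (\<lambda>x. cos (s * x) * cos (s * x)) = pi / 2 + sin (2 * s * pi) / (4 * s)"
proof -
  have "((\<lambda>x. x / 2 + sin (2 * s * x) / (4 * s)) has_vector_derivative cos (s * x) * cos (s * x)) (at x within {0..pi})" for x
  proof -
    have "((\<lambda>x. x / 2 + sin (2 * s * x) / (4 * s)) has_real_derivative 1 / 2 + cos (2 * s * x) * (2 * s) / (4 * s)) (at x within {0..pi})"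
      by (auto intro!: derivative_eq_intros)
    moreover have "1 / 2 + cos (2 * s * x) * (2 * s) / (4 * s) = cos (s * x) * cos (s * x)"
      using assms by (simp add: cos_times_cos algebra_simps add_divide_distrib)
    ultimately show ?thesis by (simp add: has_real_derivative_iff_has_vector_derivative)
  qed
  from fundamental_theorem_of_calculus[OF _ this] show ?thesis by (simp add: integral_unique)
qed

lemma integral_cos_sin_bound:
  assumes "s > 0"
  shows "\<bar>integral {0..pi} (\<lambda>x. cos (s * x) * sin (s * x))\<bar> \<le> 1 / s"
proof -
  have "((\<lambda>x. (sin (s * x))\<^sup>2 / (2 * s)) has_vector_derivative cos (s * x) * sin (s * x)) (at x within {0..pi})" for x
    using assms by (auto intro!: derivative_eq_intros simp: has_real_derivative_iff_has_vector_derivative[symmetric])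
  from fundamental_theorem_of_calculus[OF _ this]
  have eq: "integral {0..pi} (\<lambda>x. cos (s * x) * sin (s * x)) = (sin (s * pi))\<^sup>2 / (2 * s)" by (simp add: integral_unique)
  have "(sin (s * pi))\<^sup>2 \<le> 1" by (simp add: abs_square_le_1)
  then show ?thesis unfolding eq using assms by (simp add: divide_simps)
qed

text \<open>In the product formula one sine does not depend on x; it yields the main part -(pi -
  t)/2 sin(st), while the oscillating one contributes only O(1/s).\<close>

lemma integral_sin_cos_shift:
  assumes "s > 0" "t \<le> pi"
  shows "integral {t..pi} (\<lambda>x. sin (s * (x - t)) * cos (s * x))
      = - (pi - t) / 2 * sin (s * t) + (cos (s * t) - cos (2 * s * pi - s * t)) / (4 * s)"
proof -
  have "((\<lambda>x. - cos (2 * s * x - s * t) / (4 * s) - x / 2 * sin (s * t)) has_vector_derivative sin (s * (x - t)) * cos (s * x)) (at x within {t..pi})" for x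
  proof -
    have "((\<lambda>x. - cos (2 * s * x - s * t) / (4 * s) - x / 2 * sin (s * t)) has_real_derivative
       sin (2 * s * x - s * t) * (2 * s) / (4 * s) - sin (s * t) / 2) (at x within {t..pi})"
      by (auto intro!: derivative_eq_intros)
    moreover have "sin (2 * s * x - s * t) * (2 * s) / (4 * s) - sin (s * t) / 2 = sin (s * (x - t)) * cos (s * x)"
    proof -
      have "sin (s * (x - t)) * cos (s * x) = (sin (s * (x - t) + s * x) + sin (s * (x - t) - s * x)) / 2"
        by (rule sin_times_cos)
      also have "s * (x - t) + s * x = 2 * s * x - s * t" by (simp add: algebra_simps)
      also have "s * (x - t) - s * x = - (s * t)" by (simp add: algebra_simps)
      finally show ?thesis using assms by simp
    qed
    ultimately show ?thesis by (simp add: has_real_derivative_iff_has_vector_derivative)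
  qed
  from fundamental_theorem_of_calculus[OF assms(2) this]
  have "integral {t..pi} (\<lambda>x. sin (s * (x - t)) * cos (s * x))
     = (- cos (2 * s * pi - s * t) / (4 * s) - pi / 2 * sin (s * t)) - (- cos (2 * s * t - s * t) / (4 * s) - t / 2 * sin (s * t))"
    by (rule integral_unique)
  also have "2 * s * t - s * t = s * t" by simp
  finally show ?thesis by (simp add: diff_divide_distrib algebra_simps)
qed

context sturm_liouville
begin

text \<open>The weight pi - t comes from \<open>integral_sin_cos_shift\<close>, the frequency 2n
  from the product of sin(nt) and cos(nt).\<close>

lemma p_sin_summable: "summable (\<lambda>n. (integral {0..pi} (\<lambda>t. p t * (pi - t) * sin (real (2 * n) * t)))\<^sup>2)"
proof -
  have a: "(\<lambda>t. p t * (pi - t)) absolutely_integrable_on {0..pi}"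
    by (rule absolutely_integrable_mult_continuous(1)[OF p_abs_integrable]) (intro continuous_intros)
  have "(\<lambda>t. (p t)\<^sup>2) absolutely_integrable_on {0..pi}"
    by (rule nonnegative_absolutely_integrable_1[OF p_sq]) simp
  then have "(\<lambda>t. (p t)\<^sup>2 * (pi - t)\<^sup>2) absolutely_integrable_on {0..pi}"
    by (rule absolutely_integrable_mult_continuous(1)) (intro continuous_intros)
  then have "(\<lambda>t. (p t * (pi - t))\<^sup>2) integrable_on {0..pi}"
    by (simp add: power_mult_distrib absolutely_integrable_on_def)
  then have "summable (\<lambda>n. (integral {0..pi} (\<lambda>t. p t * (pi - t) * sin (real n * t)))\<^sup>2)"
    by (rule summable_sin_coeff_square[OF a])
  from summable_reindex[OF this, of "\<lambda>n. 2 * n"] show ?thesis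
    by (simp add: inj_on_def o_def)
qed

text \<open>Duhamel's correction is tested against the cosine, and the order of integration is
  exchanged so that the inner integral is elementary. Here the potential stands under Fubini's
  theorem, hence the Borel representative.\<close>

lemma c_Duhamel_swap:
  fixes s :: real
  assumes s: "s > 0"
  shows "of_real s * integral {0..pi} (\<lambda>x. of_real (cos (s * x)) * (c (of_real s) x - of_real (cos (s * x))))
     = of_real (h * integral {0..pi} (\<lambda>x. cos (s * x) * sin (s * x)))
       + integral {0..pi} (\<lambda>t. of_real (p t) * (c (of_real s) t * of_real (integral {t..pi} (\<lambda>x. sin (s * (x - t)) * cos (s * x)))))"
proof -
  let ?c = "c (of_real s)"
  let ?K = "\<lambda>x t. complex_of_real (sin (s * (x - t)))"
  let ?v = "\<lambda>t. complex_of_real (p t) * ?c t"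
  define \<Psi> where "\<Psi> x = integral {0..x} (\<lambda>t. ?K x t * ?v t)" for x
  have K: "continuous_kernel ?K"
    unfolding continuous_kernel_def split_beta by (intro continuous_intros)
  have D: "of_real s * (?c x - of_real (cos (s * x))) = of_real (h * sin (s * x)) + \<Psi> x" if "x \<in> {0..pi}" for x
  proof -
    have cc: "cos (of_real s * complex_of_real y) = of_real (cos (s * y))"
      "sin (of_real s * complex_of_real y) = of_real (sin (s * y))" for y
      by (metis cos_of_real of_real_mult) (metis sin_of_real of_real_mult)
    have "of_real s * ?c x = of_real s * of_real (cos (s * x)) + of_real (h * sin (s * x)) + \<Psi> x"
      unfolding Duhamel[OF that] cc \<Psi>_def by (simp add: mult_ac)
    then show ?thesis by (simp add: right_diff_distrib)
  qed
  have c\<Psi>: "continuous_on {0..pi} \<Psi>"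
  proof -
    have "continuous_on {0..pi} (\<lambda>x. of_real s * (?c x - of_real (cos (s * x))) - of_real (h * sin (s * x)))"
      by (intro continuous_intros)
    then show ?thesis by (rule continuous_on_eq) (simp only: D add_diff_cancel_left')
  qed
  have vm: "(\<lambda>t. indicator {0..pi} t *\<^sub>R ?v t) \<in> borel_measurable borel"
  proof -
    have "(\<lambda>t. complex_of_real (p t) * (indicator {0..pi} t *\<^sub>R ?c t)) \<in> borel_measurable borel"
      by (intro borel_measurable_times indicator_borel_measurable_continuous continuous_on_c
          measurable_compose[OF p_borel] borel_measurable_continuous_onI continuous_intros)
    then show ?thesis by simp
  qed
  have i: "f integrable_on {0..pi}" if "continuous_on {0..pi} f" for f :: "real \<Rightarrow> complex"
    using that by (rule integrable_continuous_interval)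
  have "of_real s * integral {0..pi} (\<lambda>x. of_real (cos (s * x)) * (?c x - of_real (cos (s * x))))
     = integral {0..pi} (\<lambda>x. of_real (cos (s * x)) * (of_real s * (?c x - of_real (cos (s * x)))))"
    by (subst integral_mult_right[symmetric]) (simp add: mult_ac)
  also have "\<dots> = integral {0..pi} (\<lambda>x. of_real (h * (cos (s * x) * sin (s * x))) + of_real (cos (s * x)) * \<Psi> x)"
    by (rule integral_cong) (simp only: D, simp add: algebra_simps)
  also have "\<dots> = integral {0..pi} (\<lambda>x. complex_of_real (h * (cos (s * x) * sin (s * x)))) + integral {0..pi} (\<lambda>x. of_real (cos (s * x)) * \<Psi> x)"
    by (intro integral_add i continuous_intros c\<Psi>)
  also have "integral {0..pi} (\<lambda>x. complex_of_real (h * (cos (s * x) * sin (s * x)))) = of_real (integral {0..pi} (\<lambda>x. h * (cos (s * x) * sin (s * x))))"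
    by (intro integral_of_real integrable_continuous_interval continuous_intros)
  also have "integral {0..pi} (\<lambda>x. of_real (cos (s * x)) * \<Psi> x)
     = integral {0..pi} (\<lambda>t. ?v t * integral {t..pi} (\<lambda>x. ?K x t * of_real (cos (s * x))))"
    unfolding \<Psi>_def
    by (rule integral_triangle_swap[OF K _ p_mult_integrable vm]) (auto intro!: continuous_intros)
  also have "\<dots> = integral {0..pi} (\<lambda>t. of_real (p t) * (?c t * of_real (integral {t..pi} (\<lambda>x. sin (s * (x - t)) * cos (s * x)))))"
  proof (rule integral_cong)
    fix t
    have "integral {t..pi} (\<lambda>x. ?K x t * of_real (cos (s * x))) = integral {t..pi} (\<lambda>x. complex_of_real (sin (s * (x - t)) * cos (s * x)))"
      by simp
    also have "\<dots> = of_real (integral {t..pi} (\<lambda>x. sin (s * (x - t)) * cos (s * x)))"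
      by (intro integral_of_real integrable_continuous_interval continuous_intros)
    finally show "?v t * integral {t..pi} (\<lambda>x. ?K x t * of_real (cos (s * x)))
      = of_real (p t) * (?c t * of_real (integral {t..pi} (\<lambda>x. sin (s * (x - t)) * cos (s * x))))" by simp
  qed
  finally show ?thesis by simp
qed

text \<open>Write c as cosine plus a deviation of size O(1/n). The integral of the squared cosine is
  pi/2 + O(1/n^2), that of the squared deviation is O(1/n^2). The size of the deviation gives only
  O(1/n) for the cross term, which is not summable; \<open>c_Duhamel_swap\<close> shows it to be a
  sine coefficient of the weighted potential divided by n, plus O(1/n^2).\<close>

lemma alpha_asymptotics: "summable (\<lambda>n. norm (alpha c lam n - of_real (pi / 2)))"
proof -
  obtain C N0 where N0: "N0 \<ge> 1" "C > 0"
    "\<And>n. n \<ge> N0 \<Longrightarrow> r n = of_real (s n) \<and> s n \<ge> real n / 2 \<and> \<bar>s n - real n\<bar> \<le> 1 / 2 \<and> \<bar>s n - real n\<bar> \<le> C / real n"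
    by (rule s_minus_nat_bound) (rule that; assumption)
  obtain B where B: "B > 0" "\<And>s x. s > 0 \<Longrightarrow> x \<in> {0..pi} \<Longrightarrow> norm (c (of_real s) x) \<le> B"
    "\<And>s x. s > 0 \<Longrightarrow> x \<in> {0..pi} \<Longrightarrow> norm (c (of_real s) x - of_real (cos (s * x))) \<le> B / s"
    by (rule c_asymptotics) (rule that; assumption)
  define d where "d n = integral {0..pi} (\<lambda>t. p t * (pi - t) * sin (real (2 * n) * t))" for n
  define E where "E = 4 * pi * B + 1 + pi * (pi * C)"
  \<comment> \<open>The three summands come from the three parts of \<open>split\<close>: squared
    cosine, cross term and squared deviation.\<close>
  define C' where "C' = pi * C + 4 * (2 * \<bar>h\<bar> + Q * E) + pi * (4 * B\<^sup>2)"
  have main: "norm (alpha c lam n - of_real (pi / 2)) \<le> \<bar>d n\<bar> / real n + C' / (real n)\<^sup>2" if n: "n \<ge> N0" for n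
  proof -
    define z where "z = s n"
    define e where "e = z - real n"
    have n1: "real n \<ge> 1" and rn: "r n = of_real z" and zn: "z \<ge> real n / 2" and e: "\<bar>e\<bar> \<le> C / real n"
      using N0(3)[OF n] n N0(1) by (auto simp: e_def z_def)
    have z0: "z > 0" using zn n1 by simp
    have iz: "1 / z \<le> 2 / real n" using zn n1 z0 by (simp add: field_simps)
    let ?c = "c (of_real z)"
    define k where "k x = complex_of_real (cos (z * x))" for x
    define \<delta> where "\<delta> x = ?c x - k x" for x
    have ck: "continuous_on {0..pi} k" unfolding k_def by (intro continuous_intros)
    have c\<delta>: "continuous_on {0..pi} \<delta>" unfolding \<delta>_def by (intro continuous_intros ck)
    have \<delta>: "norm (\<delta> x) \<le> 2 * B / real n" if "x \<in> {0..pi}" for x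
    proof -
      have "norm (\<delta> x) \<le> B / z" unfolding \<delta>_def k_def using B(3)[OF z0 that] .
      also have "\<dots> \<le> B * (2 / real n)" using mult_left_mono[OF iz, of B] B(1) by simp
      finally show ?thesis by (simp add: mult.commute)
    qed
    have i: "f integrable_on {0..pi}" if "continuous_on {0..pi} f" for f :: "real \<Rightarrow> complex"
      using that by (rule integrable_continuous_interval)
    define X where "X = integral {0..pi} (\<lambda>x. k x * \<delta> x)"
    define Y where "Y = integral {0..pi} (\<lambda>x. \<delta> x * \<delta> x)"
    have split: "alpha c lam n = integral {0..pi} (\<lambda>x. k x * k x) + 2 * X + Y"
    proof -
      have "alpha c lam n = integral {0..pi} (\<lambda>x. k x * k x + 2 * (k x * \<delta> x) + \<delta> x * \<delta> x)"
        unfolding alpha_def rn by (rule integral_cong) (simp add: \<delta>_def power2_eq_square algebra_simps)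
      also have "\<dots> = integral {0..pi} (\<lambda>x. k x * k x + 2 * (k x * \<delta> x)) + Y"
        unfolding Y_def by (intro integral_add i continuous_intros ck c\<delta>)
      also have "integral {0..pi} (\<lambda>x. k x * k x + 2 * (k x * \<delta> x)) = integral {0..pi} (\<lambda>x. k x * k x) + integral {0..pi} (\<lambda>x. 2 * (k x * \<delta> x))"
        by (intro integral_add i continuous_intros ck c\<delta>)
      finally show ?thesis by (simp add: X_def)
    qed
    have kk: "integral {0..pi} (\<lambda>x. k x * k x) = of_real (pi / 2 + sin (2 * z * pi) / (4 * z))"
    proof -
      have "integral {0..pi} (\<lambda>x. k x * k x) = integral {0..pi} (\<lambda>x. complex_of_real (cos (z * x) * cos (z * x)))"
        by (simp add: k_def)
      also have "\<dots> = of_real (integral {0..pi} (\<lambda>x. cos (z * x) * cos (z * x)))"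
        by (intro integral_of_real integrable_continuous_interval continuous_intros)
      finally show ?thesis by (simp add: integral_cos_square[OF z0])
    qed
    have k2: "norm (integral {0..pi} (\<lambda>x. k x * k x) - of_real (pi / 2)) \<le> pi * C / (real n)\<^sup>2"
    proof -
      have "sin (2 * z * pi) = 2 * (sin (z * pi) * cos (z * pi))" using sin_double[of "z * pi"] by (simp add: mult_ac)
      then have "\<bar>sin (2 * z * pi)\<bar> = 2 * (\<bar>sin (z * pi)\<bar> * \<bar>cos (z * pi)\<bar>)" by (simp add: abs_mult)
      also have "\<dots> \<le> 2 * (\<bar>e * pi\<bar> * 1)"
      proof (intro mult_left_mono mult_mono)
        show "\<bar>sin (z * pi)\<bar> \<le> \<bar>e * pi\<bar>"
          unfolding sin_cos_shift_nat(1)[of z n] e_def[symmetric] abs_mult using abs_sin_x_le_abs_x[of "e * pi"]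
          by (simp add: power_abs[symmetric] abs_mult)
      qed auto
      also have "\<dots> = 2 * (pi * \<bar>e\<bar>)" by (simp add: abs_mult)
      also have "\<dots> \<le> 2 * (pi * (C / real n))" using e by (intro mult_left_mono) auto
      finally have 1: "\<bar>sin (2 * z * pi)\<bar> \<le> 2 * (pi * (C / real n))" .
      have "norm (integral {0..pi} (\<lambda>x. k x * k x) - of_real (pi / 2)) = \<bar>sin (2 * z * pi)\<bar> * (1 / z) / 4"
        unfolding kk of_real_diff[symmetric] norm_of_real using z0 by (simp add: abs_mult)
      also have "\<dots> \<le> 2 * (pi * (C / real n)) * (2 / real n) / 4"
        by (intro divide_right_mono mult_mono 1 iz) (use z0 N0(2) in auto)
      finally show ?thesis by (simp add: power2_eq_square)
    qed
    have Y: "norm Y \<le> pi * (4 * B\<^sup>2) / (real n)\<^sup>2"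
    proof -
      have "norm Y \<le> (2 * B / real n)\<^sup>2 * (pi - 0)"
        unfolding Y_def
      proof (rule integral_bound)
        show "norm (\<delta> t * \<delta> t) \<le> (2 * B / real n)\<^sup>2" if "t \<in> {0..pi}" for t
          unfolding norm_mult power2_eq_square using \<delta>[OF that] B(1) by (intro mult_mono) auto
      qed (auto intro!: continuous_intros c\<delta>)
      then show ?thesis by (simp add: power2_eq_square mult_ac)
    qed
    have eps: "pi * \<bar>e\<bar> \<le> pi * C / real n" using mult_left_mono[OF e, of pi] by simp
    define inn where "inn t = integral {t..pi} (\<lambda>x. sin (z * (x - t)) * cos (z * x))" for t
    have inn: "inn t = - (pi - t) / 2 * sin (z * t) + (cos (z * t) - cos (2 * z * pi - z * t)) / (4 * z)" if "t \<in> {0..pi}" for t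
      unfolding inn_def using integral_sin_cos_shift[OF z0] that by simp
    have inn1: "\<bar>inn t + (pi - t) / 2 * sin (z * t)\<bar> \<le> 1 / real n" if "t \<in> {0..pi}" for t
    proof -
      have "\<bar>cos (z * t) - cos (2 * z * pi - z * t)\<bar> \<le> 2"
        using abs_cos_le_one[of "z * t"] abs_cos_le_one[of "2 * z * pi - z * t"] by linarith
      then have "\<bar>cos (z * t) - cos (2 * z * pi - z * t)\<bar> * (1 / z) \<le> 2 * (2 / real n)"
        using iz z0 by (intro mult_mono) auto
      moreover have "inn t + (pi - t) / 2 * sin (z * t) = (cos (z * t) - cos (2 * z * pi - z * t)) / (4 * z)"
        unfolding inn[OF that] by (simp add: left_diff_distrib diff_divide_distrib)
      ultimately show ?thesis using z0 by (simp add: abs_mult)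
    qed
    have inn2: "\<bar>inn t\<bar> \<le> pi" if t: "t \<in> {0..pi}" for t
    proof -
      have "\<bar>(pi - t) / 2 * sin (z * t)\<bar> \<le> pi / 2 * 1"
        unfolding abs_mult using t by (intro mult_mono) auto
      moreover have "1 / real n \<le> 1" using n1 by simp
      ultimately show ?thesis using inn1[OF t] pi_gt3 by linarith
    qed
    have cinn: "continuous_on {0..pi} inn"
    proof -
      have "continuous_on {0..pi} (\<lambda>t. - (pi - t) / 2 * sin (z * t) + (cos (z * t) - cos (2 * z * pi - z * t)) / (4 * z))"
        using z0 by (intro continuous_intros) auto
      then show ?thesis by (rule continuous_on_eq) (simp add: inn)
    qed
    define Z where "Z = integral {0..pi} (\<lambda>t. of_real (p t) * (?c t * of_real (inn t)))"
    have X: "of_real z * X = of_real (h * integral {0..pi} (\<lambda>x. cos (z * x) * sin (z * x))) + Z"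
      unfolding X_def Z_def inn_def k_def \<delta>_def by (rule c_Duhamel_swap[OF z0])
    have Z: "norm (Z - of_real (- d n / 4)) \<le> Q * (E / real n)"
    proof -
      have dn: "integral {0..pi} (\<lambda>t. p t * (- ((pi - t) / 2) * (sin (real n * t) * cos (real n * t)))) = - d n / 4"
      proof -
        have "(\<lambda>t. p t * (- ((pi - t) / 2) * (sin (real n * t) * cos (real n * t)))) = (\<lambda>t. (- 1 / 4) * (p t * (pi - t) * sin (real (2 * n) * t)))"
          using sin_double[of "real n * _"] by (auto simp: mult.assoc[symmetric])
        then show ?thesis unfolding d_def by simp
      qed
      have "integral {0..pi} (\<lambda>t. of_real (p t) * complex_of_real (- ((pi - t) / 2) * (sin (real n * t) * cos (real n * t)))) = of_real (- d n / 4)"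
        unfolding dn[symmetric] by (rule p_real_integral(1)) (intro continuous_intros; simp)
      then have "Z - of_real (- d n / 4) = integral {0..pi} (\<lambda>t. of_real (p t) * (?c t * of_real (inn t)))
         - integral {0..pi} (\<lambda>t. of_real (p t) * complex_of_real (- ((pi - t) / 2) * (sin (real n * t) * cos (real n * t))))"
        by (simp only: Z_def)
      also have "norm \<dots> \<le> Q * (E / real n)"
      proof (rule p_integral_diff_bound)
        fix t assume t: "t \<in> {0..pi}"
        have eq: "?c t * of_real (inn t) - complex_of_real (- ((pi - t) / 2) * (sin (real n * t) * cos (real n * t)))
          = \<delta> t * of_real (inn t) + of_real (cos (z * t) * (inn t + (pi - t) / 2 * sin (z * t)))
            - of_real ((pi - t) / 2 * (sin (z * t) * cos (z * t) - sin (real n * t) * cos (real n * t)))"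
          by (simp add: \<delta>_def k_def algebra_simps)
        have "norm (?c t * of_real (inn t) - complex_of_real (- ((pi - t) / 2) * (sin (real n * t) * cos (real n * t)))) \<le> norm (\<delta> t * of_real (inn t)) + norm (complex_of_real (cos (z * t) * (inn t + (pi - t) / 2 * sin (z * t))))
           + norm (complex_of_real ((pi - t) / 2 * (sin (z * t) * cos (z * t) - sin (real n * t) * cos (real n * t))))"
          unfolding eq by (rule order_trans[OF norm_triangle_ineq4 add_right_mono[OF norm_triangle_ineq]])
        also have "\<dots> \<le> 2 * B / real n * pi + 1 * (1 / real n) + pi / 2 * (2 * (pi * C / real n))"
          unfolding norm_mult norm_of_real abs_mult
        proof (intro add_mono mult_mono \<delta> inn2 inn1 t)
          have d: "\<bar>cos (z * t) - cos (real n * t)\<bar> \<le> pi * C / real n" "\<bar>sin (z * t) - sin (real n * t)\<bar> \<le> pi * C / real n"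
          proof -
            have "\<bar>z * t - real n * t\<bar> = \<bar>t\<bar> * \<bar>e\<bar>" by (simp add: e_def abs_mult flip: left_diff_distrib)
            also have "\<dots> \<le> pi * \<bar>e\<bar>" using t by (intro mult_right_mono) auto
            finally have "\<bar>z * t - real n * t\<bar> \<le> pi * C / real n" using eps by linarith
            then show "\<bar>cos (z * t) - cos (real n * t)\<bar> \<le> pi * C / real n" "\<bar>sin (z * t) - sin (real n * t)\<bar> \<le> pi * C / real n"
              using abs_cos_diff_le[of "z * t" "real n * t"] abs_sin_diff_le[of "z * t" "real n * t"] by linarith+
          qed
          show "\<bar>sin (z * t) * cos (z * t) - sin (real n * t) * cos (real n * t)\<bar> \<le> 2 * (pi * C / real n)"
            by (rule abs_mult_diff_le) (use d in auto)
        qed (use t B(1) in auto)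
        also have "\<dots> \<le> E / real n"
          using B(1) n1 by (simp add: E_def add_divide_distrib[symmetric] divide_right_mono)
        finally show "norm (?c t * of_real (inn t) - complex_of_real (- ((pi - t) / 2) * (sin (real n * t) * cos (real n * t)))) \<le> E / real n" .
      qed (auto intro!: continuous_intros cinn)
      finally show ?thesis .
    qed
    have "norm (complex_of_real (h * integral {0..pi} (\<lambda>x. cos (z * x) * sin (z * x)))) \<le> \<bar>h\<bar> * (2 / real n)"
      unfolding norm_of_real abs_mult using integral_cos_sin_bound[OF z0] iz by (intro mult_left_mono) auto
    note nh = this
    have nd: "norm (complex_of_real (- d n / 4)) \<le> \<bar>d n\<bar> / 4" unfolding norm_of_real by simp
    have eqX: "of_real z * X = of_real (h * integral {0..pi} (\<lambda>x. cos (z * x) * sin (z * x))) + ((Z - of_real (- d n / 4)) + of_real (- d n / 4))"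
      unfolding X by simp
    have "norm (of_real z * X) \<le> \<bar>h\<bar> * (2 / real n) + (Q * (E / real n) + \<bar>d n\<bar> / 4)"
      unfolding eqX by (intro norm_triangle_mono nh Z nd)
    then have zX: "z * norm X \<le> (2 * \<bar>h\<bar> + Q * E) / real n + \<bar>d n\<bar> / 4"
      using z0 by (simp add: norm_mult add_divide_distrib algebra_simps)
    have "norm X \<le> ((2 * \<bar>h\<bar> + Q * E) / real n + \<bar>d n\<bar> / 4) * (1 / z)"
      using zX z0 by (simp add: field_simps)
    also have "\<dots> \<le> ((2 * \<bar>h\<bar> + Q * E) / real n + \<bar>d n\<bar> / 4) * (2 / real n)"
    proof (intro mult_left_mono iz)
      have "E \<ge> 0" unfolding E_def using B(1) N0(2) by simp
      then show "0 \<le> (2 * \<bar>h\<bar> + Q * E) / real n + \<bar>d n\<bar> / 4" using Q_nonneg by simp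
    qed
    finally have X2: "norm X \<le> 2 * (2 * \<bar>h\<bar> + Q * E) / (real n)\<^sup>2 + \<bar>d n\<bar> / (2 * real n)"
      by (simp add: power2_eq_square add_divide_distrib mult_ac)
    have "norm (2 * X) = 2 * norm X" by (simp add: norm_mult)
    with mult_left_mono[OF X2, of 2]
    have X4: "norm (2 * X) \<le> 2 * (2 * (2 * \<bar>h\<bar> + Q * E) / (real n)\<^sup>2 + \<bar>d n\<bar> / (2 * real n))" by linarith
    have eqa: "alpha c lam n - of_real (pi / 2) = (integral {0..pi} (\<lambda>x. k x * k x) - of_real (pi / 2)) + 2 * X + Y"
      unfolding split by simp
    have "norm (alpha c lam n - of_real (pi / 2)) \<le> pi * C / (real n)\<^sup>2 + 2 * (2 * (2 * \<bar>h\<bar> + Q * E) / (real n)\<^sup>2 + \<bar>d n\<bar> / (2 * real n)) + pi * (4 * B\<^sup>2) / (real n)\<^sup>2"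
      unfolding eqa by (intro norm_triangle_mono k2 X4 Y)
    also have "\<dots> = \<bar>d n\<bar> / real n + C' / (real n)\<^sup>2"
      by (simp add: C'_def add_divide_distrib)
    finally show ?thesis .
  qed
  show ?thesis
  proof (rule summable_comparison_test'[where N=N0])
    show "summable (\<lambda>n. \<bar>d n\<bar> / real n + C' / (real n)\<^sup>2)"
      unfolding d_def by (rule summable_add[OF summable_coeff_over_n[OF p_sin_summable] summable_const_over_n2])
  qed (use main in simp)
qed

lemma inverse_alpha_asymptotics: "summable (\<lambda>n. norm (1 / alpha c lam n - of_real (2 / pi)))"
proof -
  have "(\<lambda>n. norm (alpha c lam n - of_real (pi / 2))) \<longlonglongrightarrow> 0"
    by (rule summable_LIMSEQ_zero[OF alpha_asymptotics])
  then have "\<forall>\<^sub>F n in sequentially. norm (alpha c lam n - of_real (pi / 2)) < 1 / 2"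
    by (rule order_tendstoD) simp
  then obtain N where N: "\<And>n. n \<ge> N \<Longrightarrow> norm (alpha c lam n - of_real (pi / 2)) < 1 / 2"
    by (auto simp: eventually_sequentially)
  show ?thesis
  proof (rule summable_comparison_test'[OF alpha_asymptotics, of N])
    fix n assume "n \<ge> N"
    let ?a = "alpha c lam n"
    have "norm (complex_of_real (pi / 2)) \<le> norm ?a + norm (?a - of_real (pi / 2))"
      by (metis norm_minus_commute norm_triangle_sub)
    then have a1: "norm ?a \<ge> 1" using N[OF \<open>n \<ge> N\<close>] pi_gt3 by simp
    have eq: "1 / ?a - of_real (2 / pi) = - (?a - of_real (pi / 2)) / (?a * of_real (pi / 2))"
      by (simp add: field_simps)
    have "norm (1 / ?a - of_real (2 / pi)) = norm (?a - of_real (pi / 2)) / (norm ?a * (pi / 2))"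
      unfolding eq norm_divide norm_mult norm_minus_cancel norm_of_real by simp
    also have "\<dots> \<le> norm (?a - of_real (pi / 2)) / 1"
    proof (rule divide_left_mono)
      show "1 \<le> norm ?a * (pi / 2)"
        using mult_mono[OF a1, of 1 "pi / 2"] pi_gt3 by simp
    qed auto
    finally show "norm (norm (1 / ?a - of_real (2 / pi))) \<le> norm (?a - of_real (pi / 2))" by simp
  qed
qed

end

section \<open>Convergence of the kernel series\<close>

lemma volterra_cong:
  assumes "\<And>s. s \<in> {0..pi} \<Longrightarrow> u s = v s" "x \<in> {0..pi}"
  shows "volterra A u x = volterra A v x"
proof -
  have "integral {0..x} (\<lambda>s. A x s * u s) = integral {0..x} (\<lambda>s. A x s * v s)"
    by (rule integral_cong) (use assms in auto)
  then show ?thesis using assms by (simp add: volterra_def)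
qed

lemma volterra_sum:
  assumes A: "continuous_kernel A" and u: "\<And>n. n \<in> I \<Longrightarrow> continuous_on {0..pi} (u n)" and "finite I"
    and x: "x \<in> {0..pi}"
  shows "volterra A (\<lambda>s. \<Sum>n\<in>I. b n * u n s) x = (\<Sum>n\<in>I. b n * volterra A (u n) x)"
proof -
  have i: "(\<lambda>s. A x s * u n s) integrable_on {0..x}" if "n \<in> I" for n
    using x by (intro integrable_continuous_interval continuous_intros continuous_kernel_compose[OF A]
        continuous_on_subset[OF u[OF that]]) auto
  have "integral {0..x} (\<lambda>s. A x s * (\<Sum>n\<in>I. b n * u n s)) = integral {0..x} (\<lambda>s. \<Sum>n\<in>I. b n * (A x s * u n s))"
    by (simp add: sum_distrib_left mult_ac)
  also have "\<dots> = (\<Sum>n\<in>I. integral {0..x} (\<lambda>s. b n * (A x s * u n s)))"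
    using i \<open>finite I\<close> by (intro integral_sum integrable_on_mult_right)
  also have "\<dots> = (\<Sum>n\<in>I. b n * integral {0..x} (\<lambda>s. A x s * u n s))" by simp
  finally show ?thesis by (simp add: volterra_def sum.distrib distrib_left)
qed

lemma uniform_limit_volterra:
  assumes A: "continuous_kernel A"
    and ul: "uniform_limit {0..pi} \<phi> \<psi> sequentially"
    and c: "\<And>N. continuous_on {0..pi} (\<phi> N)" "continuous_on {0..pi} \<psi>"
  shows "uniform_limit {0..pi} (\<lambda>N. volterra A (\<phi> N)) (volterra A \<psi>) sequentially"
proof -
  obtain M where M: "M > 0" "\<And>x t. 0 \<le> t \<Longrightarrow> t \<le> x \<Longrightarrow> x \<le> pi \<Longrightarrow> norm (A x t) \<le> M"
    using continuous_kernel_bounded[OF A] by metis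
  show ?thesis
  proof (rule uniform_limitI)
    fix e :: real assume "e > 0"
    \<comment> \<open>A bound for the operator in the supremum norm.\<close>
    define L where "L = 1 + M * pi"
    define e' where "e' = (e / 2) / L"
    have "L > 0" using M(1) by (simp add: L_def add_pos_pos)
    then have e': "e' > 0" "L * e' = e / 2" using \<open>e > 0\<close> by (auto simp: e'_def)
    have "\<forall>\<^sub>F N in sequentially. \<forall>x\<in>{0..pi}. dist (\<phi> N x) (\<psi> x) < e'"
      using ul e'(1) by (rule uniform_limitD)
    then show "\<forall>\<^sub>F N in sequentially. \<forall>x\<in>{0..pi}. dist (volterra A (\<phi> N) x) (volterra A \<psi> x) < e"
    proof eventually_elim
      case (elim N)
      show ?case
      proof
        fix x assume x: "x \<in> {0..pi}"
        have ck: "continuous_on {0..x} (A x)"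
          using x by (intro continuous_kernel_compose[OF A]) (auto intro!: continuous_intros)
        have ci: "continuous_on {0..x} (\<phi> N)" "continuous_on {0..x} \<psi>"
          using x by (auto intro: continuous_on_subset[OF c(1)] continuous_on_subset[OF c(2)])
        have "integral {0..x} (\<lambda>s. A x s * \<phi> N s) - integral {0..x} (\<lambda>s. A x s * \<psi> s)
            = integral {0..x} (\<lambda>s. A x s * (\<phi> N s - \<psi> s))"
          unfolding right_diff_distrib
          by (intro integral_diff[symmetric] integrable_continuous_interval continuous_intros ck ci)
        then have eq: "volterra A (\<phi> N) x - volterra A \<psi> x = (\<phi> N x - \<psi> x) + integral {0..x} (\<lambda>s. A x s * (\<phi> N s - \<psi> s))"
          by (simp add: volterra_def)
        have "norm (integral {0..x} (\<lambda>s. A x s * (\<phi> N s - \<psi> s))) \<le> (M * e') * (x - 0)"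
        proof (rule integral_bound)
          show "continuous_on {0..x} (\<lambda>s. A x s * (\<phi> N s - \<psi> s))"
            by (intro continuous_intros ck ci)
          fix s assume "s \<in> {0..x}"
          then show "norm (A x s * (\<phi> N s - \<psi> s)) \<le> M * e'"
            unfolding norm_mult using x elim M by (intro mult_mono) (auto simp: dist_norm less_imp_le)
        qed (use x in auto)
        also have "\<dots> \<le> (M * e') * pi" using x M(1) e'(1) by (intro mult_left_mono) auto
        finally have "norm (volterra A (\<phi> N) x - volterra A \<psi> x) \<le> e' + (M * e') * pi"
          unfolding eq using elim x by (intro norm_triangle_mono) (auto simp: dist_norm less_imp_le)
        also have "\<dots> = e / 2" unfolding e'(2)[symmetric] L_def by (simp add: algebra_simps)
        finally show "dist (volterra A (\<phi> N) x) (volterra A \<psi> x) < e"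
          using \<open>e > 0\<close> by (simp add: dist_norm)
      qed
    qed
  qed
qed

context sturm_liouville
begin

text \<open>A single term of the series for F; not the transmutation operator, which is
  \<open>volterra G\<close>.\<close>

definition T :: "nat \<Rightarrow> real \<Rightarrow> real \<Rightarrow> complex" where
  "T n x t = cos (r n * of_real x) * cos (r n * of_real t) / alpha c lam n
           - cos (of_nat n * of_real x) * cos (of_nat n * of_real t) / alpha0 n"

lemma kernel_F_eq: "kernel_F c lam x t = (\<Sum>n. T n x t)"
  by (simp add: kernel_F_def T_def)

lemma cos_nat_of_real: "cos (of_nat n * of_real x) = complex_of_real (cos (real n * x))"
  by (metis cos_of_real of_real_mult of_real_of_nat_eq)

text \<open>The bound depends on \<open>n\<close>: it is meant for the finitely many early indices,
  where \<open>r n\<close> may be imaginary.\<close>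

lemma T_norm_bound: "\<exists>B. \<forall>x\<in>{0..pi}. \<forall>t\<in>{0..pi}. norm (T n x t) \<le> B"
proof -
  let ?E = "exp (\<bar>Im (r n)\<bar> * pi)"
  have cb: "norm (cos (r n * of_real x)) \<le> ?E" if "x \<in> {0..pi}" for x
  proof -
    have "norm (cos (r n * of_real x)) \<le> exp (\<bar>Im (r n)\<bar> * x)" using that by (intro norm_cos_mult_le_exp) auto
    also have "\<dots> \<le> ?E" using that by (simp add: mult_left_mono)
    finally show ?thesis .
  qed
  have "norm (T n x t) \<le> ?E * ?E / norm (alpha c lam n) + 1 * 1 / norm (alpha0 n)" if "x \<in> {0..pi}" "t \<in> {0..pi}" for x t
    unfolding T_def
  proof (rule order_trans[OF norm_triangle_ineq4], intro add_mono)
    show "norm (cos (r n * of_real x) * cos (r n * of_real t) / alpha c lam n) \<le> ?E * ?E / norm (alpha c lam n)"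
      unfolding norm_divide norm_mult using cb that by (intro divide_right_mono mult_mono) auto
    show "norm (cos (of_nat n * of_real x) * cos (of_nat n * of_real t) / alpha0 n) \<le> 1 * 1 / norm (alpha0 n)"
      unfolding norm_divide norm_mult cos_nat_of_real norm_of_real by (intro divide_right_mono mult_mono) auto
  qed
  then show ?thesis by blast
qed

text \<open>Expansion of cos((n + e) y) to second order in e, with e replaced by \<kappa>/n in the
  linear term. The value of \<kappa> is free: the constant from the eigenvalue asymptotics serves
  for the kernel series, and \<kappa> = e n cancels the last error term.\<close>

lemma cos_shift_expansion:
  fixes y z :: real
  assumes y: "\<bar>y\<bar> \<le> 2 * pi"
  shows "\<bar>cos (z * y) - cos (real n * y) + \<kappa> * (y * (sin (real n * y) / real n))\<bar>
     \<le> 2 * (2 * pi)\<^sup>2 * (z - real n)\<^sup>2 + 2 * pi * \<bar>z - real n - \<kappa> / real n\<bar>"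
proof -
  define e where "e = z - real n"
  have e2: "(e * y)\<^sup>2 \<le> (2 * pi)\<^sup>2 * e\<^sup>2"
  proof -
    have "y\<^sup>2 \<le> (2 * pi)\<^sup>2" using y by (metis abs_ge_zero power2_abs power_mono)
    then have "e\<^sup>2 * y\<^sup>2 \<le> e\<^sup>2 * (2 * pi)\<^sup>2" by (intro mult_left_mono) auto
    then show ?thesis by (simp only: power_mult_distrib[of e y] mult.commute[of "e\<^sup>2"])
  qed
  have "cos (z * y) = cos (real n * y) * cos (e * y) - sin (real n * y) * sin (e * y)"
  proof -
    have "z * y = real n * y + e * y" by (simp add: e_def algebra_simps)
    then show ?thesis by (simp only: cos_add)
  qed
  then have eq: "cos (z * y) - cos (real n * y) + \<kappa> * (y * (sin (real n * y) / real n))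
     = cos (real n * y) * (cos (e * y) - 1) + - (sin (real n * y) * (sin (e * y) - e * y)) + - ((e - \<kappa> / real n) * (y * sin (real n * y)))"
    by (simp add: algebra_simps)
  have 1: "\<bar>cos (real n * y) * (cos (e * y) - 1)\<bar> \<le> (e * y)\<^sup>2"
  proof -
    have "\<bar>cos (e * y) - 1\<bar> \<le> (e * y)\<^sup>2"
    proof -
      have "cos (e * y) - 1 = - 2 * (sin (e * y / 2))\<^sup>2" using cos_double_sin[of "e * y / 2"] by simp
      moreover have "(sin (e * y / 2))\<^sup>2 \<le> (e * y / 2)\<^sup>2"
        using abs_sin_x_le_abs_x[of "e * y / 2"] by (metis abs_ge_zero power2_abs power_mono)
      moreover have "(e * y / 2)\<^sup>2 = (e * y)\<^sup>2 / 4" by (simp add: power_divide)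
      moreover have "0 \<le> (sin (e * y / 2))\<^sup>2" by simp
      ultimately show ?thesis by linarith
    qed
    then show ?thesis unfolding abs_mult using mult_mono[of "\<bar>cos (real n * y)\<bar>" 1 "\<bar>cos (e * y) - 1\<bar>" "(e * y)\<^sup>2"] by simp
  qed
  have 2: "\<bar>- (sin (real n * y) * (sin (e * y) - e * y))\<bar> \<le> (e * y)\<^sup>2"
    unfolding abs_minus_cancel abs_mult
    using mult_mono[of "\<bar>sin (real n * y)\<bar>" 1, OF _ abs_sin_minus_le[of "e * y"]] by simp
  have 3: "\<bar>- ((e - \<kappa> / real n) * (y * sin (real n * y)))\<bar> \<le> 2 * pi * \<bar>e - \<kappa> / real n\<bar>"
  proof -
    have "\<bar>y\<bar> * \<bar>sin (real n * y)\<bar> \<le> 2 * pi * 1" using y by (intro mult_mono) auto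
    from mult_left_mono[OF this, of "\<bar>e - \<kappa> / real n\<bar>"] show ?thesis by (simp add: abs_mult mult_ac)
  qed
  show ?thesis unfolding eq using 1 2 3 e2 unfolding e_def[symmetric] by linarith
qed

text \<open>The value at \<open>n = 0\<close> is 0, since division by zero gives 0.\<close>

definition sine_term :: "nat \<Rightarrow> real \<Rightarrow> real" where
  "sine_term n y = y * (sin (real n * y) / real n)"

text \<open>Only the explicit sine series, which converges conditionally, has to be split off.\<close>

lemma T_expansion:
  obtains \<kappa> W where "summable W"
    "\<And>n x t. x \<in> {0..pi} \<Longrightarrow> t \<in> {0..pi} \<Longrightarrow>
       norm (T n x t + of_real (\<kappa> * (sine_term n (x + t) + sine_term n (x - t)))) \<le> W n"
proof -
  obtain \<kappa> where \<kappa>: "summable (\<lambda>n. \<bar>s n - real n - \<kappa> / real n\<bar>)" by (rule s_asymptotics) (rule that; assumption)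
  obtain C N0 where N0: "N0 \<ge> 1" "C > 0"
    "\<And>n. n \<ge> N0 \<Longrightarrow> r n = of_real (s n) \<and> s n \<ge> real n / 2 \<and> \<bar>s n - real n\<bar> \<le> 1 / 2 \<and> \<bar>s n - real n\<bar> \<le> C / real n"
    by (rule s_minus_nat_bound) (rule that; assumption)
  define w where "w n = 2 * (2 * pi)\<^sup>2 * (C\<^sup>2 / (real n)\<^sup>2) + 2 * pi * \<bar>s n - real n - \<kappa> / real n\<bar>
     + norm (1 / alpha c lam n - of_real (2 / pi))" for n
  have sw: "summable w"
    unfolding w_def by (intro summable_add summable_mult summable_const_over_n2 \<kappa> inverse_alpha_asymptotics)
  have big: "norm (T n x t + of_real (\<kappa> / pi * (sine_term n (x + t) + sine_term n (x - t)))) \<le> w n"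
    if n: "n \<ge> N0" and x: "x \<in> {0..pi}" and t: "t \<in> {0..pi}" for n x t
  proof -
    let ?z = "s n"
    have n1: "n \<noteq> 0" and rn: "r n = of_real ?z" and e: "\<bar>?z - real n\<bar> \<le> C / real n" using N0(3)[OF n] n N0(1) by auto
    have e2: "(?z - real n)\<^sup>2 \<le> C\<^sup>2 / (real n)\<^sup>2"
      using power_mono[OF e, of 2] by (simp add: power_divide)
    have cr: "cos (r n * of_real y) = of_real (cos (?z * y))" for y by (rule cos_r_mult[OF rn])
    define D where "D y = cos (?z * y) - cos (real n * y) + \<kappa> * sine_term n y" for y
    have D: "\<bar>D y\<bar> \<le> 2 * (2 * pi)\<^sup>2 * (C\<^sup>2 / (real n)\<^sup>2) + 2 * pi * \<bar>s n - real n - \<kappa> / real n\<bar>" (is "_ \<le> ?d") if "\<bar>y\<bar> \<le> 2 * pi" for y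
    proof -
      have "\<bar>D y\<bar> \<le> 2 * (2 * pi)\<^sup>2 * (?z - real n)\<^sup>2 + 2 * pi * \<bar>?z - real n - \<kappa> / real n\<bar>"
        unfolding D_def sine_term_def by (rule cos_shift_expansion[OF that])
      also have "\<dots> \<le> ?d" by (intro add_right_mono mult_left_mono e2) auto
      finally show ?thesis .
    qed
    have a0: "1 / alpha0 n = of_real (2 / pi)" using n1 by (simp add: alpha0_def)
    have "T n x t = (1 / alpha c lam n - of_real (2 / pi)) * of_real (cos (?z * x) * cos (?z * t))
        + of_real (2 / pi * (cos (?z * x) * cos (?z * t) - cos (real n * x) * cos (real n * t)))"
    proof -
      have "T n x t = 1 / alpha c lam n * of_real (cos (?z * x) * cos (?z * t)) - 1 / alpha0 n * of_real (cos (real n * x) * cos (real n * t))"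
        by (simp add: T_def cr cos_nat_of_real)
      then show ?thesis unfolding a0 by (simp add: algebra_simps)
    qed
    note T_eq = this
    have "cos (?z * x) * cos (?z * t) - cos (real n * x) * cos (real n * t)
       = (D (x - t) + D (x + t)) / 2 - \<kappa> / 2 * (sine_term n (x + t) + sine_term n (x - t))"
    proof -
      \<comment> \<open>The product formula leads to the arguments x - t and x + t, which is why two
        sine series appear.\<close>
      have cp: "cos (a * x) * cos (a * t) = (cos (a * (x - t)) + cos (a * (x + t))) / 2" for a
        by (simp add: cos_times_cos right_diff_distrib distrib_left)
      have gen: "(A1 + A2) / 2 - (B1 + B2) / 2
          = ((A1 - B1 + \<kappa> * S1) + (A2 - B2 + \<kappa> * S2)) / 2 - \<kappa> / 2 * (S2 + S1)" for A1 A2 B1 B2 S1 S2 :: real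
        by (simp add: field_simps)
      show ?thesis unfolding D_def cp by (rule gen)
    qed
    then have "2 / pi * (cos (?z * x) * cos (?z * t) - cos (real n * x) * cos (real n * t))
        + \<kappa> / pi * (sine_term n (x + t) + sine_term n (x - t)) = (D (x - t) + D (x + t)) / pi"
      by (simp only:) (simp add: field_simps)
    then have eq: "T n x t + of_real (\<kappa> / pi * (sine_term n (x + t) + sine_term n (x - t)))
       = (1 / alpha c lam n - of_real (2 / pi)) * of_real (cos (?z * x) * cos (?z * t)) + of_real ((D (x - t) + D (x + t)) / pi)"
      unfolding T_eq add.assoc of_real_add[symmetric] by (simp only:)
    have xt: "\<bar>x - t\<bar> \<le> 2 * pi" "\<bar>x + t\<bar> \<le> 2 * pi" using x t by auto
    have "norm ((1 / alpha c lam n - of_real (2 / pi)) * of_real (cos (?z * x) * cos (?z * t))) \<le> norm (1 / alpha c lam n - of_real (2 / pi)) * 1"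
      unfolding norm_mult[of "_ - _"] norm_of_real abs_mult by (intro mult_left_mono mult_le_one) auto
    moreover have "norm (complex_of_real ((D (x - t) + D (x + t)) / pi)) \<le> ?d"
    proof -
      have "\<bar>D (x - t) + D (x + t)\<bar> \<le> ?d + ?d"
        by (intro order_trans[OF abs_triangle_ineq] add_mono D xt)
      also have "\<dots> = ?d * 2" by simp
      also have "\<dots> \<le> ?d * pi" using pi_gt3 by (intro mult_left_mono) auto
      finally show ?thesis unfolding norm_of_real by (simp add: pos_divide_le_eq)
    qed
    ultimately show ?thesis unfolding eq w_def by (intro order_trans[OF norm_triangle_ineq]) linarith
  qed
  have small: "\<exists>B. \<forall>x\<in>{0..pi}. \<forall>t\<in>{0..pi}. norm (T n x t + of_real (\<kappa> / pi * (sine_term n (x + t) + sine_term n (x - t)))) \<le> B" for n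
  proof -
    obtain B where B: "\<And>x t. x \<in> {0..pi} \<Longrightarrow> t \<in> {0..pi} \<Longrightarrow> norm (T n x t) \<le> B"
      using T_norm_bound by blast
    have st: "\<bar>sine_term n y\<bar> \<le> 2 * pi" if "\<bar>y\<bar> \<le> 2 * pi" for y
    proof -
      have "\<bar>sin (real n * y) / real n\<bar> \<le> 1"
      proof (cases "n = 0")
        case False
        then have "\<bar>sin (real n * y)\<bar> \<le> real n" by (intro order_trans[OF abs_sin_le_one]) simp
        then show ?thesis using False by simp
      qed simp
      then have "\<bar>y\<bar> * \<bar>sin (real n * y) / real n\<bar> \<le> 2 * pi * 1" using that by (intro mult_mono) auto
      then show ?thesis by (simp add: sine_term_def abs_mult)
    qed
    have "norm (T n x t + of_real (\<kappa> / pi * (sine_term n (x + t) + sine_term n (x - t)))) \<le> B + \<bar>\<kappa> / pi\<bar> * (2 * pi + 2 * pi)"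
      if x: "x \<in> {0..pi}" and t: "t \<in> {0..pi}" for x t
    proof (intro norm_triangle_mono B x t)
      have "\<bar>sine_term n (x + t) + sine_term n (x - t)\<bar> \<le> 2 * pi + 2 * pi"
        using st[of "x + t"] st[of "x - t"] x t by (intro order_trans[OF abs_triangle_ineq] add_mono) auto
      then show "norm (complex_of_real (\<kappa> / pi * (sine_term n (x + t) + sine_term n (x - t)))) \<le> \<bar>\<kappa> / pi\<bar> * (2 * pi + 2 * pi)"
        unfolding norm_of_real abs_mult by (intro mult_left_mono) auto
    qed
    then show ?thesis by blast
  qed
  then obtain b where b: "\<And>n x t. x \<in> {0..pi} \<Longrightarrow> t \<in> {0..pi} \<Longrightarrow> norm (T n x t + of_real (\<kappa> / pi * (sine_term n (x + t) + sine_term n (x - t)))) \<le> b n"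
    by metis
  \<comment> \<open>The asymptotic bound holds only from \<open>N0\<close> on; finitely many cruder
    values do not disturb summability.\<close>
  define W where "W n = (if n \<ge> N0 then w n else b n)" for n
  have "summable W"
  proof (rule summable_cong[THEN iffD2, OF _ sw])
    show "\<forall>\<^sub>F n in sequentially. W n = w n"
      unfolding eventually_sequentially W_def by (intro exI[of _ N0]) auto
  qed
  moreover have "norm (T n x t + of_real (\<kappa> / pi * (sine_term n (x + t) + sine_term n (x - t)))) \<le> W n"
    if "x \<in> {0..pi}" "t \<in> {0..pi}" for n x t
    using big[OF _ that, of n] b[OF that, of n] by (simp add: W_def)
  ultimately show thesis using that[of W "\<kappa> / pi"] by blast
qed

lemma sine_term_sums:
  assumes "\<bar>y\<bar> \<le> 2 * pi"
  shows "summable (\<lambda>n. sine_term n y)" "\<bar>\<Sum>n<N. sine_term n y\<bar> \<le> 2 * pi * (1 + pi)"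
proof -
  show "summable (\<lambda>n. sine_term n y)"
    unfolding sine_term_def by (intro summable_mult summable_sin_series assms)
  have "\<bar>y\<bar> * \<bar>\<Sum>n<N. sin (real n * y) / real n\<bar> \<le> 2 * pi * (1 + pi)"
    using assms sin_series_partial_bound[OF assms, of N] by (intro mult_mono) auto
  then show "\<bar>\<Sum>n<N. sine_term n y\<bar> \<le> 2 * pi * (1 + pi)"
    unfolding sine_term_def sum_distrib_left[symmetric] abs_mult .
qed

text \<open>Bounded pointwise convergence is the form that dominated convergence requires.
  Uniformity cannot be expected: unless its coefficient vanishes, the sine series in x + t makes the
  sum jump at x = t = pi.\<close>

lemma T_series:
  obtains B where "\<And>N x t. x \<in> {0..pi} \<Longrightarrow> t \<in> {0..pi} \<Longrightarrow> norm (\<Sum>n\<le>N. T n x t) \<le> B"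
    and "\<And>x t. x \<in> {0..pi} \<Longrightarrow> t \<in> {0..pi} \<Longrightarrow> (\<lambda>N. \<Sum>n\<le>N. T n x t) \<longlonglongrightarrow> kernel_F c lam x t"
proof -
  obtain \<kappa> W where W: "summable W"
    "\<And>n x t. x \<in> {0..pi} \<Longrightarrow> t \<in> {0..pi} \<Longrightarrow>
       norm (T n x t + of_real (\<kappa> * (sine_term n (x + t) + sine_term n (x - t)))) \<le> W n"
    by (rule T_expansion) (rule that; assumption)
  define R where "R n x t = T n x t + of_real (\<kappa> * (sine_term n (x + t) + sine_term n (x - t)))" for n x t
  have R: "norm (R n x t) \<le> W n" if "x \<in> {0..pi}" "t \<in> {0..pi}" for n x t unfolding R_def by (rule W(2)[OF that])
  have W0: "W n \<ge> 0" for n using order_trans[OF norm_ge_zero R[of 0 0 n]] by simp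
  have T: "T n x t = R n x t - of_real (\<kappa> * (sine_term n (x + t) + sine_term n (x - t)))" for n x t
    by (simp add: R_def)
  have xt: "\<bar>x - t\<bar> \<le> 2 * pi" "\<bar>x + t\<bar> \<le> 2 * pi" if "x \<in> {0..pi}" "t \<in> {0..pi}" for x t using that by auto
  define B where "B = suminf W + \<bar>\<kappa>\<bar> * (2 * pi * (1 + pi) + 2 * pi * (1 + pi))"
  have bound: "norm (\<Sum>n\<le>N. T n x t) \<le> B" if x: "x \<in> {0..pi}" and t: "t \<in> {0..pi}" for N x t
  proof -
    have "(\<Sum>n\<le>N. T n x t) = (\<Sum>n\<le>N. R n x t) - of_real (\<kappa> * ((\<Sum>n<Suc N. sine_term n (x + t)) + (\<Sum>n<Suc N. sine_term n (x - t))))"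
      unfolding T sum_subtractf lessThan_Suc_atMost by (simp add: sum.distrib sum_distrib_left[symmetric])
    also have "norm \<dots> \<le> suminf W + \<bar>\<kappa>\<bar> * (2 * pi * (1 + pi) + 2 * pi * (1 + pi))"
    proof (intro order_trans[OF norm_triangle_ineq4] add_mono)
      have "norm (\<Sum>n\<le>N. R n x t) \<le> (\<Sum>n\<le>N. W n)" by (rule sum_norm_le) (rule R[OF x t])
      also have "\<dots> \<le> suminf W" by (rule sum_le_suminf[OF W(1)]) (auto simp: W0)
      finally show "norm (\<Sum>n\<le>N. R n x t) \<le> suminf W" .
      have "\<bar>(\<Sum>n<Suc N. sine_term n (x + t)) + (\<Sum>n<Suc N. sine_term n (x - t))\<bar> \<le> 2 * pi * (1 + pi) + 2 * pi * (1 + pi)"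
        by (intro order_trans[OF abs_triangle_ineq] add_mono sine_term_sums(2) xt x t)
      then show "norm (complex_of_real (\<kappa> * ((\<Sum>n<Suc N. sine_term n (x + t)) + (\<Sum>n<Suc N. sine_term n (x - t))))) \<le> \<bar>\<kappa>\<bar> * (2 * pi * (1 + pi) + 2 * pi * (1 + pi))"
        unfolding norm_of_real abs_mult by (intro mult_left_mono) auto
    qed
    finally show ?thesis unfolding B_def .
  qed
  have conv: "(\<lambda>N. \<Sum>n\<le>N. T n x t) \<longlonglongrightarrow> kernel_F c lam x t" if x: "x \<in> {0..pi}" and t: "t \<in> {0..pi}" for x t
  proof -
    have "summable (\<lambda>n. R n x t)" by (rule summable_comparison_test'[OF W(1)]) (rule R[OF x t])
    moreover have "summable (\<lambda>n. complex_of_real (\<kappa> * (sine_term n (x + t) + sine_term n (x - t))))"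
      by (intro summable_of_real summable_mult summable_add sine_term_sums(1) xt x t)
    ultimately have "summable (\<lambda>n. T n x t)" unfolding T by (rule summable_diff)
    then have "(\<lambda>n. T n x t) sums kernel_F c lam x t" unfolding kernel_F_eq by (rule summable_sums)
    then show ?thesis by (simp add: sums_def_le)
  qed
  show thesis using that bound conv by blast
qed

end

lemma volterra_add_scaled:
  assumes A: "continuous_kernel A" and u: "continuous_on {0..pi} u" and v: "continuous_on {0..pi} v"
    and x: "x \<in> {0..pi}"
  shows "volterra A (\<lambda>s. a * u s - b * v s) x = a * volterra A u x - b * volterra A v x"
proof -
  have i: "(\<lambda>s. A x s * w s) integrable_on {0..x}" if "continuous_on {0..pi} w" for w
    using x by (intro integrable_continuous_interval continuous_intros continuous_kernel_compose[OF A]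
        continuous_on_subset[OF that]) auto
  have "integral {0..x} (\<lambda>s. A x s * (a * u s - b * v s)) = integral {0..x} (\<lambda>s. a * (A x s * u s) - b * (A x s * v s))"
    by (simp add: algebra_simps)
  also have "\<dots> = integral {0..x} (\<lambda>s. a * (A x s * u s)) - integral {0..x} (\<lambda>s. b * (A x s * v s))"
    by (intro integral_diff integrable_on_mult_right i u v)
  finally show ?thesis by (simp add: volterra_def algebra_simps)
qed

section \<open>The limit for a fixed continuous function f\<close>

context sturm_liouville
begin

context
  fixes f :: "real \<Rightarrow> complex"
  assumes f: "continuous_on {0..pi} f"
begin

definition a :: "nat \<Rightarrow> complex" where
  "a n = integral {0..pi} (\<lambda>t. f t * cos (of_nat n * of_real t))"

definition b :: "nat \<Rightarrow> complex" where
  "b n = integral {0..pi} (\<lambda>t. f t * cos (r n * of_real t))"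

text \<open>The integral of \<open>f t * T n x t\<close> over t, written with the coefficients
  \<open>a\<close> and \<open>b\<close>.\<close>

definition \<tau> :: "nat \<Rightarrow> real \<Rightarrow> complex" where
  "\<tau> n x = cos (r n * of_real x) * (b n / alpha c lam n) - cos (of_nat n * of_real x) * (a n / alpha0 n)"

lemma continuous_on_\<tau>: "continuous_on {0..pi} (\<tau> n)"
  unfolding \<tau>_def by (intro continuous_intros)

lemma f_bounded: obtains F where "F > 0" "\<And>t. t \<in> {0..pi} \<Longrightarrow> norm (f t) \<le> F"
proof -
  have "bounded (f ` {0..pi})" using compact_continuous_image[OF f] compact_imp_bounded by blast
  then obtain F where "F > 0" "\<forall>t\<in>f ` {0..pi}. norm t \<le> F" unfolding bounded_pos by blast
  then show thesis using that by blast
qed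

lemma summable_a: "summable (\<lambda>n. (norm (a n))\<^sup>2)"
  unfolding a_def cos_nat_of_real
  by (rule summable_complex_coeff_square[OF f _ summable_cos_coeff_square]) (auto intro!: continuous_intros)

lemma summable_sine_coeff: "summable (\<lambda>n. (norm (integral {0..pi} (\<lambda>t. f t * of_real t * complex_of_real (sin (real n * t)))))\<^sup>2)"
  by (rule summable_complex_coeff_square[OF _ _ summable_sin_coeff_square]) (auto intro!: continuous_intros f)

text \<open>After integration against \<open>f\<close> the conditionally convergent sine terms turn
  into \<open>a n\<close> and the sine coefficients of t f(t), divided by n. Both are square
  summable by Bessel's inequality, hence summable after the division, so the Weierstrass test
  applies although the series of F itself is not absolutely controlled.\<close>

lemma \<tau>_bound:
  obtains M where "summable M" "\<And>n x. x \<in> {0..pi} \<Longrightarrow> norm (\<tau> n x) \<le> M n"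
proof -
  obtain C N0 where N0: "N0 \<ge> 1" "C > 0"
    "\<And>n. n \<ge> N0 \<Longrightarrow> r n = of_real (s n) \<and> s n \<ge> real n / 2 \<and> \<bar>s n - real n\<bar> \<le> 1 / 2 \<and> \<bar>s n - real n\<bar> \<le> C / real n"
    by (rule s_minus_nat_bound) (rule that; assumption)
  obtain F where F: "F > 0" "\<And>t. t \<in> {0..pi} \<Longrightarrow> norm (f t) \<le> F" by (rule f_bounded) (rule that; assumption)
  define d where "d n = integral {0..pi} (\<lambda>t. f t * of_real t * complex_of_real (sin (real n * t)))" for n
  define A where "A n = norm (1 / alpha c lam n - of_real (2 / pi))" for n
  have sA: "summable A" unfolding A_def by (rule inverse_alpha_asymptotics)
  define L where "L = suminf A + 1"
  have L: "norm (1 / alpha c lam n) \<le> L" for n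
  proof -
    have "A n \<le> suminf A" using sum_le_suminf[OF sA, of "{n}"] by (simp add: A_def)
    moreover have "norm (1 / alpha c lam n) \<le> A n + norm (complex_of_real (2 / pi))"
      unfolding A_def by (metis norm_triangle_sub add.commute)
    moreover have "norm (complex_of_real (2 / pi)) \<le> 1" using pi_gt3 unfolding norm_of_real by simp
    ultimately show ?thesis unfolding L_def by linarith
  qed
  have L0: "L \<ge> 0" using L[of 0] norm_ge_zero order_trans by blast
  define m where "m n = F * pi * A n + 2 * C * (norm (a n) / real n) + L * (C * (norm (d n) / real n) + 8 * pi ^ 3 * F * (C\<^sup>2 / (real n)\<^sup>2))" for n
  have sm: "summable m"
  proof -
    have "summable (\<lambda>n. norm (a n) / real n)" "summable (\<lambda>n. norm (d n) / real n)"
      using summable_coeff_over_n[OF summable_a] summable_coeff_over_n[OF summable_sine_coeff] by (simp_all add: d_def)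
    then show ?thesis unfolding m_def
      by (intro summable_add summable_mult summable_const_over_n2 sA)
  qed
  have big: "norm (\<tau> n x) \<le> m n" if n: "n \<ge> N0" and x: "x \<in> {0..pi}" for n x
  proof -
    let ?z = "s n"
    define e where "e = ?z - real n"
    have n1: "n \<noteq> 0" and rn: "r n = of_real ?z" and e: "\<bar>e\<bar> \<le> C / real n" using N0(3)[OF n] n N0(1) by (auto simp: e_def)
    have e2: "e\<^sup>2 \<le> C\<^sup>2 / (real n)\<^sup>2" using power_mono[OF e, of 2] by (simp add: power_divide)
    have cr: "cos (r n * of_real y) = of_real (cos (?z * y))" for y by (rule cos_r_mult[OF rn])
    have a0: "1 / alpha0 n = of_real (2 / pi)" using n1 by (simp add: alpha0_def)
    have i: "g integrable_on {0..pi}" if "continuous_on {0..pi} g" for g :: "real \<Rightarrow> complex"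
      using that by (rule integrable_continuous_interval)
    have an: "norm (a n) \<le> F * (pi - 0)"
      unfolding a_def cos_nat_of_real
    proof (rule integral_bound)
      show "norm (f t * complex_of_real (cos (real n * t))) \<le> F" if "t \<in> {0..pi}" for t
        unfolding norm_mult norm_of_real using mult_mono[OF F(2)[OF that] abs_cos_le_one[of "real n * t"]] F(1) by simp
    qed (auto intro!: continuous_intros f)
    have "b n - a n + of_real e * d n = integral {0..pi} (\<lambda>t. f t * of_real (cos (?z * t) - cos (real n * t) + (e * real n) * (t * (sin (real n * t) / real n))))"
    proof -
      have "integral {0..pi} (\<lambda>t. f t * of_real (cos (?z * t) - cos (real n * t) + (e * real n) * (t * (sin (real n * t) / real n))))
         = integral {0..pi} (\<lambda>t. (f t * of_real (cos (?z * t)) - f t * of_real (cos (real n * t))) + of_real e * (f t * of_real t * complex_of_real (sin (real n * t))))"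
        by (rule integral_cong) (use n1 in \<open>simp add: algebra_simps\<close>)
      also have "\<dots> = integral {0..pi} (\<lambda>t. f t * of_real (cos (?z * t)) - f t * of_real (cos (real n * t)))
          + integral {0..pi} (\<lambda>t. of_real e * (f t * of_real t * complex_of_real (sin (real n * t))))"
        by (intro integral_add i continuous_intros f)
      also have "integral {0..pi} (\<lambda>t. f t * complex_of_real (cos (?z * t)) - f t * of_real (cos (real n * t))) = b n - a n"
        unfolding a_def b_def cr cos_nat_of_real by (intro integral_diff i continuous_intros f)
      finally show ?thesis by (simp add: d_def)
    qed
    also have "norm \<dots> \<le> (F * (2 * (2 * pi)\<^sup>2 * e\<^sup>2)) * (pi - 0)"
    proof (rule integral_bound)
      show "norm (f t * of_real (cos (?z * t) - cos (real n * t) + (e * real n) * (t * (sin (real n * t) / real n)))) \<le> F * (2 * (2 * pi)\<^sup>2 * e\<^sup>2)"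
        if t: "t \<in> {0..pi}" for t
      proof -
        have "\<bar>t\<bar> \<le> 2 * pi" using t by auto
        \<comment> \<open>The exact shift is used in place of the asymptotic constant, so that only
          the quadratic error remains.\<close>
        from cos_shift_expansion[OF this, of ?z n "e * real n"]
        have "\<bar>cos (?z * t) - cos (real n * t) + (e * real n) * (t * (sin (real n * t) / real n))\<bar> \<le> 2 * (2 * pi)\<^sup>2 * e\<^sup>2"
          using n1 by (simp add: e_def)
        then show ?thesis unfolding norm_mult[of "f t"] norm_of_real using F t by (intro mult_mono) auto
      qed
    qed (use n1 in \<open>auto intro!: continuous_intros f\<close>)
    finally have 1: "norm (b n - a n + of_real e * d n) \<le> 8 * pi ^ 3 * F * e\<^sup>2"
      by (simp add: power2_eq_square power3_eq_cube mult_ac)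
    have 2: "norm (b n - a n) \<le> C * (norm (d n) / real n) + 8 * pi ^ 3 * F * (C\<^sup>2 / (real n)\<^sup>2)"
    proof -
      have "norm (b n - a n) \<le> norm (of_real e * d n) + norm (b n - a n + of_real e * d n)"
        by (metis add_diff_cancel_right' add.commute norm_triangle_ineq4)
      also have "norm (of_real e * d n) \<le> C / real n * norm (d n)"
        unfolding norm_mult norm_of_real using e by (intro mult_right_mono) auto
      also have "norm (b n - a n + of_real e * d n) \<le> 8 * pi ^ 3 * F * (C\<^sup>2 / (real n)\<^sup>2)"
        by (rule order_trans[OF 1]) (intro mult_left_mono e2, use F(1) in simp)
      finally show ?thesis by simp
    qed
    have 3: "norm (complex_of_real (cos (?z * x)) * (1 / alpha c lam n) - of_real (cos (real n * x)) * (1 / alpha0 n)) \<le> A n + 2 * (C / real n)"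
    proof -
      have "complex_of_real (cos (?z * x)) * (1 / alpha c lam n) - of_real (cos (real n * x)) * (1 / alpha0 n)
         = of_real (cos (?z * x)) * (1 / alpha c lam n - of_real (2 / pi)) + of_real (2 / pi * (cos (?z * x) - cos (real n * x)))"
        unfolding a0 by (simp add: algebra_simps)
      also have "norm \<dots> \<le> 1 * A n + 2 / pi * (C / real n * pi)"
      proof (intro norm_triangle_mono)
        show "norm (complex_of_real (cos (?z * x)) * (1 / alpha c lam n - of_real (2 / pi))) \<le> 1 * A n"
          unfolding norm_mult[of "of_real (cos _)"] A_def norm_of_real by (intro mult_right_mono) auto
        have "\<bar>cos (?z * x) - cos (real n * x)\<bar> \<le> \<bar>?z * x - real n * x\<bar>" by (rule abs_cos_diff_le)
        also have "\<dots> = \<bar>e\<bar> * \<bar>x\<bar>" by (simp add: e_def abs_mult flip: left_diff_distrib)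
        also have "\<dots> \<le> C / real n * pi" using e x by (intro mult_mono) auto
        finally have "2 / pi * \<bar>cos (?z * x) - cos (real n * x)\<bar> \<le> 2 / pi * (C / real n * pi)" by (intro mult_left_mono) auto
        then show "norm (complex_of_real (2 / pi * (cos (?z * x) - cos (real n * x)))) \<le> 2 / pi * (C / real n * pi)"
          unfolding norm_of_real abs_mult by simp
      qed
      finally show ?thesis by simp
    qed
    have "\<tau> n x = (complex_of_real (cos (?z * x)) * (1 / alpha c lam n) - of_real (cos (real n * x)) * (1 / alpha0 n)) * a n
        + complex_of_real (cos (?z * x)) * (1 / alpha c lam n) * (b n - a n)"
      unfolding \<tau>_def cr cos_nat_of_real by (simp add: algebra_simps diff_divide_distrib)
    also have "norm \<dots> \<le> (A n * (F * pi) + 2 * (C / real n) * norm (a n)) + L * (C * (norm (d n) / real n) + 8 * pi ^ 3 * F * (C\<^sup>2 / (real n)\<^sup>2))"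
    proof (intro norm_triangle_mono)
      have "norm ((complex_of_real (cos (?z * x)) * (1 / alpha c lam n) - of_real (cos (real n * x)) * (1 / alpha0 n)) * a n) \<le> (A n + 2 * (C / real n)) * norm (a n)"
        unfolding norm_mult[of "_ - _"] using 3 by (intro mult_right_mono) auto
      also have "\<dots> \<le> A n * (F * pi) + 2 * (C / real n) * norm (a n)"
        unfolding distrib_right using an N0(2) by (intro add_mono mult_left_mono) (auto simp: A_def)
      finally show "norm ((complex_of_real (cos (?z * x)) * (1 / alpha c lam n) - of_real (cos (real n * x)) * (1 / alpha0 n)) * a n) \<le> A n * (F * pi) + 2 * (C / real n) * norm (a n)" .
      have "norm (complex_of_real (cos (?z * x)) * (1 / alpha c lam n)) \<le> 1 * L"
        unfolding norm_mult[of "of_real (cos _)"] norm_of_real using L by (intro mult_mono) auto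
      then show "norm (complex_of_real (cos (?z * x)) * (1 / alpha c lam n) * (b n - a n)) \<le> L * (C * (norm (d n) / real n) + 8 * pi ^ 3 * F * (C\<^sup>2 / (real n)\<^sup>2))"
        unfolding norm_mult[of "_ * _" "b n - a n"] using 2 L0 by (intro mult_mono) auto
    qed
    also have "\<dots> = m n" by (simp add: m_def)
    finally show ?thesis .
  qed
  have small: "\<exists>B. \<forall>x\<in>{0..pi}. norm (\<tau> n x) \<le> B" for n
  proof -
    have "bounded (\<tau> n ` {0..pi})"
      using compact_continuous_image[OF continuous_on_\<tau>] compact_imp_bounded by blast
    then show ?thesis by (auto simp: bounded_iff)
  qed
  then obtain k where k: "\<And>n x. x \<in> {0..pi} \<Longrightarrow> norm (\<tau> n x) \<le> k n" by metis
  define M where "M n = (if n \<ge> N0 then m n else k n)" for n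
  have "summable M"
  proof (rule summable_cong[THEN iffD2, OF _ sm])
    show "\<forall>\<^sub>F n in sequentially. M n = m n"
      unfolding eventually_sequentially M_def by (intro exI[of _ N0]) auto
  qed
  moreover have "norm (\<tau> n x) \<le> M n" if "x \<in> {0..pi}" for n x
    using big[OF _ that, of n] k[OF that, of n] by (simp add: M_def)
  ultimately show thesis using that by blast
qed

definition \<phi> :: "real \<Rightarrow> complex" where "\<phi> x = (\<Sum>n. \<tau> n x)"

lemma uniform_limit_\<phi>: "uniform_limit {0..pi} (\<lambda>N x. \<Sum>n\<le>N. \<tau> n x) \<phi> sequentially"
proof -
  obtain M where M: "summable M" "\<And>n x. x \<in> {0..pi} \<Longrightarrow> norm (\<tau> n x) \<le> M n"
    by (rule \<tau>_bound) (rule that; assumption)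
  have "uniform_limit {0..pi} (\<lambda>N x. \<Sum>n<N. \<tau> n x) \<phi> sequentially"
    unfolding \<phi>_def[abs_def] by (rule Weierstrass_m_test[OF M(2) M(1)])
  from filterlim_compose[OF this filterlim_Suc] show ?thesis
    unfolding lessThan_Suc_atMost .
qed

lemma continuous_on_\<phi>: "continuous_on {0..pi} \<phi>"
  by (rule uniform_limit_theorem[OF always_eventually uniform_limit_\<phi>]) (auto intro!: continuous_intros continuous_on_\<tau>)

definition P :: "nat \<Rightarrow> real \<Rightarrow> complex" where
  "P N x = (\<Sum>n\<le>N. c (of_nat n) x * (a n / alpha0 n) - c (r n) x * (b n / alpha c lam n))"

lemma integral_partial_I: "integral {0..pi} (\<lambda>t. f t * partial_I c lam N x t) = P N x"
proof -
  have i: "g integrable_on {0..pi}" if "continuous_on {0..pi} g" for g :: "real \<Rightarrow> complex"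
    using that by (rule integrable_continuous_interval)
  have "integral {0..pi} (\<lambda>t. f t * partial_I c lam N x t)
     = integral {0..pi} (\<lambda>t. \<Sum>n\<le>N. (c (of_nat n) x / alpha0 n) * (f t * cos (of_nat n * of_real t))
         - (c (r n) x / alpha c lam n) * (f t * cos (r n * of_real t)))"
    unfolding partial_I_def by (rule integral_cong) (simp add: sum_distrib_left right_diff_distrib mult_ac)
  also have "\<dots> = (\<Sum>n\<le>N. integral {0..pi} (\<lambda>t. (c (of_nat n) x / alpha0 n) * (f t * cos (of_nat n * of_real t))
         - (c (r n) x / alpha c lam n) * (f t * cos (r n * of_real t))))"
    by (intro integral_sum i continuous_intros f finite_atMost)
  also have "\<dots> = (\<Sum>n\<le>N. integral {0..pi} (\<lambda>t. (c (of_nat n) x / alpha0 n) * (f t * cos (of_nat n * of_real t)))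
         - integral {0..pi} (\<lambda>t. (c (r n) x / alpha c lam n) * (f t * cos (r n * of_real t))))"
    by (intro sum.cong refl integral_diff i continuous_intros f)
  finally show ?thesis by (simp add: P_def a_def b_def)
qed

lemma volterra_T:
  assumes x: "x \<in> {0..pi}"
  shows "volterra G (\<lambda>s. \<Sum>n\<le>N. T n s t) x = - partial_I c lam N x t"
proof -
  have "volterra G (\<lambda>s. \<Sum>n\<le>N. 1 * T n s t) x = (\<Sum>n\<le>N. 1 * volterra G (\<lambda>s. T n s t) x)"
    by (rule volterra_sum[OF G _ _ x]) (auto simp: T_def intro!: continuous_intros simp: alpha0_def)
  moreover have "volterra G (\<lambda>s. T n s t) x = c (r n) x * cos (r n * of_real t) / alpha c lam n
       - c (of_nat n) x * cos (of_nat n * of_real t) / alpha0 n" for n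
  proof -
    have "volterra G (\<lambda>s. (cos (r n * of_real t) / alpha c lam n) * cos (r n * of_real s)
          - (cos (of_nat n * of_real t) / alpha0 n) * cos (of_nat n * of_real s)) x
       = (cos (r n * of_real t) / alpha c lam n) * volterra G (\<lambda>s. cos (r n * of_real s)) x
         - (cos (of_nat n * of_real t) / alpha0 n) * volterra G (\<lambda>s. cos (of_nat n * of_real s)) x"
      by (rule volterra_add_scaled[OF G _ _ x]) (intro continuous_intros)+
    then show ?thesis unfolding TG[OF x] by (simp add: T_def mult_ac)
  qed
  ultimately show ?thesis by (simp add: partial_I_def sum_negf[symmetric])
qed

lemma volterra_\<tau>:
  assumes x: "x \<in> {0..pi}"
  shows "volterra G (\<lambda>s. \<Sum>n\<le>N. \<tau> n s) x = - P N x"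
proof -
  have "volterra G (\<lambda>s. \<Sum>n\<le>N. 1 * \<tau> n s) x = (\<Sum>n\<le>N. 1 * volterra G (\<tau> n) x)"
    by (rule volterra_sum[OF G _ _ x]) (auto intro: continuous_on_\<tau>)
  moreover have "volterra G (\<tau> n) x = c (r n) x * (b n / alpha c lam n) - c (of_nat n) x * (a n / alpha0 n)" for n
  proof -
    have "volterra G (\<lambda>s. (b n / alpha c lam n) * cos (r n * of_real s) - (a n / alpha0 n) * cos (of_nat n * of_real s)) x
       = (b n / alpha c lam n) * volterra G (\<lambda>s. cos (r n * of_real s)) x
         - (a n / alpha0 n) * volterra G (\<lambda>s. cos (of_nat n * of_real s)) x"
      by (rule volterra_add_scaled[OF G _ _ x]) (intro continuous_intros)+
    then show ?thesis unfolding TG[OF x] by (simp add: \<tau>_def[abs_def] mult_ac)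
  qed
  ultimately show ?thesis by (simp add: P_def sum_negf[symmetric])
qed

definition W :: "real \<Rightarrow> complex" where "W x = - volterra G \<phi> x"

lemma continuous_on_W: "continuous_on {0..pi} W"
  unfolding W_def by (intro continuous_intros continuous_on_volterra[OF G continuous_on_\<phi>])

lemma uniform_limit_P: "uniform_limit {0..pi} P W sequentially"
proof -
  have "uniform_limit {0..pi} (\<lambda>N. volterra G (\<lambda>s. \<Sum>n\<le>N. \<tau> n s)) (volterra G \<phi>) sequentially"
    by (rule uniform_limit_volterra[OF G uniform_limit_\<phi>]) (auto intro!: continuous_intros continuous_on_\<tau> continuous_on_\<phi>)
  from uniform_limit_uminus[OF this]
  show ?thesis
    unfolding W_def[abs_def] by (rule uniform_limit_cong'[THEN iffD1, rotated -1]) (simp_all add: volterra_\<tau>)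
qed

text \<open>\<open>kernel_F\<close> enters only as a bounded pointwise limit of the partial sums.
  Dominated convergence is used twice, in s inside the Volterra integral and then in t, and the
  result is compared with the uniform limit \<open>W\<close>.\<close>

lemma W_eq_kernel_F:
  assumes x: "x \<in> {0..pi}"
  shows "W x = - integral {0..pi} (\<lambda>t. f t * (kernel_F c lam x t + integral {0..x} (\<lambda>s. G x s * kernel_F c lam s t)))"
proof -
  obtain B where B: "\<And>N x t. x \<in> {0..pi} \<Longrightarrow> t \<in> {0..pi} \<Longrightarrow> norm (\<Sum>n\<le>N. T n x t) \<le> B"
    and lim: "\<And>x t. x \<in> {0..pi} \<Longrightarrow> t \<in> {0..pi} \<Longrightarrow> (\<lambda>N. \<Sum>n\<le>N. T n x t) \<longlonglongrightarrow> kernel_F c lam x t"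
    by (rule T_series) (rule that; assumption)
  obtain M where M: "M > 0" "\<And>x t. 0 \<le> t \<Longrightarrow> t \<le> x \<Longrightarrow> x \<le> pi \<Longrightarrow> norm (G x t) \<le> M"
    using continuous_kernel_bounded[OF G] by metis
  obtain F where F: "F > 0" "\<And>t. t \<in> {0..pi} \<Longrightarrow> norm (f t) \<le> F" by (rule f_bounded) (rule that; assumption)
  have B0: "B \<ge> 0" using order_trans[OF norm_ge_zero B[of 0 0 0]] by simp
  have cT: "continuous_on {0..x} (\<lambda>s. G x s * (\<Sum>n\<le>N. T n s t))" for N t
    unfolding T_def using x
    by (intro continuous_intros continuous_kernel_compose[OF G]) (auto simp: alpha0_def)
  have GB: "norm (G x s * (\<Sum>n\<le>N. T n s t)) \<le> M * B" if "s \<in> {0..x}" "t \<in> {0..pi}" for s t N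
    unfolding norm_mult using that x M B by (intro mult_mono) auto
  have pI: "partial_I c lam N x t = - ((\<Sum>n\<le>N. T n x t) + integral {0..x} (\<lambda>s. G x s * (\<Sum>n\<le>N. T n s t)))" for N t
    using volterra_T[OF x, where N=N and t=t] unfolding volterra_def by (simp only: minus_minus)
  have in1: "(\<lambda>N. integral {0..x} (\<lambda>s. G x s * (\<Sum>n\<le>N. T n s t))) \<longlonglongrightarrow> integral {0..x} (\<lambda>s. G x s * kernel_F c lam s t)"
    if t: "t \<in> {0..pi}" for t
  proof (rule dominated_convergence(2))
    show "(\<lambda>s. G x s * (\<Sum>n\<le>N. T n s t)) integrable_on {0..x}" for N by (rule integrable_continuous_interval[OF cT])
    show "(\<lambda>s. M * B) integrable_on {0..x}" by (rule integrable_const_ivl)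
    show "norm (G x s * (\<Sum>n\<le>N. T n s t)) \<le> M * B" if "s \<in> {0..x}" for s N by (rule GB[OF that t])
    show "(\<lambda>N. G x s * (\<Sum>n\<le>N. T n s t)) \<longlonglongrightarrow> G x s * kernel_F c lam s t" if "s \<in> {0..x}" for s
      by (intro tendsto_intros lim) (use that t x in auto)
  qed
  have lim_pI: "(\<lambda>N. partial_I c lam N x t) \<longlonglongrightarrow> - (kernel_F c lam x t + integral {0..x} (\<lambda>s. G x s * kernel_F c lam s t))"
    if "t \<in> {0..pi}" for t
    unfolding pI by (intro tendsto_intros lim in1 x that)
  have bound_pI: "norm (partial_I c lam N x t) \<le> B + (M * B) * (x - 0)" if t: "t \<in> {0..pi}" for N t
    unfolding pI norm_minus_cancel
    by (intro norm_triangle_mono B x t integral_bound cT GB) (use x in auto)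
  have cpI: "continuous_on {0..pi} (\<lambda>t. partial_I c lam N x t)" for N
    unfolding partial_I_def by (intro continuous_intros) (auto simp: alpha0_def)
  have "(\<lambda>N. integral {0..pi} (\<lambda>t. f t * partial_I c lam N x t)) \<longlonglongrightarrow>
     integral {0..pi} (\<lambda>t. f t * - (kernel_F c lam x t + integral {0..x} (\<lambda>s. G x s * kernel_F c lam s t)))"
  proof (rule dominated_convergence(2))
    show "(\<lambda>t. f t * partial_I c lam N x t) integrable_on {0..pi}" for N
      by (intro integrable_continuous_interval continuous_intros f cpI)
    show "(\<lambda>t. F * (B + (M * B) * (x - 0))) integrable_on {0..pi}" by (rule integrable_const_ivl)
    show "norm (f t * partial_I c lam N x t) \<le> F * (B + (M * B) * (x - 0))" if "t \<in> {0..pi}" for t N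
      unfolding norm_mult using F(1) by (intro mult_mono F bound_pI that) auto
    show "(\<lambda>N. f t * partial_I c lam N x t) \<longlonglongrightarrow> f t * - (kernel_F c lam x t + integral {0..x} (\<lambda>s. G x s * kernel_F c lam s t))"
      if "t \<in> {0..pi}" for t
      by (intro tendsto_mult tendsto_const lim_pI that)
  qed
  then have "(\<lambda>N. P N x) \<longlonglongrightarrow> - integral {0..pi} (\<lambda>t. f t * (kernel_F c lam x t + integral {0..x} (\<lambda>s. G x s * kernel_F c lam s t)))"
    unfolding integral_partial_I by (simp only: mult_minus_right integral_neg)
  moreover have "(\<lambda>N. P N x) \<longlonglongrightarrow> W x" by (rule tendsto_uniform_limitI[OF uniform_limit_P x])
  ultimately show ?thesis using LIMSEQ_unique by blast
qed

section \<open>Identification of the limit by completeness\<close>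

lemma continuous_kernel_K: "continuous_kernel K" using inv by (simp add: inverse_kernel_def)

definition g :: "real \<Rightarrow> complex" where "g = adjoint_volterra K f"

lemma continuous_on_g: "continuous_on {0..pi} g"
  unfolding g_def by (rule continuous_on_adjoint_volterra[OF continuous_kernel_K f])

text \<open>The inverse operator returns cos(rho_n x) from the eigenfunction; its transpose then
  acts on \<open>f\<close>.\<close>

lemma b_eq: "b n = integral {0..pi} (\<lambda>x. g x * c (r n) x)"
proof -
  have "cos (r n * of_real x) = volterra K (c (r n)) x" if x: "x \<in> {0..pi}" for x
  proof -
    have "continuous_on {0..pi} (\<lambda>s. cos (r n * complex_of_real s))" by (intro continuous_intros)
    then have "cos (r n * of_real x) = volterra K (volterra G (\<lambda>s. cos (r n * of_real s))) x"
      using inv x unfolding inverse_kernel_def by simp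
    also have "\<dots> = volterra K (c (r n)) x" by (rule volterra_cong[OF TG x])
    finally show ?thesis .
  qed
  then have "b n = integral {0..pi} (\<lambda>x. f x * volterra K (c (r n)) x)"
    unfolding b_def by (intro integral_cong) simp
  also have "\<dots> = integral {0..pi} (\<lambda>x. g x * c (r n) x)"
    unfolding g_def by (rule integral_mult_volterra[OF continuous_kernel_K f continuous_on_c])
  finally show ?thesis .
qed

lemma eigenfunctions_orthogonal:
  "integral {0..pi} (\<lambda>x. c (r n) x * c (r m) x) = (if n = m then alpha c lam m else 0)"
proof (cases "n = m")
  case True
  then show ?thesis by (simp add: alpha_def power2_eq_square)
next
  case False
  then have "lam n \<noteq> lam m" using lam_mono strict_mono_eq by blast
  then show ?thesis
    using Wronskian_char[OF char_fun_r[of m], of "r n"] False by simp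
qed

text \<open>Orthogonality collapses the part with the eigenfunctions to \<open>b m\<close>, as soon
  as index \<open>m\<close> occurs in the sum. The other part is a partial sum of Parseval's formula
  for \<open>f\<close> and the transposed operator applied to the eigenfunction.\<close>

lemma integral_P_eigenfunction:
  assumes "m \<le> N"
  shows "integral {0..pi} (\<lambda>x. P N x * c (r m) x)
     = (\<Sum>n\<le>N. a n * integral {0..pi} (\<lambda>t. adjoint_volterra G (c (r m)) t * cos (of_nat n * of_real t)) / alpha0 n) - b m"
proof -
  have i: "g integrable_on {0..pi}" if "continuous_on {0..pi} g" for g :: "real \<Rightarrow> complex"
    using that by (rule integrable_continuous_interval)
  have "integral {0..pi} (\<lambda>x. P N x * c (r m) x)
     = integral {0..pi} (\<lambda>x. \<Sum>n\<le>N. (a n / alpha0 n) * (c (r m) x * c (of_nat n) x) - (b n / alpha c lam n) * (c (r n) x * c (r m) x))"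
    unfolding P_def sum_distrib_right
    by (intro integral_cong sum.cong refl) (simp add: algebra_simps)
  also have "\<dots> = (\<Sum>n\<le>N. integral {0..pi} (\<lambda>x. (a n / alpha0 n) * (c (r m) x * c (of_nat n) x) - (b n / alpha c lam n) * (c (r n) x * c (r m) x)))"
    by (intro integral_sum i continuous_intros finite_atMost)
  also have "\<dots> = (\<Sum>n\<le>N. integral {0..pi} (\<lambda>x. (a n / alpha0 n) * (c (r m) x * c (of_nat n) x)) - integral {0..pi} (\<lambda>x. (b n / alpha c lam n) * (c (r n) x * c (r m) x)))"
    by (intro sum.cong refl integral_diff i continuous_intros)
  also have "\<dots> = (\<Sum>n\<le>N. a n * integral {0..pi} (\<lambda>t. adjoint_volterra G (c (r m)) t * cos (of_nat n * of_real t)) / alpha0 n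
       - (if n = m then b m else 0))"
  proof (intro sum.cong refl)
    fix n
    have "integral {0..pi} (\<lambda>x. c (r m) x * c (of_nat n) x) = integral {0..pi} (\<lambda>t. adjoint_volterra G (c (r m)) t * cos (of_nat n * of_real t))"
      unfolding integral_mult_c[OF continuous_on_c] cos_transform_nat ..
    then show "integral {0..pi} (\<lambda>x. (a n / alpha0 n) * (c (r m) x * c (of_nat n) x)) - integral {0..pi} (\<lambda>x. (b n / alpha c lam n) * (c (r n) x * c (r m) x))
      = a n * integral {0..pi} (\<lambda>t. adjoint_volterra G (c (r m)) t * cos (of_nat n * of_real t)) / alpha0 n - (if n = m then b m else 0)"
      by (simp add: eigenfunctions_orthogonal)
  qed
  finally show ?thesis using assms by (simp add: sum_subtractf)
qed

text \<open>Parseval's formula gives the limit as a pairing of \<open>f\<close> with the transposed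
  operator, and transposing back puts \<open>volterra G\<close> on \<open>f\<close>. Uniform
  convergence allows the limit under the integral.\<close>

lemma integral_W_eigenfunction:
  "integral {0..pi} (\<lambda>x. W x * c (r m) x) = integral {0..pi} (\<lambda>x. volterra G f x * c (r m) x) - b m"
proof -
  have bdd: "bounded (u ` {0..pi})" if "continuous_on {0..pi} u" for u :: "real \<Rightarrow> complex"
    using compact_continuous_image[OF that] compact_imp_bounded by blast
  have "uniform_limit {0..pi} (\<lambda>N x. P N x * c (r m) x) (\<lambda>x. W x * c (r m) x) sequentially"
    by (intro uniform_lim_mult uniform_limit_P uniform_limit_const bdd continuous_on_W continuous_on_c)
  then obtain I J where IJ: "\<And>N. ((\<lambda>x. P N x * c (r m) x) has_integral I N) {0..pi}"
    "((\<lambda>x. W x * c (r m) x) has_integral J) {0..pi}" "I \<longlonglongrightarrow> J"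
  proof (rule uniform_limit_integral)
    show "continuous_on {0..pi} (\<lambda>x. P N x * c (r m) x)" for N
      unfolding P_def by (intro continuous_intros)
  qed auto
  have "(\<lambda>N. \<Sum>n\<le>N. a n * integral {0..pi} (\<lambda>t. adjoint_volterra G (c (r m)) t * cos (of_nat n * of_real t)) / alpha0 n)
     \<longlonglongrightarrow> integral {0..pi} (\<lambda>t. f t * adjoint_volterra G (c (r m)) t)"
    unfolding a_def by (rule Parseval[OF f continuous_on_adjoint_volterra[OF G continuous_on_c]])
  also have "integral {0..pi} (\<lambda>t. f t * adjoint_volterra G (c (r m)) t) = integral {0..pi} (\<lambda>x. volterra G f x * c (r m) x)"
    using integral_mult_volterra[OF G continuous_on_c[of "r m"] f] by (simp only: mult.commute)
  finally have "(\<lambda>N. (\<Sum>n\<le>N. a n * integral {0..pi} (\<lambda>t. adjoint_volterra G (c (r m)) t * cos (of_nat n * of_real t)) / alpha0 n) - b m)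
     \<longlonglongrightarrow> integral {0..pi} (\<lambda>x. volterra G f x * c (r m) x) - b m"
    by (intro tendsto_diff tendsto_const)
  then have "I \<longlonglongrightarrow> integral {0..pi} (\<lambda>x. volterra G f x * c (r m) x) - b m"
  proof (rule Lim_transform_eventually)
    show "\<forall>\<^sub>F N in sequentially. (\<Sum>n\<le>N. a n * integral {0..pi} (\<lambda>t. adjoint_volterra G (c (r m)) t * cos (of_nat n * of_real t)) / alpha0 n) - b m = I N"
      using eventually_ge_at_top[of m]
    proof eventually_elim
      case (elim N)
      show ?case using integral_P_eigenfunction[OF elim] integral_unique[OF IJ(1)] by (simp only:)
    qed
  qed
  then have "J = integral {0..pi} (\<lambda>x. volterra G f x * c (r m) x) - b m" by (rule LIMSEQ_unique[OF IJ(3)])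
  then show ?thesis using integral_unique[OF IJ(2)] by (simp only:)
qed

lemma W_eq:
  assumes x: "x \<in> {0..pi}"
  shows "W x = volterra G f x - g x"
proof -
  have cT: "continuous_on {0..pi} (volterra G f)" by (rule continuous_on_volterra[OF G f])
  have i: "(\<lambda>x. u x * c (r m) x) integrable_on {0..pi}" if "continuous_on {0..pi} u" for u m
    by (intro integrable_continuous_interval continuous_intros that)
  have "volterra G f x - W x - g x = 0"
  proof (rule eigenfunctions_complete[OF _ _ x])
    show "continuous_on {0..pi} (\<lambda>x. volterra G f x - W x - g x)"
      by (intro continuous_intros cT continuous_on_W continuous_on_g)
    fix m
    have "integral {0..pi} (\<lambda>x. (volterra G f x - W x - g x) * c (r m) x)
       = integral {0..pi} (\<lambda>x. volterra G f x * c (r m) x) - integral {0..pi} (\<lambda>x. W x * c (r m) x)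
         - integral {0..pi} (\<lambda>x. g x * c (r m) x)"
      unfolding left_diff_distrib
      by (simp add: integral_diff integrable_diff i cT continuous_on_W continuous_on_g)
    then show "integral {0..pi} (\<lambda>x. (volterra G f x - W x - g x) * c (r m) x) = 0"
      by (simp add: integral_W_eigenfunction b_eq)
  qed
  then show ?thesis by (simp add: algebra_simps)
qed

lemma integral_ext0:
  assumes x: "x \<in> {0..pi}"
  shows "integral {0..pi} (\<lambda>t. f t * (ext0 G x t - ext0 K t x)) = W x"
proof -
  have cG: "continuous_on {0..x} (\<lambda>t. G x t * f t)"
    using x by (intro continuous_intros continuous_kernel_compose[OF G] continuous_on_subset[OF f]) auto
  have cK: "continuous_on {x..pi} (\<lambda>t. K t x * f t)"
    using x by (intro continuous_intros continuous_kernel_compose[OF continuous_kernel_K] continuous_on_subset[OF f]) auto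
  have 1: "((\<lambda>t. if t \<in> {0..x} then G x t * f t else 0) has_integral integral {0..x} (\<lambda>t. G x t * f t)) {0..pi}"
    using x integrable_integral[OF integrable_continuous_interval[OF cG]] by (subst has_integral_restrict) auto
  have 2: "((\<lambda>t. if t \<in> {x..pi} then K t x * f t else 0) has_integral integral {x..pi} (\<lambda>t. K t x * f t)) {0..pi}"
    using x integrable_integral[OF integrable_continuous_interval[OF cK]] by (subst has_integral_restrict) auto
  have "((\<lambda>t. f t * (ext0 G x t - ext0 K t x)) has_integral
      integral {0..x} (\<lambda>t. G x t * f t) - integral {x..pi} (\<lambda>t. K t x * f t)) {0..pi}"
    by (rule has_integral_eq[OF _ has_integral_diff[OF 1 2]]) (auto simp: ext0_def algebra_simps)
  then show ?thesis
    unfolding W_eq[OF x] by (simp add: integral_unique volterra_def g_def adjoint_volterra_def)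
qed

theorem kernel_series:
  "uniform_limit {0..pi}
           (\<lambda>N x. integral {0..pi} (\<lambda>t. f t * partial_I c lam N x t))
           (\<lambda>x. integral {0..pi} (\<lambda>t. f t * (ext0 G x t - ext0 K t x)))
           sequentially
       \<and> (\<forall>x\<in>{0..pi}.
           integral {0..pi} (\<lambda>t. f t * (ext0 G x t - ext0 K t x))
           = - integral {0..pi} (\<lambda>t. f t *
                 (kernel_F c lam x t + integral {0..x} (\<lambda>s. G x s * kernel_F c lam s t))))"
proof
  show "uniform_limit {0..pi}
           (\<lambda>N x. integral {0..pi} (\<lambda>t. f t * partial_I c lam N x t))
           (\<lambda>x. integral {0..pi} (\<lambda>t. f t * (ext0 G x t - ext0 K t x))) sequentially"
    unfolding integral_partial_I
    by (rule uniform_limit_cong'[THEN iffD1, OF _ _ uniform_limit_P]) (simp_all add: integral_ext0)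
qed (simp add: integral_ext0 W_eq_kernel_F)

end

end

section \<open>Reduction to a Borel measurable potential\<close>

lemma L2_0pi_borel_representative:
  assumes "L2_0pi q"
  obtains p where "p \<in> borel_measurable borel" "AE x in lebesgue_on {0<..<pi}. q x = p x"
    "(\<lambda>x. complex_of_real (p x)) absolutely_integrable_on {0..pi}" "(\<lambda>x. (p x)\<^sup>2) integrable_on {0..pi}"
proof -
  have q: "q \<in> borel_measurable (lebesgue_on {0<..<pi})" "integrable (lebesgue_on {0<..<pi}) (\<lambda>x. (q x)\<^sup>2)"
    using assms by (auto simp: L2_0pi_def)
  have "(\<lambda>x. if x \<in> {0<..<pi} then q x else 0) \<in> borel_measurable lebesgue"
    using q(1) by (subst borel_measurable_if) auto
  then obtain p where p: "p \<in> borel_measurable lborel" "AE x in lborel. (if x \<in> {0<..<pi} then q x else 0) = p x"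
    using completion_ex_borel_measurable_real by blast
  have ae: "AE x in lebesgue_on {0<..<pi}. q x = p x"
    using AE_completion[OF p(2)] by (subst AE_restrict_space_iff) (auto elim!: eventually_mono)
  obtain N where N: "negligible N" "\<And>x. x \<in> {0..pi} - N \<Longrightarrow> x \<in> {0<..<pi} \<and> q x = p x"
    using AE_lebesgue_on_imp_negligible[OF ae] by blast
  have "(\<lambda>x. (q x)\<^sup>2) integrable_on {0<..<pi}" by (rule integrable_on_lebesgue_on[OF q(2)]) auto
  then have "(\<lambda>x. (q x)\<^sup>2) integrable_on {0..pi}" by (simp add: integrable_on_open_interval_real)
  then have p2: "(\<lambda>x. (p x)\<^sup>2) integrable_on {0..pi}"
    by (rule integrable_spike[OF _ N(1)]) (use N(2) in auto)
  have pb: "p \<in> borel_measurable borel" using p(1) by simp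
  have "(\<lambda>x. complex_of_real (p x)) absolutely_integrable_on {0..pi}"
  proof (rule measurable_bounded_by_integrable_imp_absolutely_integrable)
    have "(\<lambda>x. complex_of_real (p x)) \<in> borel_measurable borel"
      by (intro measurable_compose[OF pb] borel_measurable_continuous_onI continuous_intros)
    then show "(\<lambda>x. complex_of_real (p x)) \<in> borel_measurable (lebesgue_on {0..pi})"
      by (intro measurable_restrict_space1 measurable_completion) simp
    show "(\<lambda>x. 1 + (p x)\<^sup>2) integrable_on {0..pi}" by (intro integrable_add p2 integrable_const_ivl)
    \<comment> \<open>On a bounded interval square integrability implies integrability through this
      inequality.\<close>
    show "norm (complex_of_real (p x)) \<le> 1 + (p x)\<^sup>2" for x
    proof -
      have "0 \<le> (\<bar>p x\<bar> - 1 / 2)\<^sup>2" by simp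
      then show ?thesis by (simp add: power2_diff power_divide)
    qed
  qed auto
  then show thesis using that pb ae p2 by blast
qed

text \<open>The potential occurs in \<open>sl_eq\<close> only inside the almost everywhere clause,
  so a change on a null set alters nothing.\<close>

lemma sl_eq_AE_cong:
  assumes "AE x in lebesgue_on {0<..<pi}. q x = p x"
  shows "sl_eq q = sl_eq p"
proof (intro ext)
  fix y g
  have "(AE x in lebesgue_on {0<..<pi}. (dx y has_vector_derivative (complex_of_real (q x) * y x + g x)) (at x))
    \<longleftrightarrow> (AE x in lebesgue_on {0<..<pi}. (dx y has_vector_derivative (complex_of_real (p x) * y x + g x)) (at x))"
    using assms by (intro eventually_cong[OF _ _]) auto
  then show "sl_eq q y g = sl_eq p y g" unfolding sl_eq_def by simp
qed

theorem theorem2: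
  fixes q :: "real \<Rightarrow> real" and h H :: real
    and c :: "complex \<Rightarrow> real \<Rightarrow> complex" and lam :: "nat \<Rightarrow> real"
    and G K :: "real \<Rightarrow> real \<Rightarrow> complex" and f :: "real \<Rightarrow> complex"
  assumes "L2_0pi q"
    and "\<And>\<rho>. cauchy_solution q h \<rho> (c \<rho>)"
    and "eigenvalue_enumeration q h H lam"
    and "transmutation_kernel q c G"
    and "inverse_kernel G K"
    and "abs_cont_on 0 pi f"
  shows "uniform_limit {0..pi}
           (\<lambda>N x. integral {0..pi} (\<lambda>t. f t * partial_I c lam N x t))
           (\<lambda>x. integral {0..pi} (\<lambda>t. f t * (ext0 G x t - ext0 K t x)))
           sequentially
       \<and> (\<forall>x\<in>{0..pi}.
           integral {0..pi} (\<lambda>t. f t * (ext0 G x t - ext0 K t x))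
           = - integral {0..pi} (\<lambda>t. f t *
                 (kernel_F c lam x t + integral {0..x} (\<lambda>s. G x s * kernel_F c lam s t))))"
proof -
  obtain p where p: "p \<in> borel_measurable borel" "AE x in lebesgue_on {0<..<pi}. q x = p x"
    "(\<lambda>x. complex_of_real (p x)) absolutely_integrable_on {0..pi}" "(\<lambda>x. (p x)\<^sup>2) integrable_on {0..pi}"
    using L2_0pi_borel_representative[OF assms(1)] by metis
  note sl = sl_eq_AE_cong[OF p(2)]
  \<comment> \<open>In the Cauchy problem and in the eigenvalue problem \<open>q\<close> enters only
    through \<open>sl_eq\<close>, so both transfer to the representative \<open>p\<close>.\<close>
  interpret sturm_liouville p h H c lam G K
  proof
    show "cauchy_solution p h \<rho> (c \<rho>)" for \<rho>
      using assms(2)[of \<rho>] by (simp add: cauchy_solution_def sl)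
    show "eigenvalue_enumeration p h H lam"
      using assms(3) by (simp add: eigenvalue_enumeration_def sl_eigenvalue_def sl)
    show "continuous_kernel G" "\<And>\<rho> x. x \<in> {0..pi} \<Longrightarrow> volterra G (\<lambda>s. cos (\<rho> * of_real s)) x = c \<rho> x"
      using assms(4) by (simp_all add: transmutation_kernel_def)
  qed (use p assms(5) in auto)
  show ?thesis
    by (rule kernel_series[OF abs_cont_on_imp_continuous_on[OF assms(6)]])
qed

end
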